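(* Let $N$ be a positive integer and let $r\ge1$ be an integer. Let $(a_n)_{n\ge0}$ be positive and $(b_n)_{n\ge0}$ real. Suppose that for each $i\in\{0,1,\ldots,N-1\}$, $$\Big(\frac{a_{jN+i-1}}{a_{jN+i}} : j\in\mathbb{N}\Big),\ \Big(\frac{b_{jN+i}}{a_{jN+i}} : j\in\mathbb{N}_0\Big),\ \Big(\frac{1}{a_{jN+i}} : j\in\mathbb{N}_0\Big)\in\mathcal{D}_r,$$ and $$\lim_{n\to\infty}\frac{a_{n-1}}{a_n}=1,\qquad \lim_{n\to\infty}\frac{b_n}{a_n}=q,\qquad \lim_{n\to\infty}a_n=\infty.$$ If $|q|<2$ with $$q\notin\big\{2\cos\big(j\tfrac{\pi}{N}\big) : j=1,2,\ldots,N-1\big\},$$ and the Carleman condition $\sum_{n=0}^\infty\frac{1}{a_n}=\infty$ is satisfied, then $$\lim_{n\to\infty}\bigg(\sum_{j=0}^n\frac{1}{a_j}\bigg)^{-1}\sum_{j=0}^np_j^2(x)=\frac{1}{\pi\sqrt{4-q^2}\,\mu'(x)}$$ locally uniformly with respect to $x\in\mathbb{R}$.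
   Context: The polynomials $(p_n)_{n\ge 0}$ are defined by $p_0(x)=1$, $p_1(x)=(x-b_0)/a_0$, and $x p_n(x) = a_n p_{n+1}(x)+b_n p_n(x)+a_{n-1}p_{n-1}(x)$ for $n\ge1$. Under the Carleman condition there is a unique probability measure $\mu$ on $\mathbb{R}$ for which $(p_n)$ is orthonormal in $L^2(\mathbb{R},\mu)$. It is a known fact that, under the hypotheses of the claim, $\mu$ is purely absolutely continuous on $\mathbb{R}$ with continuous positive density; $\mu'$ denotes this density. Stolz class: a real sequence $(x_n)$ belongs to $\mathcal{D}_r$ if it is bounded and for each $j\in\{1,\ldots,r\}$, $\sum_{n}|\Delta^jx_n|^{r/j}<\infty$, where $\Delta^0x_n=x_n$, $\Delta^jx_n=\Delta^{j-1}x_{n+1}-\Delta^{j-1}x_n$. *)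

theory Defs
  imports
    "HOL-Probability.Probability"
    "HOL-Computational_Algebra.Polynomial"
begin

fun orth_poly :: "(nat \<Rightarrow> real) \<Rightarrow> (nat \<Rightarrow> real) \<Rightarrow> nat \<Rightarrow> real poly" where
  "orth_poly a b 0 = 1"
| "orth_poly a b (Suc 0) = smult (1 / a 0) [:- b 0, 1:]"
| "orth_poly a b (Suc (Suc n)) = smult (1 / a (Suc n))
     ([:- b (Suc n), 1:] * orth_poly a b (Suc n) - smult (a n) (orth_poly a b n))"

lemma poly_orth_poly_0: "poly (orth_poly a b 0) x = 1"
  by simp

lemma poly_orth_poly_1: "poly (orth_poly a b 1) x = (x - b 0) / a 0"
  by (simp add: diff_divide_distrib)

text \<open>The three-term recurrence; \<open>orth_poly\<close> is this relation solved for its leading term.\<close>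

lemma poly_orth_poly_recurrence:
  assumes "a n \<noteq> 0" "1 \<le> n"
  shows "x * poly (orth_poly a b n) x =
           a n * poly (orth_poly a b (n + 1)) x + b n * poly (orth_poly a b n) x
             + a (n - 1) * poly (orth_poly a b (n - 1)) x"
  using assms by (cases n) (auto simp: field_simps)

definition orthonormality_measure :: "(nat \<Rightarrow> real) \<Rightarrow> (nat \<Rightarrow> real) \<Rightarrow> real measure \<Rightarrow> bool" where
  "orthonormality_measure a b M \<longleftrightarrow>
     prob_space M \<and> sets M = sets borel \<and>
     (\<forall>m n. has_bochner_integral M
        (\<lambda>x. poly (orth_poly a b m) x * poly (orth_poly a b n) x) (if m = n then 1 else 0))"

definition is_continuous_density :: "real measure \<Rightarrow> (real \<Rightarrow> real) \<Rightarrow> bool" where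
  "is_continuous_density M w \<longleftrightarrow>
     continuous_on UNIV w \<and> (\<forall>x. 0 < w x) \<and> M = density lborel (\<lambda>x. ennreal (w x))"

text \<open>A Radon--Nikodym derivative is only determined almost everywhere, so \<open>RN_deriv\<close> has no
  meaningful pointwise values; the continuous representative does, and it is unique
  by \<open>is_continuous_density_unique\<close> below.\<close>

definition continuous_density :: "real measure \<Rightarrow> real \<Rightarrow> real" where
  "continuous_density M = (THE w. is_continuous_density M w)"

lemma is_continuous_density_unique:
  assumes v: "is_continuous_density M v" and w: "is_continuous_density M w"
  shows "v = w"
proof -
  have cv: "continuous_on UNIV v" and cw: "continuous_on UNIV w"
    and pv: "0 < v x" and pw: "0 < w x" for x
    using v w by (auto simp: is_continuous_density_def)
  have [measurable]: "v \<in> borel_measurable borel" "w \<in> borel_measurable borel"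
    using cv cw by (auto intro: borel_measurable_continuous_onI)
  have "density lborel (\<lambda>x. ennreal (v x)) = density lborel (\<lambda>x. ennreal (w x))"
    using v w by (simp add: is_continuous_density_def)
  then have "AE x in lborel. ennreal (v x) = ennreal (w x)"
    by (subst (asm) sigma_finite_measure.density_unique_iff[OF sigma_finite_lborel]) auto
  then have "AE x in lborel. v x = w x"
    by eventually_elim (metis ennreal_inj less_imp_le pv pw)
  then have "AE x in lebesgue. x \<in> {x. v x = w x}"
    by (auto intro: AE_completion)
  moreover have "closed {x. v x = w x}"
    using cv cw by (rule closed_Collect_eq)
  ultimately show ?thesis
    using mem_closed_if_AE_lebesgue by blast
qed

lemma continuous_density_eqI:
  "is_continuous_density M w \<Longrightarrow> continuous_density M = w"
  unfolding continuous_density_def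
  by (rule the_equality) (auto intro: is_continuous_density_unique)

primrec fwd_diff :: "nat \<Rightarrow> (nat \<Rightarrow> real) \<Rightarrow> nat \<Rightarrow> real" where
  "fwd_diff 0 x n = x n"
| "fwd_diff (Suc j) x n = fwd_diff j x (Suc n) - fwd_diff j x n"

text \<open>Only exponents \<open>r / j > 0\<close> occur below, so \<open>0 powr (r / j) = 0\<close> is the correct value.\<close>

definition stolz_class :: "nat \<Rightarrow> (nat \<Rightarrow> real) set" where
  "stolz_class r = {x. bounded (range x) \<and>
     (\<forall>j\<in>{1..r}. summable (\<lambda>n. \<bar>fwd_diff j x n\<bar> powr (real r / real j)))}"

end

(* Put U_n = a_n (p_n^2 + q p_n p_{n+1} + p_{n+1}^2); for the root s of s^2 - q s + 1 = 0 with
   Im s > 0 the bracket is |s p_n + p_{n+1}|^2.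

   The N-step transfer matrices act on s by elliptic Moebius maps F_j whose coefficients vary slowly.
   Starting from the fixed points of F_j, r Newton steps yield s_j -> s with
   sum_j |F_j(s_{j+1}) - s_j| < infinity; since |s v_1 + v_2|^2 / Im s transforms by the determinant,
   log U_n converges locally uniformly, say U_n -> g > 0.

   The weight w_n = sqrt(4 - q^2) / (2 pi U_n) is of Bernstein-Szego type: p_0, ..., p_n are orthonormal
   for it, because p_j / (p_{n+1} + s p_n) is holomorphic in the upper half plane. Bessel's inequality
   for 1/(t - z) and the Carleman condition force the Stieltjes transforms of w_n dx to converge to that
   of mu, hence mu = sqrt(4 - q^2) / (2 pi g) dx.

   Weighted by 1/a_n, the Cesaro means of U_n agree asymptotically with those of (2 - q^2/2) a_n p_n^2,
   since the recurrence makes the difference a telescoping sum up to lower order. *)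

theory Submission
  imports
    Defs
    "HOL-Library.Landau_Symbols"
    "HOL-Complex_Analysis.Complex_Analysis"
begin

section \<open>Slowly varying families\<close>

text \<open>Elliptic maps do not contract: at its fixed point the limiting N-step map has a
  derivative of modulus one, so errors committed at each step are never damped and have to be
  summed. The exact fixed points move by O(h) per step, whereas only the sum of \<open>h ^ r\<close>
  is known to converge. Hence r orders must be gained: the exact fixed point contributes the first,
  each of r - 1 corrections one more.

  A correction divides by 1 minus the derivative, and the derivative tends to 1 / \<lambda>^2 with
  \<lambda> = \<open>\<omega> ^ N\<close>. The excluded values of q are exactly those with
  \<lambda>^2 = 1. The determinant of an N-step matrix is a quotient of two values of a, which is
  why the factor a_n belongs into U_n.

  Absolute continuity of mu comes out as a by-product: g is a locally uniform limit of continuous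
  functions and is positive as an exponential, so the density found is continuous and positive. In
  the final constant, one factor sqrt(4 - q^2) stems from this density and 4 - q^2 from the passage
  to averages of squares.\<close>

text \<open>The control sequence \<open>h\<close> turns the Stolz conditions into pointwise bounds
  \<open>\<Delta>\<^sup>k f = O(h\<^sup>k)\<close>, uniformly over the parameter set; for these the Leibniz rule replaces
  Hoelder's inequality.\<close>

locale slow_scale =
  fixes h :: "nat \<Rightarrow> real" and K :: "'x set"
  assumes h_nonneg: "h j \<ge> 0"
    and h_Suc: "h (Suc j) \<le> 2 * h j"
    and h_tendsto: "h \<longlonglongrightarrow> 0"
begin

text \<open>Convergence along \<open>F\<close> is convergence in the index, uniform over the
  parameters in \<open>K\<close>, since \<open>principal K\<close> admits no shrinking. The general
  limit and Landau lemmas thereby deliver uniform estimates.\<close>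

definition F :: "(nat \<times> 'x) filter"
  where "F = sequentially \<times>\<^sub>F principal K"

definition sh :: "nat \<times> 'x \<Rightarrow> nat \<times> 'x"
  where "sh p = (Suc (fst p), snd p)"

abbreviation ord_le :: "nat \<Rightarrow> (nat \<times> 'x \<Rightarrow> complex) \<Rightarrow> bool"
  where "ord_le m f \<equiv> f \<in> O[F](\<lambda>p. complex_of_real (h (fst p)) ^ m)"

lemma filterlim_sh: "filterlim sh F F"
  unfolding F_def sh_def [abs_def]
  by (intro filterlim_Pair filterlim_snd filterlim_compose[OF filterlim_Suc filterlim_fst])

lemma eventually_sh: "eventually P F \<Longrightarrow> eventually (\<lambda>p. P (sh p)) F"
  using filterlim_sh by (simp add: filterlim_iff)

lemma tendsto_sh: "(f \<longlongrightarrow> c) F \<Longrightarrow> ((\<lambda>p. f (sh p)) \<longlongrightarrow> c) F"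
  by (rule filterlim_compose[OF _ filterlim_sh])

lemma h_tendsto_F: "((\<lambda>p. complex_of_real (h (fst p))) \<longlongrightarrow> 0) F"
proof -
  have "filterlim fst sequentially F"
    unfolding F_def by (rule filterlim_fst)
  then have "((\<lambda>p. h (fst p)) \<longlongrightarrow> 0) F"
    by (rule filterlim_compose[OF h_tendsto])
  then show ?thesis
    using tendsto_of_real[of "\<lambda>p. h (fst p)" 0 F, where ?'a = complex] by simp
qed

lemma ord_le_0I: "(f \<longlongrightarrow> c) F \<Longrightarrow> ord_le 0 f"
  by (rule bigoI_tendsto[where c = c]) auto

lemma ord_le_mono:
  assumes "ord_le m f" "l \<le> m" shows "ord_le l f"
proof -
  have "(\<lambda>p. complex_of_real (h (fst p)) ^ m) \<in> O[F](\<lambda>p. complex_of_real (h (fst p)) ^ l)"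
  proof (rule bigoI[where c = 1])
    have "\<forall>\<^sub>F p in F. norm (complex_of_real (h (fst p))) < 1"
      using order_tendstoD(2)[OF tendsto_norm[OF h_tendsto_F], of 1] by simp
    then show "\<forall>\<^sub>F p in F. norm (complex_of_real (h (fst p)) ^ m)
        \<le> 1 * norm (complex_of_real (h (fst p)) ^ l)"
    proof eventually_elim
      case (elim p)
      then show ?case
        using power_decreasing[OF assms(2) norm_ge_zero, of "complex_of_real (h (fst p))"]
        by (simp only: norm_power mult_1)
    qed
  qed
  then show ?thesis by (rule landau_o.big_trans[OF assms(1)])
qed

text \<open>The doubling bound on \<open>h\<close> enters here: passing to the next index costs a
  factor \<open>2 ^ m\<close>, which the Landau class absorbs.\<close>

lemma ord_le_shift:
  assumes "ord_le m f" shows "ord_le m (\<lambda>p. f (sh p))"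
proof -
  have "(\<lambda>p. f (sh p)) \<in> O[F](\<lambda>p. complex_of_real (h (fst (sh p))) ^ m)"
    using landau_o.big.compose[OF assms filterlim_sh] .
  moreover have "(\<lambda>p. complex_of_real (h (fst (sh p))) ^ m) \<in> O[F](\<lambda>p. complex_of_real (h (fst p)) ^ m)"
  proof (rule bigoI[where c = "2 ^ m"], rule always_eventually, rule allI)
    fix p :: "nat \<times> 'x"
    have "h (Suc (fst p)) ^ m \<le> (2 * h (fst p)) ^ m"
      by (intro power_mono h_Suc h_nonneg)
    then show "norm (complex_of_real (h (fst (sh p))) ^ m)
        \<le> 2 ^ m * norm (complex_of_real (h (fst p)) ^ m)"
      by (simp add: sh_def norm_power h_nonneg power_mult_distrib)
  qed
  ultimately show ?thesis by (rule landau_o.big_trans)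
qed

lemma ord_le_mult:
  assumes "ord_le m f" "ord_le l g" shows "ord_le (m + l) (\<lambda>p. f p * g p)"
  using landau_o.big_mult[OF assms] by (simp add: power_add)

lemma ord_le_tendsto_0:
  assumes "ord_le (Suc m) f" shows "(f \<longlongrightarrow> 0) F"
proof -
  have "ord_le 1 f" using ord_le_mono[OF assms, of 1] by simp
  then have "f \<in> O[F](\<lambda>p. complex_of_real (h (fst p)))" by simp
  moreover have "(\<lambda>p. complex_of_real (h (fst p))) \<in> o[F](\<lambda>_. 1)"
    by (rule smalloI_tendsto) (use h_tendsto_F in auto)
  ultimately have "f \<in> o[F](\<lambda>_. 1)" by (rule landau_o.big_small_trans)
  from smalloD_tendsto[OF this] show ?thesis by simp
qed

text \<open>\<open>slow k m f\<close> means \<open>\<Delta>\<^sup>i f = O(h\<^sup>m\<^sup>+\<^sup>i)\<close> for \<open>i \<le> k\<close>.\<close>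

primrec slow :: "nat \<Rightarrow> nat \<Rightarrow> (nat \<times> 'x \<Rightarrow> complex) \<Rightarrow> bool" where
  "slow 0 m f = ord_le m f"
| "slow (Suc k) m f = (ord_le m f \<and> slow k (Suc m) (\<lambda>p. f (sh p) - f p))"

lemma slow_ord: "slow k m f \<Longrightarrow> ord_le m f"
  by (cases k) auto

text \<open>Quotients are rearranged below only where denominators are nonzero, that is eventually.
  An eventual identity passes to all differences because \<open>F\<close> is stable under
  \<open>sh\<close>.\<close>

lemma slow_cong:
  assumes "slow k m f" "eventually (\<lambda>p. f p = g p) F"
  shows "slow k m g"
  using assms
proof (induction k arbitrary: m f g)
  case 0
  then show ?case using landau_o.big.in_cong[of f g F] by simp
next
  case (Suc k)
  have "eventually (\<lambda>p. f (sh p) - f p = g (sh p) - g p) F"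
    using Suc.prems(2) eventually_sh[OF Suc.prems(2)] by eventually_elim auto
  moreover have "ord_le m g"
    using Suc.prems landau_o.big.in_cong[of f g F] by simp
  ultimately show ?case
    using Suc.IH[of "Suc m" "\<lambda>p. f (sh p) - f p"] Suc.prems(1) by simp
qed

lemma slow_mono_ord: "slow k m f \<Longrightarrow> l \<le> m \<Longrightarrow> slow k l f"
proof (induction k arbitrary: m l f)
  case 0
  then show ?case using ord_le_mono[of f m l] by simp
next
  case (Suc k)
  then show ?case using ord_le_mono[of f m l] Suc.IH[of "Suc m" "\<lambda>p. f (sh p) - f p" "Suc l"] by simp
qed

lemma slow_lower: "slow (Suc k) m f \<Longrightarrow> slow k m f"
proof (induction k arbitrary: m f)
  case (Suc k)
  from Suc.prems have "slow (Suc k) (Suc m) (\<lambda>p. f (sh p) - f p)"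
    by (simp only: slow.simps(2)[of "Suc k"])
  from Suc.IH[OF this] show ?case using Suc.prems by (simp only: slow.simps(2))
qed simp

lemma slow_shift: "slow k m f \<Longrightarrow> slow k m (\<lambda>p. f (sh p))"
proof (induction k arbitrary: m f)
  case (Suc k)
  from Suc.prems have "slow k (Suc m) (\<lambda>p. f (sh p) - f p)" by simp
  from Suc.IH[OF this] have "slow k (Suc m) (\<lambda>p. f (sh (sh p)) - f (sh p))" .
  moreover have "ord_le m (\<lambda>p. f (sh p))"
    by (rule ord_le_shift) (use Suc.prems in simp)
  ultimately show ?case by simp
qed (simp add: ord_le_shift)

lemma slow_diff_shift: "slow (Suc k) m f \<Longrightarrow> slow k (Suc m) (\<lambda>p. f (sh p) - f p)"
  by simp

lemma slow_add: "slow k m f \<Longrightarrow> slow k m g \<Longrightarrow> slow k m (\<lambda>p. f p + g p)"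
proof (induction k arbitrary: m f g)
  case 0
  then show ?case by (simp only: slow.simps sum_in_bigo(1))
next
  case (Suc k)
  have "slow k (Suc m) (\<lambda>p. (f (sh p) - f p) + (g (sh p) - g p))"
    by (rule Suc.IH) (use Suc.prems in simp_all)
  moreover have "ord_le m (\<lambda>p. f p + g p)"
    by (rule sum_in_bigo(1)) (use Suc.prems in simp_all)
  ultimately show ?case by (simp add: algebra_simps)
qed

lemma slow_uminus: "slow k m f \<Longrightarrow> slow k m (\<lambda>p. - f p)"
proof (induction k arbitrary: m f)
  case (Suc k)
  have "slow k (Suc m) (\<lambda>p. - (f (sh p) - f p))"
    by (rule Suc.IH) (use Suc.prems in auto)
  then show ?case using Suc.prems by (auto simp: algebra_simps)
qed auto

lemma slow_diff: "slow k m f \<Longrightarrow> slow k m g \<Longrightarrow> slow k m (\<lambda>p. f p - g p)"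
  using slow_add[of k m f "\<lambda>p. - g p"] slow_uminus[of k m g] by simp

text \<open>Discrete Leibniz rule: the difference of f g is the difference of f times the shifted g,
  plus f times the difference of g. Both terms have one order more and one level of differences
  less.\<close>

lemma slow_mult: "slow k m f \<Longrightarrow> slow k l g \<Longrightarrow> slow k (m + l) (\<lambda>p. f p * g p)"
proof (induction k arbitrary: m l f g)
  case 0
  then show ?case using ord_le_mult[of f m g l] by (simp only: slow.simps)
next
  case (Suc k)
  have "slow k (Suc m + l) (\<lambda>p. (f (sh p) - f p) * g (sh p))"
    by (rule Suc.IH[OF slow_diff_shift slow_shift[OF slow_lower]]) (rule Suc.prems)+
  moreover have "slow k (m + Suc l) (\<lambda>p. f p * (g (sh p) - g p))"
    by (rule Suc.IH[OF slow_lower slow_diff_shift]) (rule Suc.prems)+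
  ultimately have "slow k (Suc (m + l))
      (\<lambda>p. (f (sh p) - f p) * g (sh p) + f p * (g (sh p) - g p))"
    unfolding add_Suc add_Suc_right by (rule slow_add)
  moreover have "(\<lambda>p. (f (sh p) - f p) * g (sh p) + f p * (g (sh p) - g p))
      = (\<lambda>p. f (sh p) * g (sh p) - f p * g p)"
    by (simp add: algebra_simps)
  moreover have "ord_le (m + l) (\<lambda>p. f p * g p)"
    using Suc.prems by (intro ord_le_mult slow_ord)
  ultimately show ?case by (simp only: slow.simps simp_thms)
qed

lemma slow_mult_0: "slow k 0 f \<Longrightarrow> slow k m g \<Longrightarrow> slow k m (\<lambda>p. f p * g p)"
  using slow_mult[of k 0 f m g] by simp

lemma slow_zero: "slow k m (\<lambda>_. 0)"
  by (induction k arbitrary: m) auto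

text \<open>Differences in the index annihilate functions of the parameter, so only boundedness
  remains to be checked. This brings the spectral variable x into the coefficients (x - b_n) /
  a_n.\<close>

lemma slow_bounded_param:
  assumes "\<And>x. x \<in> K \<Longrightarrow> norm (c x) \<le> M"
  shows "slow k 0 (\<lambda>p. c (snd p))"
proof -
  have "eventually (\<lambda>p. snd p \<in> K) F"
    using filterlim_snd[of "principal K" sequentially] by (auto simp: F_def filterlim_principal)
  then have "ord_le 0 (\<lambda>p. c (snd p))"
    by (intro bigoI[where c = M]) (auto elim!: eventually_mono intro: assms)
  then show ?thesis by (cases k) (auto simp: sh_def slow_zero)
qed

lemma slow_const: "slow k 0 (\<lambda>_. c)"
  using slow_bounded_param[of "\<lambda>_. c" "norm c"] by simp

text \<open>Induction on the level of differences: with f' the shift of f, the difference of 1 / f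
  is - (f' - f) / (f f'), and the reciprocals on the right are needed at one level less.\<close>

lemma slow_inverse:
  assumes "slow k 0 f" "(f \<longlongrightarrow> c) F" "c \<noteq> 0"
  shows "slow k 0 (\<lambda>p. inverse (f p))"
  using assms(1)
proof (induction k)
  case 0
  have "((\<lambda>p. inverse (f p)) \<longlongrightarrow> inverse c) F"
    using assms by (intro tendsto_inverse) auto
  then show ?case using ord_le_0I by simp
next
  case (Suc k)
  have nz: "eventually (\<lambda>p. f p \<noteq> 0) F"
    using tendsto_imp_eventually_ne[OF assms(2,3)] .
  have "slow k 0 (\<lambda>p. inverse (f p))" by (rule Suc.IH[OF slow_lower[OF Suc.prems]])
  then have "slow k (Suc 0)
     (\<lambda>p. inverse (f p) * (inverse (f (sh p)) * - (f (sh p) - f p)))"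
    using Suc.prems by (intro slow_mult_0 slow_uminus slow_shift) auto
  then have "slow k (Suc 0) (\<lambda>p. inverse (f (sh p)) - inverse (f p))"
    by (rule slow_cong) (use nz eventually_sh[OF nz] in eventually_elim, auto simp: field_simps)
  moreover have "((\<lambda>p. inverse (f p)) \<longlongrightarrow> inverse c) F"
    using assms by (intro tendsto_inverse) auto
  ultimately show ?case using ord_le_0I by simp
qed

text \<open>As for reciprocals, from sqrt f' - sqrt f = (f' - f) / (sqrt f + sqrt f') with f' the
  shift of f. A limit off the branch cut gives continuity of \<open>csqrt\<close> there and keeps
  the denominator away from 0.\<close>

lemma slow_csqrt:
  assumes "slow k 0 f" "(f \<longlongrightarrow> c) F" "c \<notin> \<real>\<^sub>\<le>\<^sub>0"
  shows "slow k 0 (\<lambda>p. csqrt (f p))"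
proof -
  have lim: "((\<lambda>p. csqrt (f p)) \<longlongrightarrow> csqrt c) F"
    using assms isCont_tendsto_compose[OF continuous_at_csqrt] by blast
  have c0: "csqrt c \<noteq> 0" using assms(3) by auto
  show ?thesis
    using assms(1)
  proof (induction k)
    case 0
    then show ?case using ord_le_0I[OF lim] by simp
  next
    case (Suc k)
    let ?y = "\<lambda>p. csqrt (f p)"
    have limy: "((\<lambda>p. ?y p + ?y (sh p)) \<longlongrightarrow> csqrt c + csqrt c) F"
      by (intro tendsto_add lim tendsto_sh[OF lim])
    have nz: "eventually (\<lambda>p. ?y p + ?y (sh p) \<noteq> 0) F"
      using tendsto_imp_eventually_ne[OF limy, of 0] c0 by auto
    have sy: "slow k 0 ?y" by (rule Suc.IH[OF slow_lower[OF Suc.prems]])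
    have "slow k 0 (\<lambda>p. inverse (?y p + ?y (sh p)))"
      by (rule slow_inverse[OF _ limy]) (use c0 in \<open>simp_all add: slow_add[OF sy slow_shift[OF sy]]\<close>)
    then have "slow k (Suc 0) (\<lambda>p. inverse (?y p + ?y (sh p)) * (f (sh p) - f p))"
      by (rule slow_mult_0) (use Suc.prems in auto)
    then have "slow k (Suc 0) (\<lambda>p. ?y (sh p) - ?y p)"
    proof (rule slow_cong)
      show "\<forall>\<^sub>F p in F. inverse (?y p + ?y (sh p)) * (f (sh p) - f p) = ?y (sh p) - ?y p"
        using nz
      proof eventually_elim
        case (elim p)
        have "f (sh p) - f p = (?y (sh p))\<^sup>2 - (?y p)\<^sup>2" by simp
        also have "\<dots> = (?y p + ?y (sh p)) * (?y (sh p) - ?y p)"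
          by (simp only: power2_eq_square) (simp add: algebra_simps)
        finally have "f (sh p) - f p = (?y p + ?y (sh p)) * (?y (sh p) - ?y p)" .
        then show ?case using elim by simp
      qed
    qed
    then show ?case using ord_le_0I[OF lim] by simp
  qed
qed

lemma slow_divide:
  assumes "slow k m f" "slow k 0 g" "(g \<longlongrightarrow> c) F" "c \<noteq> 0"
  shows "slow k m (\<lambda>p. f p / g p)"
  using slow_mult_0[OF slow_inverse[OF assms(2-4)] assms(1)] by (simp only: divide_inverse mult.commute)

end

section \<open>Approximate fixed points of slowly varying Moebius maps\<close>

text \<open>Put F(t) = (t A + C) / (t B + D). Then \<open>mu\<close> is F'(t), \<open>e\<close> the
  defect F(t) - s, \<open>d\<close> the Newton correction and \<open>d'\<close> its value at the
  next index. The exact second-order expansion of F(t + d') around t, together with e - d = - mu d,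
  leaves mu (d' - d) minus a term quadratic in d' as the new defect.\<close>

lemma newton_identity:
  fixes A B C D :: complex
  assumes e: "e = (t * A + C) / (t * B + D) - s"
    and mu: "mu = (A * D - B * C) / (t * B + D)\<^sup>2"
    and d: "d = e / (1 - mu)"
    and nz: "t * B + D \<noteq> 0" "(t + d') * B + D \<noteq> 0" "1 - mu \<noteq> 0"
  shows "mu * (d' - d) - (A * D - B * C) * B * (d' * d') / ((t * B + D)\<^sup>2 * ((t + d') * B + D))
      = ((t + d') * A + C) / ((t + d') * B + D) - (s + d)"
proof -
  define u where "u = t * B + D"
  define v where "v = (t + d') * B + D"
  have v: "v = u + d' * B" by (simp add: u_def v_def algebra_simps)
  have ed: "e - d = - mu * d" using d nz(3) by (simp add: field_simps)
  have "((t + d') * A + C) / v - (t * A + C) / u = (A * D - B * C) * d' / (u * v)"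
    using nz by (simp add: divide_simps u_def[symmetric] v_def[symmetric])
      (simp add: u_def v_def algebra_simps)
  moreover have "(A * D - B * C) * d' / (u * v)
      = mu * d' - (A * D - B * C) * B * (d' * d') / (u\<^sup>2 * v)"
    using nz unfolding mu u_def[symmetric] v_def[symmetric]
    by (simp add: divide_simps power2_eq_square) (simp add: v algebra_simps)
  moreover have "mu * (d' - d) - T = R - (s + d)"
    if "R - P = Q" "Q = mu * d' - T" "e = P - s" for P Q R T
    using that ed by algebra
  ultimately show ?thesis
    using e unfolding u_def[symmetric] v_def[symmetric] by blast
qed

context slow_scale
begin

text \<open>Both parts of the new defect gain an order: d' - d is a difference, which costs one
  level (\<open>k\<close> for \<open>Suc k\<close>), and d'^2 has order 2 m + 2. As the limiting
  determinant is 1, the divisor 1 - mu tends to 1 - 1 / lam^2, which is nonzero.\<close>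

lemma newton_step:
  assumes slowM: "slow (Suc k) 0 A" "slow (Suc k) 0 B" "slow (Suc k) 0 C" "slow (Suc k) 0 D"
    and limM: "(A \<longlongrightarrow> A0) F" "(B \<longlongrightarrow> B0) F" "(C \<longlongrightarrow> C0) F" "(D \<longlongrightarrow> D0) F"
    and det: "A0 * D0 - B0 * C0 = 1"
    and lam: "\<sigma> * B0 + D0 = lam" "lam \<noteq> 0" "lam\<^sup>2 \<noteq> 1"
    and s: "slow (Suc k) 0 s" "(s \<longlongrightarrow> \<sigma>) F"
    and e: "slow (Suc k) (Suc m) (\<lambda>p. (s (sh p) * A p + C p) / (s (sh p) * B p + D p) - s p)"
  shows "\<exists>s'. slow k 0 s' \<and> (s' \<longlongrightarrow> \<sigma>) F \<and>
    slow k (Suc (Suc m)) (\<lambda>p. (s' (sh p) * A p + C p) / (s' (sh p) * B p + D p) - s' p)"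
proof -
  define e where "e p = (s (sh p) * A p + C p) / (s (sh p) * B p + D p) - s p" for p
  define den where "den p = s (sh p) * B p + D p" for p
  define dt where "dt p = A p * D p - B p * C p" for p
  define mu where "mu p = dt p / (den p * den p)" for p
  define d where "d p = e p / (1 - mu p)" for p
  define s' where "s' p = s p + d p" for p
  define den' where "den' p = s' (sh p) * B p + D p" for p
  have sl_dt: "slow (Suc k) 0 dt"
    unfolding dt_def [abs_def] by (intro slow_diff slow_mult_0 slowM)
  have sl_den: "slow (Suc k) 0 den"
    unfolding den_def [abs_def] by (intro slow_add slow_mult_0 slowM slow_shift[OF s(1)])
  have sl_den2: "slow (Suc k) 0 (\<lambda>p. den p * den p)"
    by (intro slow_mult_0 sl_den)
  have lim_dt: "(dt \<longlongrightarrow> A0 * D0 - B0 * C0) F"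
    unfolding dt_def [abs_def] by (intro tendsto_diff tendsto_mult limM)
  have lim_den: "(den \<longlongrightarrow> \<sigma> * B0 + D0) F"
    unfolding den_def [abs_def] by (intro tendsto_add tendsto_mult limM tendsto_sh[OF s(2)])
  have lim_den: "(den \<longlongrightarrow> lam) F" using lim_den lam(1) by simp
  have lim_den2: "((\<lambda>p. den p * den p) \<longlongrightarrow> lam * lam) F"
    by (intro tendsto_mult lim_den)
  have sl_mu: "slow (Suc k) 0 mu"
    unfolding mu_def [abs_def] by (rule slow_divide[OF sl_dt sl_den2 lim_den2]) (use lam in simp)
  have "(mu \<longlongrightarrow> (A0 * D0 - B0 * C0) / (lam * lam)) F"
    unfolding mu_def [abs_def] by (rule tendsto_divide[OF lim_dt lim_den2]) (use lam in simp)
  then have lim_1mu: "((\<lambda>p. 1 - mu p) \<longlongrightarrow> 1 - 1 / lam\<^sup>2) F"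
    unfolding det power2_eq_square by (intro tendsto_diff tendsto_const)
  have nz: "1 - 1 / lam\<^sup>2 \<noteq> 0" using lam by simp
  have sl_1mu: "slow (Suc k) 0 (\<lambda>p. 1 - mu p)"
    by (intro slow_diff slow_const sl_mu)
  have sl_d: "slow (Suc k) (Suc m) d"
    unfolding d_def [abs_def]
    by (rule slow_divide[OF e[folded e_def] sl_1mu lim_1mu nz])
  have lim_d: "(d \<longlongrightarrow> 0) F"
    by (rule ord_le_tendsto_0[OF slow_ord[OF sl_d]])
  have sl_s': "slow (Suc k) 0 s'"
    unfolding s'_def [abs_def]
    by (intro slow_add s slow_mono_ord[OF sl_d]) simp
  have lim_s': "(s' \<longlongrightarrow> \<sigma>) F"
    using tendsto_add[OF s(2) lim_d] by (simp add: s'_def [abs_def])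
  have sl_den': "slow (Suc k) 0 den'"
    unfolding den'_def [abs_def] by (intro slow_add slow_mult_0 slowM slow_shift[OF sl_s'])
  have "(den' \<longlongrightarrow> \<sigma> * B0 + D0) F"
    unfolding den'_def [abs_def] by (intro tendsto_add tendsto_mult limM tendsto_sh[OF lim_s'])
  then have lim_den': "(den' \<longlongrightarrow> lam) F" using lam(1) by simp
  have sl_q: "slow (Suc k) 0 (\<lambda>p. (den p * den p) * den' p)"
    by (intro slow_mult_0 sl_den sl_den')
  have lim_q: "((\<lambda>p. (den p * den p) * den' p) \<longlongrightarrow> (lam * lam) * lam) F"
    by (intro tendsto_mult lim_den lim_den')
  have "slow (Suc k) (Suc m + Suc m) (\<lambda>p. d (sh p) * d (sh p))"
    by (intro slow_mult slow_shift[OF sl_d])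
  then have "slow k (Suc m + Suc m) (\<lambda>p. d (sh p) * d (sh p))" by (rule slow_lower)
  then have sl_dd: "slow k (Suc (Suc m)) (\<lambda>p. d (sh p) * d (sh p))"
    by (rule slow_mono_ord) simp
  have "slow (Suc k) 0 (\<lambda>p. dt p * B p)"
    by (rule slow_mult_0[OF sl_dt slowM(2)])
  then have "slow k 0 (\<lambda>p. dt p * B p)" by (rule slow_lower)
  then have "slow k (Suc (Suc m)) (\<lambda>p. (dt p * B p) * (d (sh p) * d (sh p)))"
    using sl_dd by (rule slow_mult_0)
  then have "slow k (Suc (Suc m)) (\<lambda>p. (dt p * B p) * (d (sh p) * d (sh p)) / ((den p * den p) * den' p))"
    using slow_lower[OF sl_q] lim_q by (rule slow_divide) (use lam in simp)
  moreover have "slow k (Suc (Suc m)) (\<lambda>p. mu p * (d (sh p) - d p))"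
    by (rule slow_mult_0[OF slow_lower[OF sl_mu] slow_diff_shift[OF sl_d]])
  ultimately have "slow k (Suc (Suc m)) (\<lambda>p. mu p * (d (sh p) - d p)
      - (dt p * B p) * (d (sh p) * d (sh p)) / ((den p * den p) * den' p))"
    by (intro slow_diff)
  then have "slow k (Suc (Suc m))
      (\<lambda>p. (s' (sh p) * A p + C p) / (s' (sh p) * B p + D p) - s' p)"
  proof (rule slow_cong)
    have "\<forall>\<^sub>F p in F. den p \<noteq> 0" "\<forall>\<^sub>F p in F. den' p \<noteq> 0" "\<forall>\<^sub>F p in F. 1 - mu p \<noteq> 0"
      by (intro tendsto_imp_eventually_ne[OF lim_den lam(2)]
          tendsto_imp_eventually_ne[OF lim_den' lam(2)] tendsto_imp_eventually_ne[OF lim_1mu nz])+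
    then show "\<forall>\<^sub>F p in F. mu p * (d (sh p) - d p)
        - (dt p * B p) * (d (sh p) * d (sh p)) / ((den p * den p) * den' p)
        = (s' (sh p) * A p + C p) / (s' (sh p) * B p + D p) - s' p"
    proof eventually_elim
      case (elim p)
      show ?case
        using newton_identity[of "e p" "s (sh p)" "A p" "C p" "B p" "D p" "s p" "mu p" "d p" "d (sh p)"]
          elim by (simp add: e_def d_def mu_def den_def den'_def dt_def s'_def power2_eq_square)
    qed
  qed
  then show ?thesis using slow_lower[OF sl_s'] lim_s' by auto
qed

text \<open>The iteration starts at the exact fixed point of the Moebius map; its defect is of the order of
  the first differences of the coefficients, and every Newton step gains one order.\<close>

lemma ex_almost_fixed_point:
  assumes slowM: "slow r 0 A" "slow r 0 B" "slow r 0 C" "slow r 0 D"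
    and limM: "(A \<longlongrightarrow> of_real A0) F" "(B \<longlongrightarrow> of_real B0) F"
      "(C \<longlongrightarrow> of_real C0) F" "(D \<longlongrightarrow> of_real D0) F"
    and det: "A0 * D0 - B0 * C0 = 1"
    and fp: "\<sigma> * of_real A0 + of_real C0 = lam * \<sigma>"
    and lam: "\<sigma> * of_real B0 + of_real D0 = lam" "lam \<noteq> 0" "lam\<^sup>2 \<noteq> 1"
    and sig: "Im \<sigma> > 0" and r: "r \<ge> 1"
  shows "\<exists>s. (s \<longlongrightarrow> \<sigma>) F \<and>
    ord_le r (\<lambda>p. (s (sh p) * A p + C p) / (s (sh p) * B p + D p) - s p)"
proof -
  \<comment> \<open>If \<open>B0\<close> vanished, \<open>lam\<close> would be the real number
    \<open>D0\<close>; comparing imaginary parts in the fixed point equation gives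
    \<open>A0 = D0\<close>, and the determinant then makes lam^2 = 1.\<close>
  have B0: "B0 \<noteq> 0"
  proof
    assume B0: "B0 = 0"
    then have l: "lam = of_real D0" using lam by simp
    have "Im (\<sigma> * of_real A0 + of_real C0) = Im (lam * \<sigma>)" using fp by simp
    then have "A0 = D0" using sig l by simp
    then show False using det B0 l lam(3) by (simp add: power2_eq_square flip: of_real_mult)
  qed
  \<comment> \<open>The fixed point equation s (s B + D) = s A + C, divided by B and with the square
    completed, reads (s - al)^2 = - u. Since u tends to (Im \<sigma>)^2 > 0, the principal root
    selects the solution near \<sigma>.\<close>
  define al where "al p = (A p - D p) / (2 * B p)" for p
  define u where "u p = - (C p / B p) - al p * al p" for p
  define s where "s p = al p + \<i> * csqrt (u p)" for p
  define al0 where "al0 = (A0 - D0) / (2 * B0)"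
  define u0 where "u0 = - (C0 / B0) - al0 * al0"
  have quad: "\<sigma> * \<sigma> - 2 * of_real al0 * \<sigma> - of_real (C0 / B0) = 0"
  proof -
    have "of_real B0 * (\<sigma> * \<sigma> - 2 * of_real al0 * \<sigma> - of_real (C0 / B0))
      = (\<sigma> * of_real B0 + of_real D0) * \<sigma> - (\<sigma> * of_real A0 + of_real C0)"
      using B0 by (simp add: al0_def field_simps)
    also have "\<dots> = 0" using fp lam(1) by simp
    finally show ?thesis using B0 by simp
  qed
  have re: "Re \<sigma> = al0"
  proof -
    have "Im (\<sigma> * \<sigma> - 2 * of_real al0 * \<sigma> - of_real (C0 / B0)) = 0" using quad by simp
    then have "2 * Im \<sigma> * (Re \<sigma> - al0) = 0" by (simp add: algebra_simps)
    then show ?thesis using sig by simp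
  qed
  have im: "(Im \<sigma>)\<^sup>2 = u0"
  proof -
    have "Re (\<sigma> * \<sigma> - 2 * of_real al0 * \<sigma> - of_real (C0 / B0)) = 0" using quad by simp
    then show ?thesis by (simp add: re u0_def power2_eq_square algebra_simps)
  qed
  have u0: "u0 > 0" unfolding im[symmetric] using sig by simp
  have sigma: "\<sigma> = of_real al0 + \<i> * csqrt (of_real u0)"
    using re sig by (simp add: im[symmetric] complex_eq_iff)
  have slB2: "slow r 0 (\<lambda>p. 2 * B p)"
    by (intro slow_mult_0 slow_const slowM)
  have limB2: "((\<lambda>p. 2 * B p) \<longlongrightarrow> 2 * of_real B0) F"
    by (intro tendsto_intros limM)
  have sl_al: "slow r 0 al"
    unfolding al_def [abs_def]
    by (rule slow_divide[OF slow_diff[OF slowM(1,4)] slB2 limB2]) (use B0 in simp)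
  have "(al \<longlongrightarrow> (of_real A0 - of_real D0) / (2 * of_real B0)) F"
    unfolding al_def [abs_def] by (intro tendsto_divide limB2 tendsto_diff limM) (use B0 in simp)
  then have lim_al: "(al \<longlongrightarrow> of_real al0) F" by (simp add: al0_def)
  have sl_u: "slow r 0 u"
    unfolding u_def [abs_def]
    by (intro slow_diff slow_uminus slow_mult_0 sl_al slow_divide[OF slowM(3,2) limM(2)])
      (use B0 in simp)
  have "(u \<longlongrightarrow> - (of_real C0 / of_real B0) - of_real al0 * of_real al0) F"
    unfolding u_def [abs_def]
    by (intro tendsto_diff tendsto_minus tendsto_mult lim_al tendsto_divide limM) (use B0 in simp)
  then have lim_u: "(u \<longlongrightarrow> of_real u0) F" by (simp add: u0_def)
  have u0_np: "complex_of_real u0 \<notin> \<real>\<^sub>\<le>\<^sub>0" using u0 by simp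
  have sl_s: "slow r 0 s"
    unfolding s_def [abs_def]
    by (intro slow_add sl_al slow_mult_0 slow_const slow_csqrt[OF sl_u lim_u u0_np])
  have lim_s: "(s \<longlongrightarrow> \<sigma>) F"
    unfolding s_def [abs_def] sigma
    by (intro tendsto_add tendsto_mult tendsto_const lim_al
        isCont_tendsto_compose[OF continuous_at_csqrt[OF u0_np] lim_u])
  obtain k where k: "r = Suc k" using r by (cases r) auto
  define t where "t p = s (sh p)" for p
  have sl_t: "slow r 0 t" unfolding t_def [abs_def] by (rule slow_shift[OF sl_s])
  have lim_t: "(t \<longlongrightarrow> \<sigma>) F" unfolding t_def [abs_def] by (rule tendsto_sh[OF lim_s])
  define den where "den p = (t p * B p + D p) * (s p * B p + D p)" for p
  have sl_den: "slow r 0 den"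
    unfolding den_def [abs_def] by (intro slow_add slow_mult_0 slowM sl_t sl_s)
  have limX: "((\<lambda>p. t p * B p + D p) \<longlongrightarrow> lam) F" "((\<lambda>p. s p * B p + D p) \<longlongrightarrow> lam) F"
    unfolding lam(1)[symmetric] by (intro tendsto_add tendsto_mult limM lim_t lim_s)+
  have lim_den: "(den \<longlongrightarrow> lam * lam) F"
    unfolding den_def [abs_def] by (intro tendsto_mult limX)
  have "slow r 0 (\<lambda>p. A p * D p - B p * C p)"
    by (intro slow_diff slow_mult_0 slowM)
  then have "slow k 0 (\<lambda>p. A p * D p - B p * C p)"
    unfolding k by (rule slow_lower)
  moreover have "slow k (Suc 0) (\<lambda>p. s (sh p) - s p)"
    using sl_s unfolding k by (rule slow_diff_shift)
  ultimately have "slow k (Suc 0) (\<lambda>p. (A p * D p - B p * C p) * (s (sh p) - s p))"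
    by (rule slow_mult_0)
  moreover have "slow k 0 den"
    using sl_den unfolding k by (rule slow_lower)
  ultimately have "slow k (Suc 0) (\<lambda>p. (A p * D p - B p * C p) * (s (sh p) - s p) / den p)"
    using lim_den by (rule slow_divide) (use lam in simp)
  \<comment> \<open>As \<open>s p\<close> is fixed exactly, the defect is a difference of two values
    of one Moebius map, that is, the determinant times the difference of \<open>s\<close> over
    \<open>den\<close>.\<close>
  then have e0: "slow k (Suc 0) (\<lambda>p. (s (sh p) * A p + C p) / (s (sh p) * B p + D p) - s p)"
  proof (rule slow_cong)
    have "\<forall>\<^sub>F p in F. t p * B p + D p \<noteq> 0" "\<forall>\<^sub>F p in F. s p * B p + D p \<noteq> 0"
      "\<forall>\<^sub>F p in F. 2 * B p \<noteq> 0"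
      using tendsto_imp_eventually_ne[OF limX(1) lam(2)]
          tendsto_imp_eventually_ne[OF limX(2) lam(2)] tendsto_imp_eventually_ne[OF limB2, of 0] B0
      by simp_all
    then show "\<forall>\<^sub>F p in F. (A p * D p - B p * C p) * (s (sh p) - s p) / den p
        = (s (sh p) * A p + C p) / (s (sh p) * B p + D p) - s p"
    proof eventually_elim
      case (elim p)
      have "(s p - al p) * (s p - al p) = \<i> * \<i> * (csqrt (u p))\<^sup>2"
        by (simp only: s_def power2_eq_square) (simp add: algebra_simps)
      then have "s p * s p - 2 * al p * s p = C p / B p"
        by (simp add: u_def algebra_simps)
      then have "2 * (s p * (s p * B p + D p)) = 2 * (s p * A p + C p)"
        using elim(3) by (simp add: al_def divide_simps) (simp add: algebra_simps)
      then have "s p * (s p * B p + D p) = s p * A p + C p"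
        by (simp only: mult_cancel_left) simp
      then have "s p = (s p * A p + C p) / (s p * B p + D p)"
        using elim(2) by (simp add: field_simps)
      moreover have "(t p * A p + C p) / (t p * B p + D p) - (s p * A p + C p) / (s p * B p + D p)
        = (A p * D p - B p * C p) * (t p - s p) / den p"
        using elim(1,2) unfolding den_def
        by (simp add: divide_simps) (simp add: algebra_simps)
      ultimately show ?case unfolding t_def by simp
    qed
  qed
  \<comment> \<open>After \<open>i\<close> corrections the order is \<open>i + 1\<close> and
    \<open>k - i\<close> levels of differences remain; with \<open>k = r - 1\<close> the levels run
    out exactly when the order reaches \<open>r\<close>.\<close>
  have "i \<le> k \<Longrightarrow> \<exists>s. slow (k - i) 0 s \<and> (s \<longlongrightarrow> \<sigma>) F \<and>
    slow (k - i) (Suc i) (\<lambda>p. (s (sh p) * A p + C p) / (s (sh p) * B p + D p) - s p)" for i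
  proof (induction i)
    case 0
    then show ?case using e0 slow_lower[OF sl_s[unfolded k]] lim_s by auto
  next
    case (Suc i)
    define l where "l = k - Suc i"
    have l: "k - i = Suc l" "r = Suc (Suc l) + i" using Suc.prems by (auto simp: l_def k)
    from Suc obtain s where s: "slow (Suc l) 0 s" "(s \<longlongrightarrow> \<sigma>) F"
      "slow (Suc l) (Suc i) (\<lambda>p. (s (sh p) * A p + C p) / (s (sh p) * B p + D p) - s p)"
      unfolding l(1) by auto
    have low: "slow (Suc l) 0 f" if "slow r 0 f" for f
    proof -
      have "slow (Suc l + j) 0 f \<Longrightarrow> slow (Suc l) 0 f" for j
        by (induction j) (simp_all only: add_0_right add_Suc_right slow_lower)
      from this[of "Suc i"] that show ?thesis unfolding l by simp
    qed
    have "complex_of_real A0 * of_real D0 - of_real B0 * of_real C0 = 1"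
      using det by (simp flip: of_real_mult of_real_diff)
    from newton_step[OF low[OF slowM(1)] low[OF slowM(2)] low[OF slowM(3)] low[OF slowM(4)]
        limM this lam s]
    show ?case unfolding l_def .
  qed
  from this[of k] show ?thesis unfolding k by auto
qed

end

section \<open>Convergence of the energies\<close>

text \<open>Up to a positive factor every positive definite binary quadratic form is of this kind.
  Division by Im s normalises its determinant to 1, so that points of the upper half-plane stand for
  forms.\<close>

definition qform :: "complex \<Rightarrow> real \<Rightarrow> real \<Rightarrow> real"
  where "qform s u v = (cmod (s * of_real u + of_real v))\<^sup>2 / Im s"

lemma qform_ne_0:
  assumes "Im s > 0" "u \<noteq> 0 \<or> v \<noteq> 0" shows "s * of_real u + of_real v \<noteq> 0"
  using assms by (auto simp: complex_eq_iff)

lemma qform_pos: "Im s > 0 \<Longrightarrow> u \<noteq> 0 \<or> v \<noteq> 0 \<Longrightarrow> qform s u v > 0"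
  using qform_ne_0[of s u v] by (simp add: qform_def)

text \<open>With w = s B + D, the substitution turns s u + v into w (s' u + v), while Im s' is Im s
  times the determinant over |w|^2. The factor |w|^2 cancels and only the determinant
  survives.\<close>

lemma qform_transform:
  fixes A B C D :: real
  assumes s: "Im s > 0" and nz: "s * of_real B + of_real D \<noteq> 0"
    and det: "A * D - B * C \<noteq> 0"
    and s': "s' = (s * of_real A + of_real C) / (s * of_real B + of_real D)"
  shows "qform s (A * u + B * v) (C * u + D * v) = (A * D - B * C) * qform s' u v"
proof -
  define w where "w = s * of_real B + of_real D"
  have w: "w \<noteq> 0" using nz by (simp add: w_def)
  have "s' = (s * of_real A + of_real C) * cnj w / of_real ((cmod w)\<^sup>2)"
    unfolding s' w_def[symmetric] by (subst complex_div_cnj) simp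
  moreover have "Im ((s * of_real A + of_real C) * cnj w) = (A * D - B * C) * Im s"
    by (simp add: w_def algebra_simps)
  ultimately have im: "Im s' = (A * D - B * C) * Im s / (cmod w)\<^sup>2"
    by (simp add: Im_divide_of_real)
  have "s * of_real (A * u + B * v) + of_real (C * u + D * v)
      = (s * of_real A + of_real C) * of_real u + w * of_real v"
    by (simp add: w_def algebra_simps)
  also have "\<dots> = w * (s' * of_real u + of_real v)"
    using w unfolding s' w_def[symmetric] by (simp add: field_simps)
  finally have "(cmod (s * of_real (A * u + B * v) + of_real (C * u + D * v)))\<^sup>2
      = (cmod w)\<^sup>2 * (cmod (s' * of_real u + of_real v))\<^sup>2"
    by (simp add: norm_mult power_mult_distrib)
  then show ?thesis
    using w s det unfolding qform_def im by (simp add: field_simps)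
qed

text \<open>Since |u| \<le> |s u + v| / Im s, moving s to t changes the modulus at most by the
  relative amount |t - s| / Im s. The squared modulus accounts for two of the three units in the
  constant, the quotient of Im s and Im t for the third.\<close>

lemma ln_qform_close_aux:
  assumes s: "Im s > 0" "Im t > 0" and uv: "u \<noteq> 0 \<or> v \<noteq> 0"
  shows "ln (qform t u v) - ln (qform s u v) \<le> 3 * cmod (t - s) / min (Im s) (Im t)"
proof -
  define X Y d where "X = cmod (s * of_real u + of_real v)"
    and "Y = cmod (t * of_real u + of_real v)" and "d = cmod (t - s)"
  have pos: "X > 0" "Y > 0" using qform_ne_0[OF s(1) uv] qform_ne_0[OF s(2) uv]
    by (auto simp: X_def Y_def)
  have "Y = cmod ((s * of_real u + of_real v) + (t - s) * of_real u)"
    unfolding Y_def by (rule arg_cong[where f = cmod]) (simp add: algebra_simps)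
  also have "\<dots> \<le> X + cmod ((t - s) * of_real u)"
    unfolding X_def by (rule norm_triangle_ineq)
  finally have Y: "Y \<le> X + d * \<bar>u\<bar>"
    by (simp add: d_def norm_mult)
  have "\<bar>Im (s * of_real u + of_real v)\<bar> \<le> X" unfolding X_def by (rule abs_Im_le_cmod)
  then have "\<bar>u\<bar> \<le> X / Im s" using s by (simp add: abs_mult field_simps)
  then have "d * \<bar>u\<bar> \<le> d * (X / Im s)" by (intro mult_left_mono) (auto simp: d_def)
  then have "Y \<le> X * (1 + d / Im s)" using Y by (simp add: field_simps)
  then have "ln Y \<le> ln (X * (1 + d / Im s))" using pos s by (subst ln_le_cancel_iff) (auto simp: d_def intro!: add_pos_nonneg mult_pos_pos)
  also have "\<dots> = ln X + ln (1 + d / Im s)"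
    using pos s by (subst ln_mult_pos) (auto simp: d_def intro!: add_pos_nonneg)
  also have "ln (1 + d / Im s) \<le> d / Im s"
    using s by (intro ln_add_one_self_le_self) (auto simp: d_def)
  finally have 1: "ln Y - ln X \<le> d / Im s" by simp
  have "ln (Im s) - ln (Im t) = ln (Im s / Im t)" using s by (simp add: ln_div)
  also have "\<dots> \<le> Im s / Im t - 1" using s by (intro ln_le_minus_one) auto
  also have "\<dots> = (Im s - Im t) / Im t" using s by (simp add: field_simps)
  also have "\<dots> \<le> d / Im t"
    using s abs_Im_le_cmod[of "t - s"] by (intro divide_right_mono) (auto simp: d_def)
  finally have 2: "ln (Im s) - ln (Im t) \<le> d / Im t" .
  have "ln (qform t u v) - ln (qform s u v) = 2 * (ln Y - ln X) + (ln (Im s) - ln (Im t))"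
    using pos s unfolding qform_def X_def[symmetric] Y_def[symmetric]
    by (simp add: ln_div ln_realpow)
  also have "\<dots> \<le> 2 * (d / Im s) + d / Im t" using 1 2 by simp
  also have "\<dots> \<le> 2 * (d / min (Im s) (Im t)) + d / min (Im s) (Im t)"
    using s by (intro add_mono mult_left_mono divide_left_mono) (auto simp: d_def)
  finally show ?thesis by (simp add: d_def)
qed

lemma ln_qform_close:
  assumes s: "Im s > c" "Im t > c" "c > 0" and uv: "u \<noteq> 0 \<or> v \<noteq> 0"
  shows "\<bar>ln (qform t u v) - ln (qform s u v)\<bar> \<le> 3 * cmod (t - s) / c"
proof -
  have "3 * cmod (t - s) / min (Im s) (Im t) \<le> 3 * cmod (t - s) / c"
    using s by (intro divide_left_mono) auto
  then show ?thesis
    using ln_qform_close_aux[of s t u v] ln_qform_close_aux[of t s u v] s uv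
    by (simp add: min.commute norm_minus_commute abs_le_iff)
qed

section \<open>The recurrence, its limiting root and the energies\<close>

locale jacobi =
  fixes a b :: "nat \<Rightarrow> real" and q :: real
  assumes a_pos: "\<And>n. a n > 0"
    and a_ratio: "(\<lambda>n. a n / a (Suc n)) \<longlonglongrightarrow> 1"
    and ba_lim: "(\<lambda>n. b n / a n) \<longlonglongrightarrow> q"
    and a_top: "filterlim a at_top sequentially"
    and q_less: "\<bar>q\<bar> < 2"
begin

definition op :: "nat \<Rightarrow> real \<Rightarrow> real"
  where "op n x = poly (orth_poly a b n) x"

lemma op_0 [simp]: "op 0 x = 1" by (simp add: op_def)

lemma op_1: "op (Suc 0) x = (x - b 0) / a 0"
  by (simp add: op_def diff_divide_distrib)

lemma op_Suc_Suc: "op (Suc (Suc n)) x = ((x - b (Suc n)) * op (Suc n) x - a n * op n x) / a (Suc n)"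
  by (simp add: op_def diff_divide_distrib add_divide_distrib algebra_simps)

lemma op_nontrivial: "op n x \<noteq> 0 \<or> op (Suc n) x \<noteq> 0"
proof (induction n)
  case (Suc n)
  show ?case
  proof (rule ccontr)
    assume "\<not> ?thesis"
    then have "op (Suc n) x = 0" "op (Suc (Suc n)) x = 0" by auto
    then have "op n x = 0" using a_pos[of n] a_pos[of "Suc n"] by (simp add: op_Suc_Suc)
    then show False using Suc \<open>op (Suc n) x = 0\<close> by simp
  qed
qed simp

lemma continuous_on_op [continuous_intros]: "continuous_on S (op n)"
  unfolding op_def [abs_def] by (intro continuous_intros)

definition \<sigma> :: complex
  where "\<sigma> = Complex (q / 2) (sqrt (4 - q\<^sup>2) / 2)"

lemma q2: "q\<^sup>2 < 4"
  using q_less power2_less_imp_less[of "\<bar>q\<bar>" 2] abs_square_less_1[of "q/2"]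
  by (simp add: power2_eq_square field_simps)

lemma Re_\<sigma>: "Re \<sigma> = q / 2" and Im_\<sigma>: "Im \<sigma> = sqrt (4 - q\<^sup>2) / 2"
  by (simp_all add: \<sigma>_def)

lemma Im_\<sigma>_pos: "Im \<sigma> > 0" using q2 by (simp add: Im_\<sigma>)

lemma Im_\<sigma>_sq: "(Im \<sigma>)\<^sup>2 = 1 - q\<^sup>2 / 4"
  using q2 by (simp add: Im_\<sigma> power_divide field_simps)

lemma \<sigma>_quad: "\<sigma> * (\<sigma> - of_real q) = - 1"
proof (rule complex_eqI)
  show "Re (\<sigma> * (\<sigma> - of_real q)) = Re (- 1)"
    using Im_\<sigma>_sq by (simp add: Re_\<sigma> power2_eq_square)
qed (simp add: Re_\<sigma>)

definition U :: "nat \<Rightarrow> real \<Rightarrow> real"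
  where "U n x = a n * ((op n x)\<^sup>2 + q * op n x * op (Suc n) x + (op (Suc n) x)\<^sup>2)"

lemma U_qform: "U n x = a n * Im \<sigma> * qform \<sigma> (op n x) (op (Suc n) x)"
proof -
  have "(cmod (\<sigma> * of_real u + of_real v))\<^sup>2 = u\<^sup>2 + q * u * v + v\<^sup>2" for u v
  proof -
    have "(cmod (\<sigma> * of_real u + of_real v))\<^sup>2 = (q / 2 * u + v)\<^sup>2 + (Im \<sigma>)\<^sup>2 * u\<^sup>2"
      by (simp add: cmod_power2 Re_\<sigma> power_mult_distrib)
    then show ?thesis unfolding Im_\<sigma>_sq by (simp add: power2_eq_square field_simps)
  qed
  then show ?thesis using Im_\<sigma>_pos by (simp add: U_def qform_def)
qed

lemma U_pos: "U n x > 0"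
  unfolding U_qform using a_pos Im_\<sigma>_pos qform_pos[OF Im_\<sigma>_pos op_nontrivial] by simp

lemma continuous_on_U: "continuous_on S (U n)"
  unfolding U_def [abs_def] by (intro continuous_intros)

end

text \<open>Blocks of length \<open>N\<close> start at index (j + 1) N rather than j N, so that the
  predecessor index is never truncated at 0. The Stolz conditions appear already converted into slow
  variation with respect to a scale whose r-th powers are summable.\<close>

locale jacobi_slow = jacobi a b q + slow_scale h K
  for a b :: "nat \<Rightarrow> real" and q :: real and h :: "nat \<Rightarrow> real" and K :: "real set" +
  fixes N r :: nat and M :: real
  assumes N_pos: "N \<ge> 1" and r_pos: "r \<ge> 1"
    and K_bounded: "\<And>x. x \<in> K \<Longrightarrow> \<bar>x\<bar> \<le> M"
    and slow_a: "\<And>i. i < N \<Longrightarrow> slow r 0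
      (\<lambda>p. of_real (a ((fst p + 1) * N + i - 1) / a ((fst p + 1) * N + i)))"
    and slow_b: "\<And>i. i < N \<Longrightarrow> slow r 0
      (\<lambda>p. of_real (b ((fst p + 1) * N + i) / a ((fst p + 1) * N + i)))"
    and slow_1: "\<And>i. i < N \<Longrightarrow> slow r 0 (\<lambda>p. of_real (1 / a ((fst p + 1) * N + i)))"
    and h_summable: "summable (\<lambda>j. h j ^ r)"
    and q_generic: "q \<notin> {2 * cos (real j * (pi / real N)) | j. 1 \<le> j \<and> j < N}"
begin

lemma eventually_F: "eventually P F \<longleftrightarrow> (\<exists>J. \<forall>j\<ge>J. \<forall>x\<in>K. P (j, x))"
proof
  assume "eventually P F"
  then obtain Pf Pg where P: "eventually Pf sequentially" "eventually Pg (principal K)"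
    "\<And>j x. Pf j \<Longrightarrow> Pg x \<Longrightarrow> P (j, x)"
    unfolding F_def eventually_prod_filter by blast
  then show "\<exists>J. \<forall>j\<ge>J. \<forall>x\<in>K. P (j, x)"
    unfolding eventually_sequentially eventually_principal by blast
next
  assume "\<exists>J. \<forall>j\<ge>J. \<forall>x\<in>K. P (j, x)"
  then obtain J where J: "\<And>j x. j \<ge> J \<Longrightarrow> x \<in> K \<Longrightarrow> P (j, x)" by blast
  show "eventually P F"
    unfolding F_def eventually_prod_filter
    by (rule exI[of _ "\<lambda>j. j \<ge> J"], rule exI[of _ "\<lambda>x. x \<in> K"])
      (use J in \<open>auto simp: eventually_principal\<close>)
qed

lemma uniform_limit_F: "uniform_limit K f l sequentially \<longleftrightarrow> 
    (\<forall>e>0. eventually (\<lambda>p. dist (f (fst p) (snd p)) (l (snd p)) < e) F)"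
  unfolding uniform_limit_iff eventually_F eventually_sequentially by simp

lemma tendsto_fst_F: "f \<longlonglongrightarrow> l \<Longrightarrow> ((\<lambda>p. f (fst p)) \<longlongrightarrow> l) F"
  unfolding F_def by (rule filterlim_compose[OF _ filterlim_fst])

lemma eventually_snd_F: "eventually (\<lambda>p. snd p \<in> K) F"
  unfolding eventually_F by auto

section \<open>Transfer matrices over one period\<close>

lemma inverse_a_lim: "(\<lambda>n. 1 / a n) \<longlonglongrightarrow> 0"
  by (rule real_tendsto_divide_at_top[OF tendsto_const a_top])

lemma tendsto_recurrence_coeff:
  assumes g: "filterlim g sequentially sequentially"
  shows "((\<lambda>p. (snd p - b (g (fst p))) / a (g (fst p))) \<longlongrightarrow> - q) F"
proof -
  have "((\<lambda>p. M * (1 / a (g (fst p)))) \<longlongrightarrow> M * 0) F"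
    by (intro tendsto_mult tendsto_const tendsto_fst_F filterlim_compose[OF inverse_a_lim g])
  then have 0: "((\<lambda>p. M * (1 / a (g (fst p)))) \<longlongrightarrow> 0) F" by simp
  have "((\<lambda>p. snd p * (1 / a (g (fst p)))) \<longlongrightarrow> 0) F"
  proof (rule Lim_null_comparison[OF _ 0])
    show "\<forall>\<^sub>F p in F. norm (snd p * (1 / a (g (fst p)))) \<le> M * (1 / a (g (fst p)))"
      using eventually_snd_F
    proof eventually_elim
      case (elim p)
      then show ?case
        using K_bounded[of "snd p"] a_pos[of "g (fst p)"] by (simp add: divide_right_mono)
    qed
  qed
  then have "((\<lambda>p. snd p * (1 / a (g (fst p))) - b (g (fst p)) / a (g (fst p))) \<longlongrightarrow> 0 - q) F"
    by (intro tendsto_diff tendsto_fst_F filterlim_compose[OF ba_lim g])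
  then show ?thesis by (simp add: diff_divide_distrib)
qed

text \<open>As \<omega> \<sigma> = - 1, this is the eigenvalue of the row vector (\<sigma>, 1) under
  the limiting one-step matrix with rows (0, 1) and (- 1, - q).\<close>

definition \<omega> :: complex where "\<omega> = \<sigma> - of_real q"

lemma \<omega>_\<sigma>: "\<omega> * \<sigma> = - 1" using \<sigma>_quad by (simp add: \<omega>_def mult.commute)

text \<open>The matrix with rows (A, B) and (C, D) carries (p_{n-1}, p_n), n = (j + 1) N, across
  \<open>l\<close> steps. Its limit has the left eigenvector (\<sigma>, 1), which says that the
  limiting Moebius map fixes \<sigma>. Everything sits in one predicate so that a single induction
  on \<open>l\<close> carries it.\<close>

definition transfer :: "nat \<Rightarrow> (nat \<times> real \<Rightarrow> real) \<Rightarrow> (nat \<times> real \<Rightarrow> real)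
    \<Rightarrow> (nat \<times> real \<Rightarrow> real) \<Rightarrow> (nat \<times> real \<Rightarrow> real) \<Rightarrow> real \<Rightarrow> real \<Rightarrow> real \<Rightarrow> real \<Rightarrow> bool"
  where "transfer l A B C D A0 B0 C0 D0 \<longleftrightarrow>
    slow r 0 (\<lambda>p. of_real (A p)) \<and> slow r 0 (\<lambda>p. of_real (B p)) \<and>
    slow r 0 (\<lambda>p. of_real (C p)) \<and> slow r 0 (\<lambda>p. of_real (D p)) \<and>
    (A \<longlongrightarrow> A0) F \<and> (B \<longlongrightarrow> B0) F \<and> (C \<longlongrightarrow> C0) F \<and> (D \<longlongrightarrow> D0) F \<and>
    A0 * D0 - B0 * C0 = 1 \<and>
    \<sigma> * of_real A0 + of_real C0 = \<omega> ^ l * \<sigma> \<and> \<sigma> * of_real B0 + of_real D0 = \<omega> ^ l \<and>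
    (\<forall>j x. op ((j + 1) * N + l - 1) x
        = A (j, x) * op ((j + 1) * N - 1) x + B (j, x) * op ((j + 1) * N) x \<and>
      op ((j + 1) * N + l) x
        = C (j, x) * op ((j + 1) * N - 1) x + D (j, x) * op ((j + 1) * N) x \<and>
      A (j, x) * D (j, x) - B (j, x) * C (j, x)
        = a ((j + 1) * N - 1) / a ((j + 1) * N + l - 1))"

lemma transferD:
  assumes "transfer l A B C D A0 B0 C0 D0"
  shows "slow r 0 (\<lambda>p. of_real (A p))" "slow r 0 (\<lambda>p. of_real (B p))"
    "slow r 0 (\<lambda>p. of_real (C p))" "slow r 0 (\<lambda>p. of_real (D p))"
    "(A \<longlongrightarrow> A0) F" "(B \<longlongrightarrow> B0) F" "(C \<longlongrightarrow> C0) F" "(D \<longlongrightarrow> D0) F"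
    "A0 * D0 - B0 * C0 = 1"
    "\<sigma> * of_real A0 + of_real C0 = \<omega> ^ l * \<sigma>" "\<sigma> * of_real B0 + of_real D0 = \<omega> ^ l"
    "op ((j + 1) * N + l - 1) x
      = A (j, x) * op ((j + 1) * N - 1) x + B (j, x) * op ((j + 1) * N) x"
    "op ((j + 1) * N + l) x = C (j, x) * op ((j + 1) * N - 1) x + D (j, x) * op ((j + 1) * N) x"
    "A (j, x) * D (j, x) - B (j, x) * C (j, x) = a ((j + 1) * N - 1) / a ((j + 1) * N + l - 1)"
  using assms unfolding transfer_def by blast+

text \<open>Each step multiplies from the left by the matrix with rows (0, 1) and (- \<alpha>,
  \<beta>), where \<alpha> tends to 1 and \<beta> to - q. Its determinant \<alpha> is a quotient of
  consecutive values of \<open>a\<close>, so the determinants telescope.\<close>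

lemma period_transfer:
  assumes "l \<le> N"
  shows "\<exists>A B C D A0 B0 C0 D0. transfer l A B C D A0 B0 C0 D0"
  using assms
proof (induction l)
  case 0
  have nz: "a ((j + 1) * N - 1) \<noteq> 0" for j
    using a_pos by (simp add: less_imp_neq[THEN not_sym])
  show ?case
    unfolding transfer_def
    by (rule exI[of _ "\<lambda>_. 1"], rule exI[of _ "\<lambda>_. 0"], rule exI[of _ "\<lambda>_. 0"],
        rule exI[of _ "\<lambda>_. 1"], rule exI[of _ 1], rule exI[of _ 0],
        rule exI[of _ 0], rule exI[of _ 1])
      (use nz in \<open>simp add: slow_const slow_zero\<close>)
next
  case (Suc l)
  then have "l < N" by simp
  from Suc.IH[OF less_imp_le[OF this]]
  obtain A B C D A0 B0 C0 D0 where T: "transfer l A B C D A0 B0 C0 D0"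
    by blast
  note sl = transferD(1-4)[OF T] and lim = transferD(5-8)[OF T] and det0 = transferD(9)[OF T]
    and sg = transferD(10,11)[OF T] and tr = transferD(12,13)[OF T] and det = transferD(14)[OF T]
  define \<alpha> where "\<alpha> p = a ((fst p + 1) * N + l - 1) / a ((fst p + 1) * N + l)" for p :: "nat \<times> real"
  define \<beta> where "\<beta> p = (snd p - b ((fst p + 1) * N + l)) / a ((fst p + 1) * N + l)" for p :: "nat \<times> real"
  have sl_\<alpha>: "slow r 0 (\<lambda>p. of_real (\<alpha> p))"
    unfolding \<alpha>_def using slow_a[OF \<open>l < N\<close>] .
  have "slow r 0 (\<lambda>p. of_real (snd p) * of_real (1 / a ((fst p + 1) * N + l))
      - of_real (b ((fst p + 1) * N + l) / a ((fst p + 1) * N + l)))"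
    by (intro slow_diff slow_mult_0 slow_b slow_1 \<open>l < N\<close>
        slow_bounded_param[of "\<lambda>x. complex_of_real x" M]) (use K_bounded in simp)
  moreover have "(\<lambda>p. of_real (snd p) * of_real (1 / a ((fst p + 1) * N + l))
      - of_real (b ((fst p + 1) * N + l) / a ((fst p + 1) * N + l))) = (\<lambda>p. complex_of_real (\<beta> p))"
    by (simp add: \<beta>_def diff_divide_distrib)
  ultimately have sl_\<beta>: "slow r 0 (\<lambda>p. of_real (\<beta> p))" by simp
  have sub: "filterlim (\<lambda>j. (j + 1) * N + l) sequentially sequentially"
    "filterlim (\<lambda>j. (j + 1) * N + l - 1) sequentially sequentially"
    using N_pos by (auto intro!: filterlim_subseq strict_monoI_Suc)
  have lim_\<beta>: "(\<beta> \<longlongrightarrow> - q) F"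
    unfolding \<beta>_def [abs_def] by (rule tendsto_recurrence_coeff[OF sub(1)])
  have Sucn: "(j + 1) * N + l = Suc ((j + 1) * N + l - 1)" for j using N_pos by simp
  have "(\<lambda>j. a ((j + 1) * N + l - 1) / a (Suc ((j + 1) * N + l - 1))) \<longlonglongrightarrow> 1"
    by (rule filterlim_compose[OF a_ratio sub(2)])
  then have "(\<lambda>j. a ((j + 1) * N + l - 1) / a ((j + 1) * N + l)) \<longlonglongrightarrow> 1"
    unfolding Sucn[symmetric] .
  then have lim_\<alpha>: "(\<alpha> \<longlongrightarrow> 1) F"
    unfolding \<alpha>_def [abs_def] by (rule tendsto_fst_F)
  define C' where "C' p = \<beta> p * C p - \<alpha> p * A p" for p
  define D' where "D' p = \<beta> p * D p - \<alpha> p * B p" for p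
  have "slow r 0 (\<lambda>p. of_real (C' p))" "slow r 0 (\<lambda>p. of_real (D' p))"
    unfolding C'_def D'_def of_real_diff of_real_mult
    by (intro slow_diff slow_mult_0 sl sl_\<alpha> sl_\<beta>)+
  note sl' = this
  have lim': "(C' \<longlongrightarrow> (- q) * C0 - 1 * A0) F" "(D' \<longlongrightarrow> (- q) * D0 - 1 * B0) F"
    unfolding C'_def [abs_def] D'_def [abs_def]
    by (intro tendsto_diff tendsto_mult lim lim_\<alpha> lim_\<beta>)+
  have det1: "C0 * ((- q) * D0 - 1 * B0) - D0 * ((- q) * C0 - 1 * A0) = 1"
    using det0 by (simp add: algebra_simps)
  \<comment> \<open>One step of the limiting recurrence multiplies the pairing with the row
    (\<sigma>, 1) by \<omega>, because \<omega> \<sigma> = - 1.\<close>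
  have "\<sigma> * of_real X + of_real ((- q) * X - 1 * Y) = \<omega> * (\<sigma> * of_real Y + of_real X)" for X Y
  proof -
    have "\<omega> * (\<sigma> * of_real Y + of_real X) = (\<omega> * \<sigma>) * of_real Y + \<omega> * of_real X"
      by (simp only: ring_distribs mult.assoc)
    then show ?thesis unfolding \<omega>_\<sigma> by (simp add: \<omega>_def algebra_simps)
  qed
  then have sg': "\<sigma> * of_real C0 + of_real ((- q) * C0 - 1 * A0) = \<omega> ^ Suc l * \<sigma>"
    "\<sigma> * of_real D0 + of_real ((- q) * D0 - 1 * B0) = \<omega> ^ Suc l"
    using sg by (simp_all add: mult.assoc)
  have tr': "op ((j + 1) * N + Suc l - 1) x
        = C (j, x) * op ((j + 1) * N - 1) x + D (j, x) * op ((j + 1) * N) x \<and>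
      op ((j + 1) * N + Suc l) x
        = C' (j, x) * op ((j + 1) * N - 1) x + D' (j, x) * op ((j + 1) * N) x \<and>
      C (j, x) * D' (j, x) - D (j, x) * C' (j, x)
        = a ((j + 1) * N - 1) / a ((j + 1) * N + Suc l - 1)" for j x
  proof -
    define n where "n = (j + 1) * N + l - 1"
    have n: "(j + 1) * N + l = Suc n" "(j + 1) * N + Suc l = Suc (Suc n)"
      using N_pos by (simp_all add: n_def)
    have an: "a (Suc n) > 0" "a n > 0" by (rule a_pos)+
    have \<alpha>\<beta>: "\<alpha> (j, x) = a n / a (Suc n)" "\<beta> (j, x) = (x - b (Suc n)) / a (Suc n)"
      unfolding \<alpha>_def \<beta>_def fst_conv snd_conv n n_def[symmetric] by simp_all
    have 1: "op (Suc n) x = C (j, x) * op ((j + 1) * N - 1) x + D (j, x) * op ((j + 1) * N) x"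
      using tr(2)[of j x] unfolding n .
    have 2: "op n x = A (j, x) * op ((j + 1) * N - 1) x + B (j, x) * op ((j + 1) * N) x"
      using tr(1)[of j x] unfolding n_def[symmetric] .
    have "op (Suc (Suc n)) x = \<beta> (j, x) * op (Suc n) x - \<alpha> (j, x) * op n x"
      unfolding op_Suc_Suc \<alpha>\<beta> using an by (simp add: field_simps)
    then have 3: "op (Suc (Suc n)) x
        = C' (j, x) * op ((j + 1) * N - 1) x + D' (j, x) * op ((j + 1) * N) x"
      unfolding 1 2 C'_def D'_def by (simp add: algebra_simps)
    have "C (j, x) * D' (j, x) - D (j, x) * C' (j, x)
        = \<alpha> (j, x) * (A (j, x) * D (j, x) - B (j, x) * C (j, x))"
      unfolding C'_def D'_def by (simp add: algebra_simps)
    also have "\<dots> = a ((j + 1) * N - 1) / a (Suc n)"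
      unfolding det \<alpha>\<beta> n_def[symmetric] using an by simp
    finally show ?thesis using 1 3 unfolding n by simp
  qed
  show ?case
    unfolding transfer_def
    by (rule exI[of _ C], rule exI[of _ D], rule exI[of _ C'], rule exI[of _ D'],
        rule exI[of _ C0], rule exI[of _ D0], rule exI[of _ "(- q) * C0 - 1 * A0"],
        rule exI[of _ "(- q) * D0 - 1 * B0"])
      (intro conjI allI sl(3,4) sl' lim(3,4) lim' det1 sg' tr'[THEN conjunct1]
        tr'[THEN conjunct2, THEN conjunct1] tr'[THEN conjunct2, THEN conjunct2])
qed

text \<open>With q = 2 cos \<phi> and 0 < \<phi> < pi one has \<omega> = - cis (- \<phi>), and
  squaring removes the sign. The square of \<open>\<omega> ^ N\<close> is 1 only if N \<phi> is a
  multiple of pi, which puts q among the excluded values.\<close>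

lemma \<omega>_power_ne: "(\<omega> ^ N)\<^sup>2 \<noteq> 1"
proof
  define \<phi> where "\<phi> = arccos (q / 2)"
  have q1: "\<bar>q / 2\<bar> < 1" using q_less by simp
  then have \<phi>: "0 < \<phi>" "\<phi> < pi" unfolding \<phi>_def using arccos_lt_bounded[of "q / 2"] by auto
  have cos: "cos \<phi> = q / 2" unfolding \<phi>_def using q1 by (intro cos_arccos) auto
  have "sin \<phi> = Im \<sigma>"
  proof -
    have "(sin \<phi>)\<^sup>2 = (Im \<sigma>)\<^sup>2"
      unfolding Im_\<sigma>_sq sin_squared_eq cos by (simp add: power_divide)
    then show ?thesis
      using sin_gt_zero[OF \<phi>] Im_\<sigma>_pos by (simp add: power2_eq_iff_nonneg)
  qed
  then have "\<sigma> = cis \<phi>" by (simp add: complex_eq_iff cos Re_\<sigma>)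
  then have "\<omega> = - cis (- \<phi>)"
    using \<omega>_\<sigma> by (simp add: \<omega>_def complex_eq_iff Re_\<sigma> cos)
  then have "\<omega>\<^sup>2 = cis (- (2 * \<phi>))"
    by (simp add: power2_eq_square cis_mult)
  then have "(\<omega>\<^sup>2) ^ N = cis (real N * (- (2 * \<phi>)))"
    by (simp only: Complex.DeMoivre)
  moreover have "(\<omega> ^ N)\<^sup>2 = (\<omega>\<^sup>2) ^ N"
    by (simp only: power_mult[symmetric] mult.commute)
  moreover have "real N * (- (2 * \<phi>)) = - (2 * real N * \<phi>)" by simp
  ultimately have "(\<omega> ^ N)\<^sup>2 = cis (- (2 * real N * \<phi>))"
    by (simp only:)
  moreover assume "(\<omega> ^ N)\<^sup>2 = 1"
  ultimately have "cos (2 * real N * \<phi>) = 1" by (simp add: complex_eq_iff)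
  then obtain m :: int where "2 * real N * \<phi> = of_int m * 2 * pi" 
    using cos_one_2pi_int by blast
  then have m: "real N * \<phi> = of_int m * pi" by simp
  then have "of_int m * pi > 0" "of_int m * pi < real N * pi"
    using \<phi> N_pos by (auto simp flip: m)
  then have m': "0 < m" "m < int N" by (simp_all add: zero_less_mult_iff)
  define j where "j = nat m"
  have "real N * \<phi> = real j * pi" using m m' by (simp add: j_def)
  then have "\<phi> = real j * (pi / real N)" using N_pos by (simp add: field_simps)
  then have "q = 2 * cos (real j * (pi / real N))" using cos by simp
  moreover have "1 \<le> j" "j < N" using m' by (auto simp: j_def)
  ultimately show False using q_generic by blast
qed


text \<open>The one-step Moebius image \<open>s'\<close> of \<sigma> tends to \<sigma>, and the
  determinant \<alpha> exactly offsets the change of weight from a_n to a_{n+1}. The lemma serves to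
  carry a limit from one residue class modulo \<open>N\<close> to the others.\<close>

lemma ln_U_neighbour: "uniform_limit K (\<lambda>n x. ln (U (Suc n) x) - ln (U n x)) (\<lambda>_. 0) sequentially"
proof -
  define c where "c = Im \<sigma> / 2"
  have c: "0 < c" "c < Im \<sigma>" using Im_\<sigma>_pos by (auto simp: c_def)
  define \<alpha> where "\<alpha> p = a (fst p) / a (Suc (fst p))" for p :: "nat \<times> real"
  define \<beta> where "\<beta> p = (snd p - b (Suc (fst p))) / a (Suc (fst p))" for p :: "nat \<times> real"
  define s' where "s' p = (\<sigma> * of_real 0 + of_real (- \<alpha> p)) / (\<sigma> * of_real 1 + of_real (\<beta> p))" for p
  have lim_\<beta>: "(\<beta> \<longlongrightarrow> - q) F"
    unfolding \<beta>_def [abs_def] by (rule tendsto_recurrence_coeff[OF filterlim_Suc])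
  have lim_\<alpha>: "(\<alpha> \<longlongrightarrow> 1) F"
    unfolding \<alpha>_def [abs_def] by (rule tendsto_fst_F[OF a_ratio])
  have nz: "\<omega> \<noteq> 0" using \<omega>_\<sigma> by auto
  have lim_den: "((\<lambda>p. \<sigma> * of_real 1 + of_real (\<beta> p)) \<longlongrightarrow> \<sigma> * of_real 1 + of_real (- q)) F"
    by (intro tendsto_add tendsto_const tendsto_of_real lim_\<beta>)
  have "(s' \<longlongrightarrow> (\<sigma> * of_real 0 + of_real (- 1)) / (\<sigma> * of_real 1 + of_real (- q))) F"
    unfolding s'_def [abs_def]
    by (intro tendsto_divide lim_den tendsto_add tendsto_const tendsto_of_real tendsto_minus lim_\<alpha>)
      (use nz in \<open>simp add: \<omega>_def\<close>)
  moreover have "(\<sigma> * of_real 0 + of_real (- 1)) / (\<sigma> * of_real 1 + of_real (- q)) = \<sigma>"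
    using \<omega>_\<sigma> nz by (simp add: \<omega>_def field_simps)
  ultimately have lim_s': "(s' \<longlongrightarrow> \<sigma>) F" by simp
  have ev_Im: "\<forall>\<^sub>F p in F. c < Im (s' p)"
    by (rule order_tendstoD(1)[OF tendsto_Im[OF lim_s'] c(2)])
  have ev_nz: "\<forall>\<^sub>F p in F. \<sigma> * of_real 1 + of_real (\<beta> p) \<noteq> 0"
    by (rule tendsto_imp_eventually_ne[OF lim_den]) (use nz in \<open>simp add: \<omega>_def\<close>)
  show ?thesis
    unfolding uniform_limit_F
  proof (intro allI impI)
    fix e :: real assume e: "e > 0"
    then have "e * c / 3 > 0" using c by simp
    from tendstoD[OF lim_s' this] ev_Im ev_nz
    show "\<forall>\<^sub>F p in F. dist (ln (U (Suc (fst p)) (snd p)) - ln (U (fst p) (snd p))) 0 < e"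
    proof eventually_elim
      case (elim p)
      define n where "n = fst p"
      define x where "x = snd p"
      let ?Q = "\<lambda>s. qform s (op n x) (op (Suc n) x)"
      have an: "a n > 0" "a (Suc n) > 0" by (rule a_pos)+
      have "\<alpha> p > 0" unfolding \<alpha>_def using a_pos by simp
      then have "qform \<sigma> (0 * op n x + 1 * op (Suc n) x) ((- \<alpha> p) * op n x + \<beta> p * op (Suc n) x)
          = (0 * \<beta> p - 1 * (- \<alpha> p)) * ?Q (s' p)"
        by (intro qform_transform Im_\<sigma>_pos elim(3)) (auto simp: s'_def)
      moreover have "op (Suc (Suc n)) x = (- \<alpha> p) * op n x + \<beta> p * op (Suc n) x"
        unfolding op_Suc_Suc \<alpha>_def \<beta>_def n_def[symmetric] x_def[symmetric]
        using an by (simp add: field_simps)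
      ultimately have "qform \<sigma> (op (Suc n) x) (op (Suc (Suc n)) x) = \<alpha> p * ?Q (s' p)"
        by simp
      then have U': "U (Suc n) x = a n * Im \<sigma> * ?Q (s' p)"
        unfolding U_qform using an by (simp add: \<alpha>_def n_def)
      have "?Q (s' p) > 0"
        "?Q \<sigma> > 0" "a n * Im \<sigma> > 0"
        using elim(2) c an Im_\<sigma>_pos by (auto intro!: qform_pos op_nontrivial)
      then have "ln (U (Suc n) x) - ln (U n x)
          = ln (?Q (s' p)) - ln (?Q \<sigma>)"
        unfolding U' unfolding U_qform by (simp add: ln_mult_pos)
      also have "\<bar>\<dots>\<bar> \<le> 3 * cmod (s' p - \<sigma>) / c"
        by (rule ln_qform_close[OF c(2) elim(2) c(1) op_nontrivial])
      also have "\<dots> < e" using elim(1) c(1) by (simp add: dist_norm field_simps)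
      finally show ?case by (simp add: n_def x_def)
    qed
  qed
qed

text \<open>With \<sigma> itself the increments over one period are only known to tend to 0. The
  sequence \<open>T\<close> uses the approximate fixed points instead, which makes them summable
  uniformly in x, and returning to \<sigma> afterwards costs a uniformly vanishing error.\<close>

lemma ln_U_subsequence: "\<exists>L. uniform_limit K (\<lambda>j x. ln (U ((j + 1) * N - 1) x)) L sequentially"
proof -
  define c where "c = Im \<sigma> / 2"
  have c: "0 < c" "c < Im \<sigma>" using Im_\<sigma>_pos by (auto simp: c_def)
  obtain A B C D A0 B0 C0 D0 where T: "transfer N A B C D A0 B0 C0 D0"
    using period_transfer[OF order_refl] by blast
  note sl = transferD(1-4)[OF T] and lim = transferD(5-8)[OF T] and det0 = transferD(9)[OF T]
    and sg = transferD(10,11)[OF T] and tr = transferD(12,13)[OF T] and det = transferD(14)[OF T]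
  have \<omega>: "\<omega> ^ N \<noteq> 0" using \<omega>_\<sigma> by auto
  note limc = lim[THEN tendsto_of_real[where ?'a = complex]]
  obtain s where lim_s: "(s \<longlongrightarrow> \<sigma>) F" and
    err: "ord_le r (\<lambda>p. (s (sh p) * of_real (A p) + of_real (C p))
      / (s (sh p) * of_real (B p) + of_real (D p)) - s p)"
    using ex_almost_fixed_point[OF sl limc det0 sg \<omega> \<omega>_power_ne Im_\<sigma>_pos r_pos] by blast
  define G where "G p = (s (sh p) * of_real (A p) + of_real (C p))
      / (s (sh p) * of_real (B p) + of_real (D p))" for p
  have err: "ord_le r (\<lambda>p. G p - s p)" using err unfolding G_def .
  obtain r' where r': "r = Suc r'" using r_pos by (cases r) auto
  have "((\<lambda>p. (G p - s p) + s p) \<longlongrightarrow> 0 + \<sigma>) F"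
    by (intro tendsto_add lim_s ord_le_tendsto_0[OF err[unfolded r']])
  then have lim_G: "(G \<longlongrightarrow> \<sigma>) F" by simp
  have lim_den: "((\<lambda>p. s (sh p) * of_real (B p) + of_real (D p)) \<longlongrightarrow> \<omega> ^ N) F"
    unfolding sg(2)[symmetric] by (intro tendsto_add tendsto_mult limc tendsto_sh[OF lim_s])
  define T where "T j x = ln (a ((j + 1) * N - 1)
      * qform (s (j, x)) (op ((j + 1) * N - 1) x) (op ((j + 1) * N) x))" for j x
  have nontriv: "op ((j + 1) * N - 1) x \<noteq> 0 \<or> op ((j + 1) * N) x \<noteq> 0" for j x
    using op_nontrivial[of "(j + 1) * N - 1" x] N_pos by simp
  obtain c0 where c0: "c0 > 0" and
    ev_err: "\<forall>\<^sub>F p in F. cmod (G p - s p) \<le> c0 * cmod (complex_of_real (h (fst p)) ^ r)"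
    using landau_o.bigE[OF err] by blast
  have "\<forall>\<^sub>F p in F. c < Im (s p)" "\<forall>\<^sub>F p in F. c < Im (G p)"
    "\<forall>\<^sub>F p in F. s (sh p) * of_real (B p) + of_real (D p) \<noteq> 0"
    "\<forall>\<^sub>F p in F. c < Im (s (sh p))"
    using order_tendstoD(1)[OF tendsto_Im[OF lim_s] c(2)]
      order_tendstoD(1)[OF tendsto_Im[OF lim_G] c(2)]
      tendsto_imp_eventually_ne[OF lim_den \<omega>]
      order_tendstoD(1)[OF tendsto_Im[OF tendsto_sh[OF lim_s]] c(2)] by simp_all
  with ev_err have "\<forall>\<^sub>F p in F. \<bar>T (Suc (fst p)) (snd p) - T (fst p) (snd p)\<bar> \<le> 3 * c0 / c * h (fst p) ^ r"
  proof eventually_elim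
    case (elim p)
    obtain j x where p: "p = (j, x)" by (cases p)
    define n where "n = (j + 1) * N"
    let ?Q = "\<lambda>s. qform s (op (n - 1) x) (op n x)"
    have n: "n \<ge> 1" "(Suc j + 1) * N = n + N" using N_pos by (simp_all add: n_def)
    have an: "a (n - 1) > 0" "a (n + N - 1) > 0" by (rule a_pos)+
    have "qform (s (sh p)) (A p * op (n - 1) x + B p * op n x) (C p * op (n - 1) x + D p * op n x)
        = (A p * D p - B p * C p) * ?Q (G p)"
    proof (rule qform_transform)
      show "A p * D p - B p * C p \<noteq> 0"
        unfolding p det n_def[symmetric] using an by simp
    qed (use elim c in \<open>auto simp: G_def\<close>)
    then have eq: "qform (s (Suc j, x)) (op (n + N - 1) x) (op (n + N) x)
        = a (n - 1) / a (n + N - 1) * ?Q (G p)"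
      using tr[of j x] det[of j x] unfolding n_def[symmetric] p by (simp add: sh_def)
    have nt: "op (n - 1) x \<noteq> 0 \<or> op n x \<noteq> 0" using nontriv[of j x] by (simp add: n_def)
    \<comment> \<open>The determinant exchanges the weight at the end of the block for the one at
      its beginning, so \<open>T (Suc j)\<close> and \<open>T j\<close> differ only in the parameter
      of the form.\<close>
    have "T (Suc j) x = ln (a (n - 1) * ?Q (G p))"
      unfolding T_def n(2) eq using an by simp
    moreover have "T j x = ln (a (n - 1) * ?Q (s p))"
      unfolding T_def n_def p by simp
    moreover have "?Q (G p) > 0" "?Q (s p) > 0"
      using nt elim c by (auto intro!: qform_pos)
    ultimately have "\<bar>T (Suc j) x - T j x\<bar>
        = \<bar>ln (?Q (G p)) - ln (?Q (s p))\<bar>"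
      using an by (simp add: ln_mult_pos)
    also have "\<dots> \<le> 3 * cmod (G p - s p) / c"
      by (rule ln_qform_close[OF _ _ c(1) nt]) (use elim in auto)
    also have "\<dots> \<le> 3 * (c0 * h j ^ r) / c"
      using elim(1) c(1) h_nonneg[of j] unfolding p by (intro divide_right_mono mult_left_mono)
        (auto simp: norm_power)
    finally show ?case unfolding p by simp
  qed
  then obtain J where J: "\<And>j x. j \<ge> J \<Longrightarrow> x \<in> K \<Longrightarrow> \<bar>T (Suc j) x - T j x\<bar> \<le> 3 * c0 / c * h j ^ r"
    unfolding eventually_F by auto
  let ?t = "\<lambda>i x. T (Suc (i + J)) x - T (i + J) x"
  \<comment> \<open>The increments are controlled only from \<open>J\<close> on, so the M-test is
    applied to the shifted series and \<open>T J x\<close> is added back.\<close>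
  have "uniform_limit K (\<lambda>n x. \<Sum>i<n. ?t i x)
      (\<lambda>x. \<Sum>i. ?t i x) sequentially"
  proof (rule Weierstrass_m_test)
    show "norm (?t i x) \<le> 3 * c0 / c * h (i + J) ^ r" if "x \<in> K" for i x
      using J[of "i + J" x] that by simp
    show "summable (\<lambda>i. 3 * c0 / c * h (i + J) ^ r)"
      using summable_ignore_initial_segment[OF h_summable, of J] by (rule summable_mult)
  qed
  moreover have "(\<Sum>i<n. ?t i x) = T (n + J) x - T J x" for n x
    using sum_lessThan_telescope[of "\<lambda>i. T (i + J) x" n] by simp
  ultimately have "uniform_limit K (\<lambda>n x. T (n + J) x - T J x)
      (\<lambda>x. \<Sum>i. ?t i x) sequentially" by simp
  then have "uniform_limit K (\<lambda>n x. (T (n + J) x - T J x) + T J x)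
      (\<lambda>x. (\<Sum>i. ?t i x) + T J x) sequentially"
    by (intro uniform_limit_add uniform_limit_const)
  then obtain L where "uniform_limit K (\<lambda>n x. T (n + J) x) L sequentially" by simp
  then have limT: "uniform_limit K T L sequentially"
    unfolding uniform_limit_iff
    using eventually_sequentially_seg[of "\<lambda>n. \<forall>x\<in>K. dist (T n x) (L x) < e" J for e] by simp
  \<comment> \<open>Here \<open>s\<close> is traded for \<sigma>. The constant
    \<open>ln (Im \<sigma>)\<close> is the factor by which \<open>U\<close> and the weighted form at
    \<sigma> differ.\<close>
  have "uniform_limit K (\<lambda>j x. ln (U ((j + 1) * N - 1) x) - T j x) (\<lambda>_. ln (Im \<sigma>)) sequentially"
    unfolding uniform_limit_F
  proof (intro allI impI)
    fix e :: real assume e: "e > 0"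
    then have "e * c / 3 > 0" using c by simp
    from tendstoD[OF lim_s this] order_tendstoD(1)[OF tendsto_Im[OF lim_s] c(2)]
    show "\<forall>\<^sub>F p in F. dist (ln (U ((fst p + 1) * N - 1) (snd p)) - T (fst p) (snd p)) (ln (Im \<sigma>)) < e"
    proof eventually_elim
      case (elim p)
      obtain j x where p: "p = (j, x)" by (cases p)
      define n where "n = (j + 1) * N"
      let ?Q = "\<lambda>s. qform s (op (n - 1) x) (op n x)"
      have n: "n \<ge> 1" using N_pos by (simp_all add: n_def)
      have an: "a (n - 1) > 0" by (rule a_pos)+
      have nt: "op (n - 1) x \<noteq> 0 \<or> op n x \<noteq> 0" using nontriv[of j x] by (simp add: n_def)
      have "U (n - 1) x = a (n - 1) * Im \<sigma> * ?Q \<sigma>"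
        unfolding U_qform using n by simp
      moreover have "T j x = ln (a (n - 1) * ?Q (s p))"
        unfolding T_def n_def p by simp
      moreover have "?Q \<sigma> > 0" "?Q (s p) > 0"
        using nt elim c by (auto intro!: qform_pos)
      ultimately have "\<bar>ln (U (n - 1) x) - T j x - ln (Im \<sigma>)\<bar>
          = \<bar>ln (?Q \<sigma>) - ln (?Q (s p))\<bar>"
        using an Im_\<sigma>_pos by (simp add: ln_mult_pos)
      also have "\<dots> \<le> 3 * cmod (\<sigma> - s p) / c"
        by (rule ln_qform_close[OF _ _ c(1) nt]) (use elim c in auto)
      also have "\<dots> < e" using elim(1) c(1) by (simp add: dist_norm norm_minus_commute field_simps)
      finally show ?case unfolding p by (simp add: n_def dist_real_def)
    qed
  qed
  from uniform_limit_add[OF this limT] show ?thesis by auto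
qed

text \<open>Consecutive logarithms get uniformly close, so all residue classes modulo
  \<open>N\<close> share the limit \<open>L\<close>; as they are finitely many, one threshold serves
  them all.\<close>

lemma ln_U_uniform_limit: "\<exists>L. uniform_limit K (\<lambda>n x. ln (U n x)) L sequentially"
proof -
  obtain L where L: "uniform_limit K (\<lambda>j x. ln (U ((j + 1) * N - 1) x)) L sequentially"
    using ln_U_subsequence by blast
  have i: "uniform_limit K (\<lambda>j x. ln (U ((j + 1) * N - 1 + i) x)) L sequentially" for i
  proof (induction i)
    case (Suc i)
    have "filterlim (\<lambda>j. (j + 1) * N - 1 + i) sequentially sequentially"
      using N_pos by (auto intro!: filterlim_subseq strict_monoI_Suc)
    from filterlim_compose[OF ln_U_neighbour this]
    have "uniform_limit K (\<lambda>j x. ln (U (Suc ((j + 1) * N - 1 + i)) x) - ln (U ((j + 1) * N - 1 + i) x))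
        (\<lambda>_. 0) sequentially" .
    from uniform_limit_add[OF this Suc] show ?case by simp
  qed (use L in simp)
  have "uniform_limit K (\<lambda>n x. ln (U n x)) L sequentially"
    unfolding uniform_limit_iff
  proof (intro allI impI)
    fix e :: real assume "e > 0"
    then have "\<forall>i\<in>{..<N}. \<forall>\<^sub>F j in sequentially. \<forall>x\<in>K. dist (ln (U ((j + 1) * N - 1 + i) x)) (L x) < e"
      using i unfolding uniform_limit_iff by blast
    then have "\<forall>\<^sub>F j in sequentially. \<forall>i\<in>{..<N}. \<forall>x\<in>K. dist (ln (U ((j + 1) * N - 1 + i) x)) (L x) < e"
      by (intro eventually_ball_finite) auto
    then obtain J where J: "\<And>j i x. j \<ge> J \<Longrightarrow> i < N \<Longrightarrow> x \<in> K \<Longrightarrow>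
        dist (ln (U ((j + 1) * N - 1 + i) x)) (L x) < e"
      unfolding eventually_sequentially by auto
    have "dist (ln (U n x)) (L x) < e" if n: "n \<ge> (J + 1) * N" and x: "x \<in> K" for n x
    proof -
      \<comment> \<open>The index is written as n + 1 = (j + 1) N + i with i < N, and n \<ge> (J +
        1) N ensures j \<ge> J.\<close>
      define j where "j = (n + 1) div N - 1"
      define i where "i = (n + 1) mod N"
      have "(n + 1) div N \<ge> J + 1"
        using n N_pos by (simp add: less_eq_div_iff_mult_less_eq)
      then have j: "j \<ge> J" "(n + 1) div N = j + 1" by (auto simp: j_def)
      have "(j + 1) * N + i = n + 1"
        unfolding i_def j(2)[symmetric] by (rule div_mult_mod_eq)
      then have "(j + 1) * N - 1 + i = n" using N_pos by simp
      moreover have "i < N" unfolding i_def using N_pos by simp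
      ultimately show ?thesis using J[OF j(1), of i x] x by simp
    qed
    then show "\<forall>\<^sub>F n in sequentially. \<forall>x\<in>K. dist (ln (U n x)) (L x) < e"
      unfolding eventually_sequentially by blast
  qed
  then show ?thesis by blast
qed

end

section \<open>Stolz classes and a common control sequence\<close>

text \<open>The sum \<open>y\<close> of all the powers with exponents r / k is summable and
  dominates each of them, so any h with h^r \<ge> y bounds the k-th differences by h^k. Geometric
  smoothing of \<open>y\<close> adds the doubling property.\<close>

lemma stolz_control_sequence:
  assumes I: "finite I" and r: "r \<ge> 1" and x: "\<And>i. i \<in> I \<Longrightarrow> x i \<in> stolz_class r"
  shows "\<exists>h. (\<forall>j. 0 \<le> h j \<and> h (Suc j) \<le> 2 * h j) \<and> h \<longlonglongrightarrow> 0 \<and> summable (\<lambda>j. h j ^ r) \<and>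
    (\<forall>i\<in>I. \<forall>k\<in>{1..r}. \<forall>j. \<bar>fwd_diff k (x i) j\<bar> \<le> h j ^ k)"
proof -
  define y where "y j = (\<Sum>i\<in>I. \<Sum>k\<in>{1..r}. \<bar>fwd_diff k (x i) j\<bar> powr (real r / real k))" for j
  have y_nonneg: "0 \<le> y j" for j unfolding y_def by (intro sum_nonneg) simp
  have y_summable: "summable y"
    unfolding y_def [abs_def] using x by (intro summable_sum) (auto simp: stolz_class_def)
  define Y where "Y = suminf y"
  have y_le: "y j \<le> Y" for j
    unfolding Y_def using sum_le_suminf[OF y_summable, of "{j}"] y_nonneg by simp
  \<comment> \<open>By construction \<open>H j = y j + H (Suc j) / 2\<close>; hence \<open>H\<close>
    lies above \<open>y\<close> and at most doubles from one index to the next.\<close>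
  define H where "H j = (\<Sum>i. (1/2) ^ i * y (i + j))" for j
  have half: "summable (\<lambda>i. (1/2::real) ^ i * Y)" "(\<Sum>i. (1/2::real) ^ i * Y) = 2 * Y"
    by (auto simp: summable_mult2 suminf_mult2[symmetric] suminf_geometric)
  have H_summable: "summable (\<lambda>i. (1/2) ^ i * y (i + j))" for j
    by (rule summable_comparison_test'[OF half(1)]) (simp add: y_nonneg y_le)
  have H_le: "H j \<le> 2 * Y" for j
    unfolding H_def half(2)[symmetric] by (intro suminf_le H_summable half) (simp add: y_le)
  have H_nonneg: "0 \<le> H j" for j
    unfolding H_def by (intro suminf_nonneg H_summable) (simp add: y_nonneg)
  have H_rec: "H j = y j + H (Suc j) / 2" for j
  proof -
    have "(\<Sum>i. (1/2) ^ Suc i * y (Suc i + j)) = (\<Sum>i. (1/2) ^ i * y (i + Suc j)) / 2"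
      by (subst suminf_divide[OF H_summable, symmetric]) simp
    then show ?thesis unfolding H_def suminf_split_head[OF H_summable] by simp
  qed
  \<comment> \<open>Summed up, the recursion gives S \<le> Y + (S + H_n - H_0) / 2 for a partial sum
    S, and H_n \<le> 2 Y turns this into S \<le> 4 Y.\<close>
  have "summable H"
  proof (rule summableI_nonneg_bounded[OF H_nonneg])
    fix n
    have "(\<Sum>j<n. H j) = (\<Sum>j<n. y j) + (\<Sum>j<n. H (Suc j)) / 2"
      unfolding sum_divide_distrib sum.distrib[symmetric] by (intro sum.cong refl H_rec)
    also have "(\<Sum>j<n. H (Suc j)) = (\<Sum>j<n. H j) + H n - H 0"
      using sum_lessThan_telescope[of H n] by (simp add: sum_subtractf)
    also have "(\<Sum>j<n. y j) \<le> Y"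
      unfolding Y_def by (rule sum_le_suminf[OF y_summable]) (auto simp: y_nonneg)
    finally have "(\<Sum>j<n. H j) \<le> Y + ((\<Sum>j<n. H j) + H n - H 0) / 2" by simp
    then show "(\<Sum>j<n. H j) \<le> 4 * Y" using H_le[of n] H_nonneg[of 0] by (simp add: field_simps)
  qed
  define h where "h j = root r (H j)" for j
  have h_nonneg: "0 \<le> h j" for j unfolding h_def using r H_nonneg by simp
  have h_pow: "h j ^ r = H j" for j unfolding h_def using r H_nonneg by simp
  have "h (Suc j) \<le> 2 * h j" for j
  proof (rule power_le_imp_le_base)
    have "h (Suc j) ^ Suc (r - 1) = H (Suc j)" using h_pow r by simp
    also have "\<dots> \<le> 2 * H j" using H_rec[of j] y_nonneg[of j] by simp
    also have "\<dots> \<le> 2 ^ r * H j"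
      using r by (intro mult_right_mono H_nonneg) (metis one_le_numeral power_increasing power_one_right)
    finally show "h (Suc j) ^ Suc (r - 1) \<le> (2 * h j) ^ Suc (r - 1)"
      using r by (simp add: power_mult_distrib h_pow del: power_Suc)
  qed (simp add: h_nonneg)
  moreover have "h \<longlonglongrightarrow> 0"
    unfolding h_def [abs_def]
    using tendsto_real_root[OF summable_LIMSEQ_zero[OF \<open>summable H\<close>], of r] by simp
  moreover have "\<bar>fwd_diff k (x i) j\<bar> \<le> h j ^ k" if i: "i \<in> I" and k: "k \<in> {1..r}" for i k j
  proof (rule power_le_imp_le_base)
    define t where "t = \<bar>fwd_diff k (x i) j\<bar>"
    have "t powr (real r / real k) \<le> (\<Sum>k\<in>{1..r}. \<bar>fwd_diff k (x i) j\<bar> powr (real r / real k))"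
      unfolding t_def by (rule member_le_sum[OF k]) auto
    also have "\<dots> \<le> y j"
      unfolding y_def
      by (rule member_le_sum[where f = "\<lambda>i. \<Sum>k\<in>{1..r}. \<bar>fwd_diff k (x i) j\<bar> powr (real r / real k)", OF i])
        (auto intro: sum_nonneg I)
    also have "\<dots> \<le> h j ^ r" using H_rec[of j] H_nonneg[of "Suc j"] by (simp add: h_pow)
    finally have "(t powr (real r / real k)) ^ k \<le> (h j ^ r) ^ k"
      by (intro power_mono) auto
    \<comment> \<open>For \<open>t = 0\<close> both sides vanish, as \<open>0 powr\<close> gives 0
      and both \<open>k\<close> and \<open>r\<close> are positive.\<close>
    moreover have "(t powr (real r / real k)) ^ k = t ^ r"
    proof (cases "t = 0")
      case False
      then have "t > 0" by (simp add: t_def)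
      then show ?thesis using k
        by (simp add: powr_realpow[symmetric] powr_powr)
    qed (use k r in \<open>auto simp: power_0_left\<close>)
    ultimately show "\<bar>fwd_diff k (x i) j\<bar> ^ Suc (r - 1) \<le> (h j ^ k) ^ Suc (r - 1)"
      using r by (simp add: t_def power_mult[symmetric] mult.commute del: power_Suc)
  qed (simp add: h_nonneg)
  ultimately show ?thesis using h_nonneg h_pow \<open>summable H\<close> by (intro exI[of _ h]) auto
qed

text \<open>On functions of the index alone, the difference along \<open>sh\<close> is the ordinary
  forward difference. Boundedness supplies the order 0, about which the control sequence says
  nothing.\<close>

lemma (in slow_scale) slow_stolz:
  assumes bd: "bounded (range x)" and d: "\<And>k j. k \<in> {1..r} \<Longrightarrow> \<bar>fwd_diff k x j\<bar> \<le> h j ^ k"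
  shows "slow r 0 (\<lambda>p. of_real (x (fst p)))"
proof -
  obtain B where B: "\<And>j. \<bar>x j\<bar> \<le> B" using bd unfolding bounded_iff by auto
  have ord: "ord_le k (\<lambda>p. of_real (fwd_diff k x (fst p)))" if "k \<le> r" for k
  proof (rule bigoI[where c = "max B 1"], rule always_eventually, rule allI)
    fix p :: "nat \<times> 'a"
    show "norm (complex_of_real (fwd_diff k x (fst p))) \<le> max B 1 * norm (complex_of_real (h (fst p)) ^ k)"
    proof (cases "k = 0")
      case True
      then show ?thesis using B[of "fst p"] by simp
    next
      case False
      then have "\<bar>fwd_diff k x (fst p)\<bar> \<le> 1 * h (fst p) ^ k" using d[of k] that by simp
      also have "\<dots> \<le> max B 1 * h (fst p) ^ k"
        by (intro mult_right_mono) (auto simp: h_nonneg)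
      finally show ?thesis by (simp add: norm_power h_nonneg)
    qed
  qed
  have "slow k l (\<lambda>p. of_real (fwd_diff l x (fst p)))" if "l + k \<le> r" for k l
    using that
  proof (induction k arbitrary: l)
    case 0
    then show ?case using ord[of l] by simp
  next
    case (Suc k)
    have "slow k (Suc l) (\<lambda>p. of_real (fwd_diff (Suc l) x (fst p)))"
      by (rule Suc.IH) (use Suc.prems in simp)
    then show ?case using ord[of l] Suc.prems by (simp add: sh_def)
  qed
  from this[of 0 r] show ?thesis by simp
qed

section \<open>Locally uniform limits of the energies\<close>

context jacobi
begin

lemma ln_U_uniform_limit_stolz:
  assumes N: "N \<ge> 1" and r: "r \<ge> 1"
    and st_a: "\<And>i. i < N \<Longrightarrow> (\<lambda>j. a ((j + 1) * N + i - 1) / a ((j + 1) * N + i)) \<in> stolz_class r"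
    and st_b: "\<And>i. i < N \<Longrightarrow> (\<lambda>j. b (j * N + i) / a (j * N + i)) \<in> stolz_class r"
    and st_1: "\<And>i. i < N \<Longrightarrow> (\<lambda>j. 1 / a (j * N + i)) \<in> stolz_class r"
    and q: "q \<notin> {2 * cos (real j * (pi / real N)) | j. 1 \<le> j \<and> j < N}"
  shows "\<exists>L. uniform_limit {-R..R} (\<lambda>n x. ln (U n x)) L sequentially"
proof -
  \<comment> \<open>The three families are interleaved modulo 3 into one family of 3 N sequences, so
    that a single control sequence serves all of them.\<close>
  define x where "x m j = (if m mod 3 = 0 then a ((j + 1) * N + m div 3 - 1) / a ((j + 1) * N + m div 3)
    else if m mod 3 = 1 then b (j * N + m div 3) / a (j * N + m div 3)
    else 1 / a (j * N + m div 3))" for m j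
  have x: "x (3 * i) = (\<lambda>j. a ((j + 1) * N + i - 1) / a ((j + 1) * N + i))"
    "x (3 * i + 1) = (\<lambda>j. b (j * N + i) / a (j * N + i))"
    "x (3 * i + 2) = (\<lambda>j. 1 / a (j * N + i))" for i
  proof -
    have "(3 * i + 1) mod 3 = 1" "(3 * i + 2) mod 3 = 2" "(3 * i + 1) div 3 = i" "(3 * i + 2) div 3 = i"
      by presburger+
    then show "x (3 * i) = (\<lambda>j. a ((j + 1) * N + i - 1) / a ((j + 1) * N + i))"
      "x (3 * i + 1) = (\<lambda>j. b (j * N + i) / a (j * N + i))"
      "x (3 * i + 2) = (\<lambda>j. 1 / a (j * N + i))" by (auto simp: x_def fun_eq_iff)
  qed
  have st: "x m \<in> stolz_class r" if "m \<in> {..<3 * N}" for m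
  proof -
    define i where "i = m div 3"
    have i: "i < N" using that by (auto simp: i_def)
    have "m = 3 * i \<or> m = 3 * i + 1 \<or> m = 3 * i + 2" unfolding i_def by presburger
    then consider "m = 3 * i" | "m = 3 * i + 1" | "m = 3 * i + 2" by blast
    then show ?thesis
    proof cases
      case 1
      show ?thesis unfolding 1 x by (rule st_a[OF i])
    next
      case 2
      show ?thesis unfolding 2 x by (rule st_b[OF i])
    next
      case 3
      show ?thesis unfolding 3 x by (rule st_1[OF i])
    qed
  qed
  obtain h where h0: "(\<forall>j. 0 \<le> h j \<and> h (Suc j) \<le> 2 * h j) \<and> h \<longlonglongrightarrow> 0 \<and>
      summable (\<lambda>j. h j ^ r) \<and>
      (\<forall>m\<in>{..<3 * N}. \<forall>k\<in>{1..r}. \<forall>j. \<bar>fwd_diff k (x m) j\<bar> \<le> h j ^ k)"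
    using stolz_control_sequence[OF finite_lessThan r st] ..
  then have h: "\<And>j. 0 \<le> h j" "\<And>j. h (Suc j) \<le> 2 * h j" "h \<longlonglongrightarrow> 0" "summable (\<lambda>j. h j ^ r)"
    by simp_all
  have h5: "\<bar>fwd_diff k (x m) j\<bar> \<le> h j ^ k" if "m \<in> {..<3 * N}" "k \<in> {1..r}" for m k j
    using h0 that by blast
  interpret slow_scale h "{-R..R}"
    by standard (use h in auto)
  have sl: "slow r 0 (\<lambda>p. of_real (x m (fst p)))" if "m \<in> {..<3 * N}" for m
  proof (rule slow_stolz)
    show "bounded (range (x m))" using st[OF that] by (simp add: stolz_class_def)
  qed (rule h5[OF that])
  \<comment> \<open>\<open>R\<close> may be negative; the interval is then empty, and
    \<open>\<bar>R\<bar>\<close> is a valid bound in every case.\<close>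
  interpret jacobi_slow a b q h "{-R..R}" N r "\<bar>R\<bar>"
  proof
    fix i assume i: "i < N"
    show "slow r 0 (\<lambda>p. complex_of_real (a ((fst p + 1) * N + i - 1) / a ((fst p + 1) * N + i)))"
      using sl[of "3 * i"] i unfolding x by simp
    \<comment> \<open>The given sequences of \<open>b\<close> and \<open>1 / a\<close> start with
      block 0, the transfer matrices at index (j + 1) N; one shift aligns them.\<close>
    show "slow r 0 (\<lambda>p. complex_of_real (b ((fst p + 1) * N + i) / a ((fst p + 1) * N + i)))"
      using slow_shift[OF sl[of "3 * i + 1"]] i unfolding x by (simp add: sh_def)
    show "slow r 0 (\<lambda>p. complex_of_real (1 / a ((fst p + 1) * N + i)))"
      using slow_shift[OF sl[of "3 * i + 2"]] i unfolding x by (simp add: sh_def)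
  qed (use N r h q in auto)
  show ?thesis by (rule ln_U_uniform_limit)
qed

text \<open>The upper bound on the limit stands in for uniform continuity of exp: the error is exp
  (l x) times exp (f - l) - 1.\<close>

lemma exp_uniform_limit:
  fixes f :: "nat \<Rightarrow> real \<Rightarrow> real"
  assumes lim: "uniform_limit S f l sequentially" and B: "\<And>x. x \<in> S \<Longrightarrow> l x \<le> B"
  shows "uniform_limit S (\<lambda>n x. exp (f n x)) (\<lambda>x. exp (l x)) sequentially"
  unfolding uniform_limit_iff
proof (intro allI impI)
  fix e :: real assume "e > 0"
  then have "e / exp B > 0" by simp
  moreover have "isCont (exp :: real \<Rightarrow> real) 0" by simp
  ultimately obtain d where d: "d > 0" "\<And>s::real. \<bar>s\<bar> < d \<Longrightarrow> \<bar>exp s - 1\<bar> < e / exp B"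
    unfolding continuous_at_eps_delta dist_real_def by (metis diff_zero exp_zero)
  have "\<forall>\<^sub>F n in sequentially. \<forall>x\<in>S. dist (f n x) (l x) < d"
    using lim d(1) unfolding uniform_limit_iff by blast
  then show "\<forall>\<^sub>F n in sequentially. \<forall>x\<in>S. dist (exp (f n x)) (exp (l x)) < e"
  proof eventually_elim
    case (elim n)
    show ?case
    proof
      fix x assume x: "x \<in> S"
      have "exp (f n x) - exp (l x) = exp (l x) * (exp (f n x - l x) - 1)"
        by (simp add: right_diff_distrib flip: exp_add)
      then have "dist (exp (f n x)) (exp (l x)) = \<bar>exp (l x) * (exp (f n x - l x) - 1)\<bar>"
        by (simp add: dist_real_def)
      also have "\<dots> = exp (l x) * \<bar>exp (f n x - l x) - 1\<bar>" by (simp add: abs_mult)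
      also have "\<dots> \<le> exp B * \<bar>exp (f n x - l x) - 1\<bar>"
        using B[OF x] by (intro mult_right_mono) auto
      also have "\<dots> < exp B * (e / exp B)"
        using d(2)[of "f n x - l x"] elim x by (intro mult_strict_left_mono) (auto simp: dist_real_def)
      finally show "dist (exp (f n x)) (exp (l x)) < e" by simp
    qed
  qed
qed

lemma U_uniform_limit:
  assumes ln_lim: "\<And>R. \<exists>L. uniform_limit {-R..R} (\<lambda>n x. ln (U n x)) L sequentially"
  shows "\<exists>g. continuous_on UNIV g \<and> (\<forall>x. g x > 0) \<and> (\<forall>R. uniform_limit {-R..R} U g sequentially)"
proof -
  \<comment> \<open>The uniform limits obtained for different \<open>R\<close> are identified
    through the pointwise limit, which gives one function on the whole line.\<close>
  define l where "l x = lim (\<lambda>n. ln (U n x))" for x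
  have lim: "uniform_limit {-R..R} (\<lambda>n x. ln (U n x)) l sequentially" for R
  proof -
    obtain L where L: "uniform_limit {-R..R} (\<lambda>n x. ln (U n x)) L sequentially"
      using ln_lim by blast
    have "L x = l x" if "x \<in> {-R..R}" for x
      using tendsto_uniform_limitI[OF L that] unfolding l_def by (simp add: limI)
    then show ?thesis using uniform_limit_cong'[of "{-R..R}" "\<lambda>n x. ln (U n x)" "\<lambda>n x. ln (U n x)" L l] L
      by simp
  qed
  have cont: "continuous_on {-R..R} l" for R
  proof (rule uniform_limit_theorem[OF _ lim])
    have "continuous_on {-R..R} (\<lambda>x. ln (U n x))" for n
      using U_pos by (intro continuous_on_ln continuous_on_U) (auto simp: less_imp_neq[THEN not_sym])
    then show "\<forall>\<^sub>F n in sequentially. continuous_on {-R..R} (\<lambda>x. ln (U n x))" by simp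
  qed simp
  have cont_UNIV: "continuous_on UNIV l"
  proof (intro continuous_at_imp_continuous_on ballI)
    fix x :: real
    have "x \<in> interior {-(\<bar>x\<bar> + 1)..\<bar>x\<bar> + 1}"
      unfolding interior_atLeastAtMost_real greaterThanLessThan_iff by linarith
    then show "isCont l x" by (rule continuous_on_interior[OF cont])
  qed
  have "uniform_limit {-R..R} (\<lambda>n x. exp (ln (U n x))) (\<lambda>x. exp (l x)) sequentially" for R
  proof -
    have "compact (l ` {-R..R})" by (intro compact_continuous_image cont) simp
    then obtain B where "\<forall>y\<in>l ` {-R..R}. y \<le> B"
      using bounded_imp_bdd_above[OF compact_imp_bounded] unfolding bdd_above_def by blast
    then have "l x \<le> B" if "x \<in> {-R..R}" for x using that by blast
    from exp_uniform_limit[OF lim this] show ?thesis .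
  qed
  then have "uniform_limit {-R..R} U (\<lambda>x. exp (l x)) sequentially" for R
    using U_pos by simp
  moreover have "continuous_on UNIV (\<lambda>x. exp (l x))" by (intro continuous_intros cont_UNIV)
  ultimately show ?thesis by (intro exI[of _ "\<lambda>x. exp (l x)"]) auto
qed

end

section \<open>Bernstein--Szego weights\<close>

lemma integrable_inverse_1_plus_square_lborel: "integrable lborel (\<lambda>x::real. inverse (1 + x\<^sup>2))"
  and integral_inverse_1_plus_square_lborel: "(\<integral>x. inverse (1 + x\<^sup>2) \<partial>lborel) = pi"
  using integrable_inverse_1_plus_square LBINT_inverse_1_plus_square
  by (simp_all add: set_integrable_def interval_lebesgue_integral_def set_lebesgue_integral_def)

section \<open>A Cauchy theorem for the upper half-plane\<close>

lemma half_plane_decay: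
  fixes f :: "complex \<Rightarrow> complex"
  assumes cont: "continuous_on {z. Im z \<ge> 0} f"
    and bd: "\<And>z. Im z \<ge> 0 \<Longrightarrow> cmod z \<ge> R0 \<Longrightarrow> cmod (f z) * (cmod z)\<^sup>2 \<le> C"
  shows "\<exists>B. \<forall>x::real. cmod (f (of_real x)) \<le> B * inverse (1 + x\<^sup>2)"
proof -
  define R where "R = max R0 1"
  have cr: "continuous_on UNIV (\<lambda>x::real. f (of_real x))"
    by (rule continuous_on_compose2[OF cont]) (auto intro!: continuous_intros)
  have "compact ((\<lambda>x::real. cmod (f (of_real x)) * (1 + x\<^sup>2)) ` {-R..R})"
    by (intro compact_continuous_image continuous_intros continuous_on_subset[OF cr]) auto
  then obtain B where B: "\<forall>y\<in>(\<lambda>x::real. cmod (f (of_real x)) * (1 + x\<^sup>2)) ` {-R..R}. y \<le> B"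
    using bounded_imp_bdd_above[OF compact_imp_bounded] unfolding bdd_above_def by blast
  have "cmod (f (of_real x)) * (1 + x\<^sup>2) \<le> max B (2 * C)" for x :: real
  proof (cases "\<bar>x\<bar> \<le> R")
    case True
    then have "x \<in> {-R..R}" by (auto simp: abs_le_iff)
    then show ?thesis using B by (force simp: le_max_iff_disj)
  next
    case False
    then have x: "\<bar>x\<bar> \<ge> R0" "\<bar>x\<bar> \<ge> 1" by (auto simp: R_def)
    have "1 \<le> x\<^sup>2" using x(2) by (simp add: abs_le_square_iff[of 1 x, simplified])
    then have "cmod (f (of_real x)) * (1 + x\<^sup>2) \<le> cmod (f (of_real x)) * (2 * x\<^sup>2)"
      by (intro mult_left_mono) auto
    also have "\<dots> \<le> 2 * C" using bd[of "of_real x"] x by simp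
    finally show ?thesis by simp
  qed
  then have "cmod (f (of_real x)) \<le> max B (2 * C) * inverse (1 + x\<^sup>2)" for x :: real
    by (simp add: pos_le_divide_eq add_pos_nonneg flip: divide_inverse)
  then show ?thesis by blast
qed

text \<open>The interval [-n, n] is closed by an upper semicircle, on which |f| \<le> C / n^2, so
  the arc contributes at most C pi / n. Cauchy's theorem on the convex half-plane allows mere
  continuity on the real axis. The integrals over [-n, n] converge to the full one by dominated
  convergence.\<close>

lemma half_plane_integral_zero:
  fixes f :: "complex \<Rightarrow> complex"
  assumes cont: "continuous_on {z. Im z \<ge> 0} f"
    and hol: "f holomorphic_on {z. Im z > 0}"
    and bd: "\<And>z. Im z \<ge> 0 \<Longrightarrow> cmod z \<ge> R0 \<Longrightarrow> cmod (f z) * (cmod z)\<^sup>2 \<le> C"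
  shows "has_bochner_integral lborel (\<lambda>x::real. f (of_real x)) 0"
proof -
  have cr: "continuous_on UNIV (\<lambda>x::real. f (of_real x))"
    by (rule continuous_on_compose2[OF cont]) (auto intro!: continuous_intros)
  then have meas: "(\<lambda>x::real. f (of_real x)) \<in> borel_measurable lborel"
    by (simp add: borel_measurable_continuous_onI)
  obtain B where B: "\<And>x::real. cmod (f (of_real x)) \<le> B * inverse (1 + x\<^sup>2)"
    using half_plane_decay[OF cont bd] by blast
  have int: "integrable lborel (\<lambda>x::real. f (of_real x))"
    by (rule Bochner_Integration.integrable_bound[where f = "\<lambda>x. B * inverse (1 + x\<^sup>2)"])
      (use meas integrable_inverse_1_plus_square_lborel B in \<open>auto intro: order_trans[OF B abs_ge_self]\<close>)
  define s where "s n x = indicator {-real n..real n} x *\<^sub>R f (of_real x)" for n and x :: real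
  have "(\<lambda>n. \<integral>x. s n x \<partial>lborel) \<longlonglongrightarrow> (\<integral>x. f (of_real x) \<partial>lborel)"
  proof (rule integral_dominated_convergence)
    show "integrable lborel (\<lambda>x::real. cmod (f (of_real x)))"
      using int by (rule integrable_norm)
    show "(\<lambda>x::real. f (of_real x)) \<in> borel_measurable lborel" by (rule meas)
    show "s n \<in> borel_measurable lborel" for n
      unfolding s_def [abs_def] using meas by measurable
    show "AE x in lborel. (\<lambda>n. s n x) \<longlonglongrightarrow> f (of_real x)"
    proof (rule AE_I2)
      fix x :: real
      obtain m where m: "\<bar>x\<bar> < real m" using reals_Archimedean2 by blast
      have "\<forall>\<^sub>F n in sequentially. s n x = f (of_real x)"
        unfolding eventually_sequentially
        by (rule exI[of _ m]) (use m in \<open>auto simp: s_def indicator_def\<close>)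
      then show "(\<lambda>n. s n x) \<longlonglongrightarrow> f (of_real x)"
        by (simp add: tendsto_eventually)
    qed
    show "AE x in lborel. norm (s n x) \<le> cmod (f (of_real x))" for n
      by (rule AE_I2) (simp add: s_def indicator_def)
  qed
  moreover have "(\<lambda>n. \<integral>x. s n x \<partial>lborel) \<longlonglongrightarrow> 0"
  proof (rule Lim_null_comparison)
    show "(\<lambda>n. C * pi * (1 / real n)) \<longlonglongrightarrow> 0"
      using tendsto_mult_right_zero[OF lim_inverse_n'] by blast
    show "\<forall>\<^sub>F n in sequentially. norm (\<integral>x. s n x \<partial>lborel) \<le> C * pi * (1 / real n)"
      using eventually_ge_at_top[of "nat \<lceil>R0\<rceil> + 1"]
    proof eventually_elim
      case (elim n)
      then have n: "n \<ge> 1" "real n \<ge> R0" by linarith+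
      let ?H = "{z. Im z \<ge> 0}"
      let ?l = "linepath (- of_real (real n)) (of_real (real n)) :: real \<Rightarrow> complex"
      let ?p = "part_circlepath 0 (real n) 0 pi"
      have convH: "convex ?H" by (rule convex_halfspace_Im_ge)
      have intH: "interior ?H = {z. Im z > 0}"
        using interior_halfspace_ge[of \<i> 0] by (simp add: inner_complex_def)
      have pl: "path_image ?l \<subseteq> ?H"
        unfolding path_image_linepath by (intro closed_segment_subset convH) auto
      have pp: "path_image ?p \<subseteq> ?H"
        unfolding path_image_part_circlepath[OF pi_ge_zero]
        by (auto simp: Im_exp intro!: mult_nonneg_nonneg sin_ge_zero)
      have norm_p: "cmod z = real n" if "z \<in> path_image ?p" for z
        using path_image_part_circlepath_subset[of 0 pi "real n" 0] that by (auto simp: sphere_def)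
      have i1: "f contour_integrable_on ?l"
        by (intro contour_integrable_continuous_linepath continuous_on_subset[OF cont])
          (use pl in simp)
      have i2: "f contour_integrable_on ?p"
        by (intro contour_integrable_continuous_part_circlepath continuous_on_subset[OF cont] pp)
      have "(f has_contour_integral 0) (?l +++ ?p)"
      proof (rule Cauchy_theorem_convex[OF cont convH, of "{}"])
        fix z assume "z \<in> interior ?H - {}"
        then have "z \<in> {z. Im z > 0}" unfolding intH by simp
        then show "f field_differentiable at z"
          using hol open_halfspace_Im_gt holomorphic_on_imp_differentiable_at by blast
      next
        show "path_image (?l +++ ?p) \<subseteq> ?H"
          using path_image_join_subset[of ?l ?p] pl pp by blast
      qed (auto simp: exp_pi_i)
      then have sum0: "contour_integral ?l f + contour_integral ?p f = 0"
        using contour_integral_join[OF i1 i2] contour_integral_unique by fastforce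
      have "norm (contour_integral ?p f) \<le> C / (real n)\<^sup>2 * real n * \<bar>pi - 0\<bar>"
      proof (rule contour_integral_bound_part_circlepath[OF i2])
        have "0 \<le> cmod (f (of_real (real n))) * (cmod (of_real (real n)))\<^sup>2" by simp
        also have "\<dots> \<le> C" by (rule bd) (use n in auto)
        finally show "0 \<le> C / (real n)\<^sup>2" by simp
        show "norm (f z) \<le> C / (real n)\<^sup>2" if "z \<in> path_image ?p" for z
          using bd[of z] pp that norm_p[OF that] n by (auto simp: field_simps)
      qed simp
      also have "\<dots> = C * pi * (1 / real n)" using n by (simp add: power2_eq_square)
      finally have "norm (contour_integral ?l f) \<le> C * pi * (1 / real n)"
        using sum0 by (metis add_eq_0_iff norm_minus_cancel)
      moreover have "contour_integral ?l f = integral {-real n..real n} (\<lambda>x. f (of_real x))"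
        using n by (subst contour_integral_linepath_Reals_eq) auto
      moreover have "set_integrable lborel {-real n..real n} (\<lambda>x. f (of_real x))"
        unfolding set_integrable_def using int by (intro integrable_mult_indicator) auto
      then have "integral {-real n..real n} (\<lambda>x. f (of_real x)) = (\<integral>x. s n x \<partial>lborel)"
        using set_borel_integral_eq_integral(2) by (fastforce simp: set_lebesgue_integral_def s_def)
      ultimately show ?case by simp
    qed
  qed
  ultimately have "(\<integral>x. f (of_real x) \<partial>lborel) = 0" using LIMSEQ_unique by blast
  then show ?thesis using int by (simp add: has_bochner_integral_iff)
qed

section \<open>The recurrence polynomials at complex arguments\<close>

context jacobi
begin

text \<open>The continuation of \<open>op\<close> off the real axis. Repeating the recurrence makes
  holomorphy and the behaviour at infinity accessible to the same induction.\<close>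

fun opc :: "nat \<Rightarrow> complex \<Rightarrow> complex" where
  "opc 0 z = 1"
| "opc (Suc 0) z = (z - of_real (b 0)) / of_real (a 0)"
| "opc (Suc (Suc n)) z = ((z - of_real (b (Suc n))) * opc (Suc n) z - of_real (a n) * opc n z)
     / of_real (a (Suc n))"


end

lemma half_plane_integral_zero':
  fixes f :: "complex \<Rightarrow> complex"
  assumes cont: "continuous_on {z. Im z \<ge> 0} f"
    and hol: "f holomorphic_on {z. Im z > 0}"
    and lim: "((\<lambda>z. f z * z\<^sup>2) \<longlongrightarrow> c) at_infinity"
  shows "has_bochner_integral lborel (\<lambda>x::real. f (of_real x)) 0"
proof -
  have "\<forall>\<^sub>F z in at_infinity. norm (f z * z\<^sup>2) < norm c + 1"
    by (rule order_tendstoD(2)[OF tendsto_norm[OF lim]]) simp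
  then obtain R0 where "\<And>z. norm z \<ge> R0 \<Longrightarrow> norm (f z * z\<^sup>2) < norm c + 1"
    unfolding eventually_at_infinity by blast
  then have "norm (f z) * (norm z)\<^sup>2 \<le> norm c + 1" if "norm z \<ge> R0" for z
    using that by (force simp: norm_mult norm_power less_imp_le)
  then show ?thesis by (intro half_plane_integral_zero[OF cont hol]) auto
qed

context jacobi
begin

lemma a_nz: "a n \<noteq> 0" using a_pos[of n] by simp

lemma opc_of_real: "opc n (of_real x) = of_real (op n x)"
  by (induction n rule: induct_nat_012) (auto simp: op_1 op_Suc_Suc)

lemma opc_holomorphic: "opc n holomorphic_on S"
proof (induction n rule: induct_nat_012)
  case 0
  then show ?case by (rule holomorphic_transform[OF holomorphic_on_const[of 1]]) simp
next
  case 1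
  have "(\<lambda>z. (z - of_real (b 0)) / of_real (a 0)) holomorphic_on S"
    using a_nz by (intro holomorphic_intros) auto
  then show ?case by (rule holomorphic_transform) simp
next
  case (ge2 n)
  have "(\<lambda>z. ((z - of_real (b (Suc n))) * opc (Suc n) z - of_real (a n) * opc n z)
     / of_real (a (Suc n))) holomorphic_on S"
    using a_nz by (intro holomorphic_intros ge2) auto
  then show ?case by (rule holomorphic_transform) simp
qed

text \<open>The leading coefficient of p_n, taken as a complex number.\<close>

definition \<kappa> :: "nat \<Rightarrow> complex" where "\<kappa> n = (\<Prod>i<n. 1 / of_real (a i))"

lemma \<kappa>_nz: "\<kappa> n \<noteq> 0" using a_nz by (simp add: \<kappa>_def)

lemma eventually_nz_at_infinity: "\<forall>\<^sub>F z in at_infinity. z \<noteq> (0::complex)"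
  unfolding eventually_at_infinity by (rule exI[of _ 1]) auto

lemma inverse_at_infinity: "((\<lambda>z::complex. c / z) \<longlongrightarrow> 0) at_infinity"
  using tendsto_mult_right_zero[OF tendsto_inverse_0, of c] by (simp add: divide_inverse)

lemma opc_asymptotic: "((\<lambda>z. opc n z / z ^ n) \<longlongrightarrow> \<kappa> n) at_infinity"
proof (induction n rule: induct_nat_012)
  case 0
  show ?case by (simp add: \<kappa>_def)
next
  case 1
  have "((\<lambda>z::complex. (1 - of_real (b 0) / z) / of_real (a 0)) \<longlongrightarrow> (1 - 0) / of_real (a 0)) at_infinity"
    using a_nz by (intro tendsto_intros inverse_at_infinity) auto
  moreover have "\<forall>\<^sub>F z in at_infinity. (1 - of_real (b 0) / z) / of_real (a 0) = opc (Suc 0) z / z ^ Suc 0"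
    using eventually_nz_at_infinity
    by eventually_elim (use a_nz in \<open>simp add: divide_simps\<close>)
  ultimately show ?case by (auto simp: \<kappa>_def elim: Lim_transform_eventually)
next
  case (ge2 n)
  have "((\<lambda>z. ((1 - of_real (b (Suc n)) / z) * (opc (Suc n) z / z ^ Suc n)
        - (of_real (a n) / z) * (1 / z) * (opc n z / z ^ n)) / of_real (a (Suc n)))
      \<longlongrightarrow> ((1 - 0) * \<kappa> (Suc n) - 0 * 0 * \<kappa> n) / of_real (a (Suc n))) at_infinity"
    using a_nz by (intro tendsto_intros inverse_at_infinity ge2) auto
  moreover have "\<forall>\<^sub>F z in at_infinity. ((1 - of_real (b (Suc n)) / z) * (opc (Suc n) z / z ^ Suc n)
        - (of_real (a n) / z) * (1 / z) * (opc n z / z ^ n)) / of_real (a (Suc n))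
      = opc (Suc (Suc n)) z / z ^ Suc (Suc n)"
    using eventually_nz_at_infinity
    by eventually_elim (use a_nz in \<open>simp add: field_simps\<close>)
  ultimately have "((\<lambda>z. opc (Suc (Suc n)) z / z ^ Suc (Suc n))
      \<longlongrightarrow> ((1 - 0) * \<kappa> (Suc n) - 0 * 0 * \<kappa> n) / of_real (a (Suc n))) at_infinity"
    by (rule Lim_transform_eventually)
  moreover have "((1 - 0) * \<kappa> (Suc n) - 0 * 0 * \<kappa> n) / of_real (a (Suc n)) = \<kappa> (Suc (Suc n))"
    by (simp add: \<kappa>_def)
  ultimately show ?case by (simp only:)
qed

text \<open>The Christoffel-Darboux formula for the pair of z and its conjugate, obtained from the
  imaginary part of the recurrence times the conjugate of p_{n+1}. Its purpose is the sign of the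
  left side in the upper half-plane.\<close>

lemma christoffel_darboux_Im:
  "a n * Im (opc (Suc n) z * cnj (opc n z)) = Im z * (\<Sum>j\<le>n. (cmod (opc j z))\<^sup>2)"
proof (induction n)
  case 0
  then show ?case using a_nz[of 0] by simp
next
  case (Suc n)
  have rec: "of_real (a (Suc n)) * (opc (Suc (Suc n)) z * cnj (opc (Suc n) z))
      = (z - of_real (b (Suc n))) * (opc (Suc n) z * cnj (opc (Suc n) z))
        - of_real (a n) * (opc n z * cnj (opc (Suc n) z))"
  proof -
    have "of_real (a (Suc n)) * opc (Suc (Suc n)) z
        = (z - of_real (b (Suc n))) * opc (Suc n) z - of_real (a n) * opc n z"
      using a_nz by simp
    then show ?thesis by (simp only: mult.assoc[symmetric]) (simp only: left_diff_distrib)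
  qed
  have Imr: "Im (of_real r * w) = r * Im w" "Im ((z - of_real r) * of_real r') = Im z * r'" for r r' w
    by simp_all
  note rec
  then have "Im (of_real (a (Suc n)) * (opc (Suc (Suc n)) z * cnj (opc (Suc n) z)))
      = Im ((z - of_real (b (Suc n))) * of_real ((cmod (opc (Suc n) z))\<^sup>2))
        - Im (of_real (a n) * (opc n z * cnj (opc (Suc n) z)))"
    by (simp only: minus_complex.sel complex_norm_square)
  moreover have "Im (opc n z * cnj (opc (Suc n) z)) = - Im (opc (Suc n) z * cnj (opc n z))"
    by (simp add: algebra_simps)
  ultimately have "a (Suc n) * Im (opc (Suc (Suc n)) z * cnj (opc (Suc n) z))
      = Im z * (cmod (opc (Suc n) z))\<^sup>2 + a n * Im (opc (Suc n) z * cnj (opc n z))"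
    by (simp only: Imr mult_minus_right diff_minus_eq_add)
  then show ?case
    unfolding Suc by (simp only: sum.atMost_Suc distrib_left add.commute)
qed

lemma opc_nontrivial: "opc n z \<noteq> 0 \<or> opc (Suc n) z \<noteq> 0"
proof (induction n)
  case (Suc n)
  show ?case
  proof (rule ccontr)
    assume "\<not> ?thesis"
    then have *: "opc (Suc n) z = 0" "opc (Suc (Suc n)) z = 0" by auto
    then have "opc n z = 0" using a_nz[of n] a_nz[of "Suc n"] by simp
    then show False using Suc * by simp
  qed
qed simp

text \<open>On the real axis a_n |\<eta>_n|^2 = U_n, so this polynomial factors the denominator of
  the weight; the choice Im \<sigma> > 0 keeps its zeros out of the closed upper half-plane.\<close>

definition \<eta> :: "nat \<Rightarrow> complex \<Rightarrow> complex"
  where "\<eta> n z = opc (Suc n) z + \<sigma> * opc n z"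

text \<open>At a zero, p_{n+1} = - \<sigma> p_n, so the imaginary part of p_{n+1} times the
  conjugate of p_n is - Im \<sigma> |p_n|^2, whereas Christoffel-Darboux makes it nonnegative. Hence
  p_n and with it p_{n+1} vanish, which the recurrence forbids.\<close>

lemma \<eta>_nz:
  assumes "Im z \<ge> 0" shows "\<eta> n z \<noteq> 0"
proof
  assume "\<eta> n z = 0"
  then have e: "opc (Suc n) z = - \<sigma> * opc n z" by (simp add: \<eta>_def add_eq_0_iff)
  have "opc (Suc n) z * cnj (opc n z) = - \<sigma> * of_real ((cmod (opc n z))\<^sup>2)"
    unfolding e complex_norm_square by (simp only: mult.assoc)
  then have "Im (opc (Suc n) z * cnj (opc n z)) = - Im \<sigma> * (cmod (opc n z))\<^sup>2"
    by simp
  then have "a n * (- Im \<sigma> * (cmod (opc n z))\<^sup>2) = Im z * (\<Sum>j\<le>n. (cmod (opc j z))\<^sup>2)"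
    using christoffel_darboux_Im[of n z] by simp
  moreover have "Im z * (\<Sum>j\<le>n. (cmod (opc j z))\<^sup>2) \<ge> 0"
    using assms by (intro mult_nonneg_nonneg sum_nonneg) auto
  ultimately have "a n * Im \<sigma> * (cmod (opc n z))\<^sup>2 \<le> 0" by simp
  then have "opc n z = 0" using a_pos[of n] Im_\<sigma>_pos by (simp add: mult_le_0_iff)
  then show False using e opc_nontrivial[of n z] by simp
qed

lemma \<eta>_holomorphic: "\<eta> n holomorphic_on S"
  unfolding \<eta>_def [abs_def] by (intro holomorphic_intros opc_holomorphic)

lemma \<eta>_asymptotic: "((\<lambda>z. \<eta> n z / z ^ Suc n) \<longlongrightarrow> \<kappa> (Suc n)) at_infinity"
proof -
  have "((\<lambda>z. opc (Suc n) z / z ^ Suc n + (\<sigma> / z) * (opc n z / z ^ n)) \<longlongrightarrow> \<kappa> (Suc n) + 0 * \<kappa> n) at_infinity"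
    by (intro tendsto_add tendsto_mult opc_asymptotic inverse_at_infinity)
  moreover have "opc (Suc n) z / z ^ Suc n + (\<sigma> / z) * (opc n z / z ^ n) = \<eta> n z / z ^ Suc n" for z
    by (simp add: \<eta>_def add_divide_distrib del: opc.simps)
  ultimately show ?thesis by simp
qed

text \<open>The denominator has degree n + 1, so the quotient decays like z^(j - n - 1); for j < n
  this is at least quadratic decay.\<close>

lemma opc_over_\<eta>_integral:
  assumes "j < n"
  shows "has_bochner_integral lborel (\<lambda>x::real. opc j (of_real x) / \<eta> n (of_real x)) 0"
proof -
  obtain k where k: "n = Suc (j + k)" using assms less_iff_Suc_add by auto
  show ?thesis
  proof (rule half_plane_integral_zero')
    show "continuous_on {z. Im z \<ge> 0} (\<lambda>z. opc j z / \<eta> n z)"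
      using \<eta>_nz by (intro continuous_on_divide holomorphic_on_imp_continuous_on opc_holomorphic \<eta>_holomorphic) auto
    show "(\<lambda>z. opc j z / \<eta> n z) holomorphic_on {z. Im z > 0}"
      using \<eta>_nz by (intro holomorphic_on_divide opc_holomorphic \<eta>_holomorphic) auto
    have "((\<lambda>z. (opc j z / z ^ j) / (\<eta> n z / z ^ Suc n) * (1 / z) ^ k) \<longlongrightarrow> \<kappa> j / \<kappa> (Suc n) * 0 ^ k) at_infinity"
      by (intro tendsto_mult tendsto_divide opc_asymptotic \<eta>_asymptotic tendsto_power inverse_at_infinity \<kappa>_nz)
    moreover have "\<forall>\<^sub>F z in at_infinity. (opc j z / z ^ j) / (\<eta> n z / z ^ Suc n) * (1 / z) ^ k = opc j z / \<eta> n z * z\<^sup>2"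
      using eventually_nz_at_infinity
      by eventually_elim (simp add: k power_add power_divide power2_eq_square)
    ultimately show "((\<lambda>z. opc j z / \<eta> n z * z\<^sup>2) \<longlongrightarrow> \<kappa> j / \<kappa> (Suc n) * 0 ^ k) at_infinity"
      by (rule Lim_transform_eventually)
  qed
qed

text \<open>For j = n the quotient behaves like a_n / z, a_n being the ratio of consecutive leading
  coefficients. Subtracting a_n / (z + \<i>), whose pole lies in the lower half-plane, restores
  quadratic decay.\<close>

lemma opc_over_\<eta>_integral_diag:
  assumes n: "n = Suc m"
  shows "has_bochner_integral lborel
    (\<lambda>x::real. opc n (of_real x) / \<eta> n (of_real x) - of_real (a n) / (of_real x + \<i>)) 0"
proof (rule half_plane_integral_zero')
  let ?f = "\<lambda>z. opc n z / \<eta> n z - of_real (a n) / (z + \<i>)"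
  have nz: "z + \<i> \<noteq> 0" if "Im z \<ge> 0" for z using that by (auto simp: complex_eq_iff)
  show "continuous_on {z. Im z \<ge> 0} ?f"
    using \<eta>_nz nz by (intro continuous_intros holomorphic_on_imp_continuous_on opc_holomorphic \<eta>_holomorphic) auto
  show "?f holomorphic_on {z. Im z > 0}"
    using \<eta>_nz nz by (intro holomorphic_intros opc_holomorphic \<eta>_holomorphic) auto
  \<comment> \<open>Inserting the recurrence for a_n p_{n+1} turns p_n (z + \<i>) - a_n \<eta>_n
    into c p_n + a_m p_m: the terms of degree n + 1 cancel.\<close>
  define c where "c = \<i> + of_real (b n) - of_real (a n) * \<sigma>"
  let ?G = "\<lambda>z. (c * (opc n z / z ^ n) + (of_real (a m) / z) * (opc m z / z ^ m)) / (\<eta> n z / z ^ Suc n * (1 + \<i> / z))"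
  have rec: "of_real (a n) * opc (Suc n) z = (z - of_real (b n)) * opc n z - of_real (a m) * opc m z" for z
    unfolding n using a_nz[of "Suc m"] by simp
  have "(?G \<longlongrightarrow> (c * \<kappa> n + 0 * \<kappa> m) / (\<kappa> (Suc n) * (1 + 0))) at_infinity"
    by (intro tendsto_mult tendsto_divide tendsto_add tendsto_const opc_asymptotic \<eta>_asymptotic inverse_at_infinity)
      (use \<kappa>_nz in simp)
  moreover have "\<forall>\<^sub>F z in at_infinity. ?G z
      = (?f z) * z\<^sup>2"
  proof -
    have "\<forall>\<^sub>F z in at_infinity. \<eta> n z / z ^ Suc n \<noteq> 0"
      by (rule tendsto_imp_eventually_ne[OF \<eta>_asymptotic \<kappa>_nz])
    moreover have "\<forall>\<^sub>F z in at_infinity. z + \<i> \<noteq> 0"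
      unfolding eventually_at_infinity
    proof (rule exI[of _ 2], intro allI impI notI)
      fix z :: complex assume z: "2 \<le> cmod z" "z + \<i> = 0"
      then have "z = - \<i>" by (simp add: eq_neg_iff_add_eq_0)
      then show False using z(1) by simp
    qed
    ultimately show ?thesis using eventually_nz_at_infinity
    proof eventually_elim
      case (elim z)
      have e: "\<eta> n z \<noteq> 0" using elim(1) by auto
      have "opc n z * (z + \<i>) - of_real (a n) * \<eta> n z
          = opc n z * (z + \<i>) - of_real (a n) * opc (Suc n) z - of_real (a n) * \<sigma> * opc n z"
        unfolding \<eta>_def by (simp add: algebra_simps del: opc.simps)
      also have "\<dots> = c * opc n z + of_real (a m) * opc m z"
        unfolding rec c_def by (simp add: algebra_simps del: opc.simps)
      finally have num: "opc n z * (z + \<i>) - of_real (a n) * \<eta> n z = c * opc n z + of_real (a m) * opc m z" .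
      have "(?f z) * z\<^sup>2
          = (c * opc n z + of_real (a m) * opc m z) * z\<^sup>2 / (\<eta> n z * (z + \<i>))"
        unfolding num[symmetric] using e elim(2) by (simp add: diff_divide_distrib left_diff_distrib del: opc.simps)
      also have "\<dots> = ((c * opc n z + of_real (a m) * opc m z) / z ^ n) / (\<eta> n z / z ^ Suc n * ((z + \<i>) / z))"
        using elim(3) by (simp add: power2_eq_square del: opc.simps)
      also have "(c * opc n z + of_real (a m) * opc m z) / z ^ n = c * (opc n z / z ^ n) + (of_real (a m) / z) * (opc m z / z ^ m)"
        unfolding n by (simp add: add_divide_distrib del: opc.simps)
      also have "(z + \<i>) / z = 1 + \<i> / z" using elim(3) by (simp add: add_divide_distrib)
      finally show ?case by simp
    qed
  qed
  ultimately show "((\<lambda>z. (?f z) * z\<^sup>2)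
      \<longlongrightarrow> (c * \<kappa> n + 0 * \<kappa> m) / (\<kappa> (Suc n) * (1 + 0))) at_infinity"
    by (rule Lim_transform_eventually)
qed


section \<open>Orthonormality with respect to the weights\<close>

definition szego :: "nat \<Rightarrow> real \<Rightarrow> real"
  where "szego n x = Im \<sigma> / (pi * U n x)"

lemma norm_\<eta>: "a n * (cmod (\<eta> n (of_real x)))\<^sup>2 = U n x"
  using Im_\<sigma>_pos unfolding U_qform qform_def \<eta>_def opc_of_real by (simp add: add.commute)

lemma \<eta>_nz_real: "\<eta> n (of_real x) \<noteq> 0"
  by (rule \<eta>_nz) simp

lemma szego_\<eta>: "szego n x * (pi * a n) * (cmod (\<eta> n (of_real x)))\<^sup>2 = Im \<sigma>"
  using a_nz[of n] \<eta>_nz_real[of n x] unfolding szego_def norm_\<eta>[symmetric] by simp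

lemma Im_over_\<eta>:
  "Im (w * of_real u / \<eta> n (of_real x)) * Im \<sigma>
    = szego n x * (pi * a n) * u * Im (w * cnj (\<eta> n (of_real x)))"
proof -
  define m where "m = (cmod (\<eta> n (of_real x)))\<^sup>2"
  have m: "m \<noteq> 0" using \<eta>_nz_real by (simp add: m_def)
  have "w * of_real u / \<eta> n (of_real x) = of_real (u / m) * (w * cnj (\<eta> n (of_real x)))"
    by (subst complex_div_cnj) (simp add: m_def mult_ac)
  then have "Im (w * of_real u / \<eta> n (of_real x)) = u / m * Im (w * cnj (\<eta> n (of_real x)))"
    by (simp only: Im_complex_of_real Re_complex_of_real times_complex.sel)
  then show ?thesis
    unfolding szego_\<eta>[of n x, symmetric] m_def[symmetric] using m by simp
qed

lemma Im_inverse_\<eta>: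
  "Im (1 * of_real u / \<eta> n (of_real x)) * (- 1 / (pi * a n)) = u * op n x * szego n x"
proof -
  let ?r = "Im (1 * of_real u / \<eta> n (of_real x)) * (- 1 / (pi * a n))"
  have "Im \<sigma> * ?r = szego n x * (pi * a n) * u * Im (1 * cnj (\<eta> n (of_real x))) * (- 1 / (pi * a n))"
    unfolding Im_over_\<eta>[symmetric] by simp
  also have "Im (1 * cnj (\<eta> n (of_real x))) = - Im \<sigma> * op n x"
    by (simp add: \<eta>_def opc_of_real)
  finally have "Im \<sigma> * ?r = Im \<sigma> * (u * op n x * szego n x)" using a_nz by simp
  then show ?thesis using Im_\<sigma>_pos by (simp only: mult_cancel_left) simp
qed

text \<open>One vanishing contour integral yields both claims. The imaginary part of w p_j /
  \<eta>_n is, up to a constant, the weight times p_j times the imaginary part of w times the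
  conjugate of \<eta>_n; the last factor is proportional to p_n for w = 1 and to p_{n+1} for w =
  \<sigma>.\<close>

lemma szego_orthogonal:
  assumes "j < n"
  shows "has_bochner_integral lborel (\<lambda>x. op j x * op n x * szego n x) 0"
    and "has_bochner_integral lborel (\<lambda>x. op j x * op (Suc n) x * szego n x) 0"
proof -
  let ?s = "\<lambda>x. Im (\<sigma> * of_real (op j x) / \<eta> n (of_real x))"
  have c: "Im \<sigma> * pi * a n \<noteq> 0" using Im_\<sigma>_pos a_nz by simp
  have gen: "has_bochner_integral lborel (\<lambda>x. Im (w * of_real (op j x) / \<eta> n (of_real x))) 0" for w
  proof -
    have "has_bochner_integral lborel (\<lambda>x. w * (opc j (of_real x) / \<eta> n (of_real x))) (w * 0)"
      by (rule has_bochner_integral_mult_right) (rule opc_over_\<eta>_integral[OF assms])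
    from has_bochner_integral_bounded_linear[OF bounded_linear_Im this]
    show ?thesis by (simp add: opc_of_real)
  qed
  have 2: "?s x * (1 / (pi * a n)) = op j x * op (Suc n) x * szego n x" for x
  proof -
    have "Im \<sigma> * (?s x * (1 / (pi * a n)))
        = szego n x * (pi * a n) * op j x * Im (\<sigma> * cnj (\<eta> n (of_real x))) * (1 / (pi * a n))"
      unfolding Im_over_\<eta>[symmetric] by simp
    also have "Im (\<sigma> * cnj (\<eta> n (of_real x))) = Im \<sigma> * op (Suc n) x"
      unfolding \<eta>_def opc_of_real by (simp add: algebra_simps)
    finally have "Im \<sigma> * (?s x * (1 / (pi * a n)))
        = Im \<sigma> * (op j x * op (Suc n) x * szego n x)" using a_nz by simp
    then show ?thesis using Im_\<sigma>_pos by (simp only: mult_cancel_left) simp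
  qed
  show "has_bochner_integral lborel (\<lambda>x. op j x * op n x * szego n x) 0"
    using has_bochner_integral_mult_left[OF gen[of 1], of "- 1 / (pi * a n)"]
    unfolding Im_inverse_\<eta> by simp
  show "has_bochner_integral lborel (\<lambda>x. op j x * op (Suc n) x * szego n x) 0"
    using has_bochner_integral_mult_left[OF gen[of \<sigma>], of "1 / (pi * a n)"] unfolding 2 by simp
qed

text \<open>The mass comes entirely from the subtracted term: its imaginary part is - a_n / (1 +
  x^2) with integral - a_n pi, and the factor - 1 / (pi a_n) turns this into 1.\<close>

lemma szego_normalized:
  assumes n: "n = Suc m"
  shows "has_bochner_integral lborel (\<lambda>x. op n x * op n x * szego n x) 1"
proof -
  let ?G = "\<lambda>x::real. Im (opc n (of_real x) / \<eta> n (of_real x) - of_real (a n) / (of_real x + \<i>))"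
  let ?H = "\<lambda>x::real. ?G x + - a n * inverse (1 + x\<^sup>2)"
  have "has_bochner_integral lborel (\<lambda>x::real. ?G x) 0"
    using has_bochner_integral_bounded_linear[OF bounded_linear_Im opc_over_\<eta>_integral_diag[OF n]] by simp
  moreover have "has_bochner_integral lborel (\<lambda>x::real. inverse (1 + x\<^sup>2)) pi"
    using integrable_inverse_1_plus_square_lborel integral_inverse_1_plus_square_lborel
    by (simp add: has_bochner_integral_iff)
  then have "has_bochner_integral lborel (\<lambda>x::real. - a n * inverse (1 + x\<^sup>2)) (- a n * pi)"
    by (intro has_bochner_integral_mult_right)
  ultimately have "has_bochner_integral lborel (\<lambda>x::real. ?H x) (0 + - a n * pi)"
    by (rule has_bochner_integral_add)
  from has_bochner_integral_mult_left[OF this, of "- 1 / (pi * a n)"]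
  have "has_bochner_integral lborel (\<lambda>x::real. (?H x) * (- 1 / (pi * a n))) 1"
    using a_nz by simp
  moreover have "(?H x) * (- 1 / (pi * a n)) = op n x * op n x * szego n x" for x :: real
  proof -
    have "Im (of_real (a n) / (of_real x + \<i>)) = - a n * inverse (1 + x\<^sup>2)"
      by (simp add: Im_divide divide_inverse add.commute power2_eq_square)
    then have "?H x = Im (1 * of_real (op n x) / \<eta> n (of_real x))"
      by (simp add: opc_of_real)
    then show ?thesis by (simp only: Im_inverse_\<eta>)
  qed
  ultimately show ?thesis by (simp only:)
qed

lemma op_recurrence: "a k * op k x = (x - b (Suc k)) * op (Suc k) x - a (Suc k) * op (Suc (Suc k)) x"
  using a_nz[of "Suc k"] by (simp add: op_Suc_Suc)

lemma op_times_x: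
  "x * op j x = a j * op (Suc j) x + b j * op j x + (if j = 0 then 0 else a (j - 1) * op (j - 1) x)"
  by (cases j) (use a_nz in \<open>simp_all add: op_1 op_Suc_Suc field_simps\<close>)

text \<open>Orthonormality descends from \<open>p\<^sub>n\<close>, \<open>p\<^sub>n\<^sub>+\<^sub>1\<close> to all lower degrees by running the recurrence
  backwards.\<close>

lemma szego_orthonormal:
  assumes n: "n = Suc m" and jk: "j \<le> n" "k \<le> n"
  shows "has_bochner_integral lborel (\<lambda>x. op j x * op k x * szego n x) (if j = k then 1 else 0)"
proof -
  \<comment> \<open>The backward recurrence expresses p_k by p_{k+1} and p_{k+2}, so the downward
    induction has to carry the orthogonality of p_{k+1} to the p_j with j < k as well.\<close>
  define P where "P k \<longleftrightarrow>
    (\<forall>j\<le>k. has_bochner_integral lborel (\<lambda>x. op j x * op k x * szego n x) (if j = k then 1 else 0)) \<and>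
    (\<forall>j<k. has_bochner_integral lborel (\<lambda>x. op j x * op (Suc k) x * szego n x) 0)" for k
  have P: "P k" if "k \<le> n" for k
    using that
  proof (induction rule: inc_induct)
    case base
    show ?case
      unfolding P_def using szego_orthogonal[of _ n] szego_normalized[OF n] by auto
  next
    case (step k)
    have 1: "has_bochner_integral lborel (\<lambda>x. op j x * op (Suc k) x * szego n x) (if j = Suc k then 1 else 0)"
      if "j \<le> Suc k" for j using step.IH that unfolding P_def by blast
    have 2: "has_bochner_integral lborel (\<lambda>x. op j x * op (Suc (Suc k)) x * szego n x) 0"
      if "j < Suc k" for j using step.IH that unfolding P_def by blast
    have "has_bochner_integral lborel (\<lambda>x. op j x * op k x * szego n x) (if j = k then 1 else 0)"
      if j: "j \<le> k" for j
    proof -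
      \<comment> \<open>For \<open>j = 0\<close> the index \<open>j - 1\<close> truncates to 0, and
        the coefficient 0 removes that term.\<close>
      define c where "c = (if j = 0 then 0 else a (j - 1))"
      let ?G = "\<lambda>x. ((a j * (op (Suc j) x * op (Suc k) x * szego n x)
          + (b j - b (Suc k)) * (op j x * op (Suc k) x * szego n x)
          + c * (op (j - 1) x * op (Suc k) x * szego n x))
          - a (Suc k) * (op j x * op (Suc (Suc k)) x * szego n x)) / a k"
      let ?v = "((a j * (if Suc j = Suc k then 1 else 0) + (b j - b (Suc k)) * (if j = Suc k then 1 else 0)
          + c * (if j - 1 = Suc k then 1 else 0)) - a (Suc k) * 0) / a k :: real"
      have "has_bochner_integral lborel (\<lambda>x. ?G x) ?v"
        by (intro has_bochner_integral_divide_zero has_bochner_integral_add has_bochner_integral_diff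
            has_bochner_integral_mult_right 1 2) (use j in auto)
      moreover have "?G x
        = op j x * op k x * szego n x" for x
      proof -
        have "a k * (op j x * op k x * szego n x)
            = op j x * ((x - b (Suc k)) * op (Suc k) x - a (Suc k) * op (Suc (Suc k)) x) * szego n x"
          unfolding op_recurrence[symmetric] by simp
        also have "\<dots> = (x * op j x) * op (Suc k) x * szego n x - b (Suc k) * (op j x * op (Suc k) x * szego n x)
            - a (Suc k) * (op j x * op (Suc (Suc k)) x * szego n x)"
          by (simp add: algebra_simps)
        also have "x * op j x = a j * op (Suc j) x + b j * op j x + c * op (j - 1) x"
          using op_times_x[of x j] by (simp add: c_def)
        finally show ?thesis using a_nz[of k] by (simp add: field_simps)
      qed
      moreover have "?v = (if j = k then 1 else 0)"
        using j a_nz[of k] by auto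
      ultimately show ?thesis by (simp only:)
    qed
    moreover have "has_bochner_integral lborel (\<lambda>x. op j x * op (Suc k) x * szego n x) 0" if "j < k" for j
      using 1[of j] that by simp
    ultimately show ?case unfolding P_def by blast
  qed
  show ?thesis
  proof (cases "j \<le> k")
    case True
    then show ?thesis using P[OF jk(2)] unfolding P_def by blast
  next
    case False
    then have "k \<le> j" by simp
    then have "has_bochner_integral lborel (\<lambda>x. op k x * op j x * szego n x) (if k = j then 1 else 0)"
      using P[OF jk(1)] unfolding P_def by blast
    then show ?thesis by (simp add: mult.commute eq_commute)
  qed
qed


section \<open>Stieltjes transforms\<close>

text \<open>The given measure satisfies this for every n, the n-th weight only up to level n; with
  the level as an argument both are treated alike. Total mass 1 is contained in the case i = j =
  0.\<close>

definition orthonormal_upto :: "nat \<Rightarrow> real measure \<Rightarrow> bool"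
  where "orthonormal_upto n M \<longleftrightarrow> sets M = sets borel \<and>
    (\<forall>i\<le>n. \<forall>j\<le>n. has_bochner_integral M (\<lambda>x. op i x * op j x) (if i = j then 1 else 0))"

text \<open>The coefficients of the Cauchy kernel 1 / (t - z) with respect to the p_j, known as
  functions of the second kind. Index 0 gives the Stieltjes transform, as p_0 = 1.\<close>

definition \<psi> :: "real measure \<Rightarrow> complex \<Rightarrow> nat \<Rightarrow> complex"
  where "\<psi> M z j = (\<integral>t. of_real (op j t) / (of_real t - z) \<partial>M)"

lemma cauchy_kernel_bound:
  assumes "Im z > 0" shows "cmod (1 / (of_real t - z)) \<le> 1 / Im z"
proof -
  have "Im z \<le> cmod (of_real t - z)"
    using abs_Im_le_cmod[of "of_real t - z"] assms by simp
  then show ?thesis using assms by (simp add: norm_divide frac_le)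
qed

lemma cauchy_kernel_measurable:
  assumes "sets M = sets borel" "Im z > 0"
  shows "(\<lambda>t. 1 / (complex_of_real t - z)) \<in> borel_measurable M"
proof -
  have "continuous_on UNIV (\<lambda>t. 1 / (complex_of_real t - z))"
    using assms(2) by (intro continuous_intros) (auto simp: complex_eq_iff)
  then have "(\<lambda>t. 1 / (complex_of_real t - z)) \<in> borel_measurable borel"
    by (rule borel_measurable_continuous_onI)
  then show ?thesis using measurable_cong_sets[OF assms(1) refl] by blast
qed

lemma op_measurable:
  assumes "sets M = sets borel" shows "op j \<in> borel_measurable M"
  using borel_measurable_continuous_onI[OF continuous_on_op] measurable_cong_sets[OF assms refl] by blast

context
  fixes n :: nat and M :: "real measure"
  assumes M: "orthonormal_upto n M"
begin

lemma sets_M: "sets M = sets borel" using M by (simp add: orthonormal_upto_def)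

lemma op_op_integral:
  "i \<le> n \<Longrightarrow> j \<le> n \<Longrightarrow> has_bochner_integral M (\<lambda>x. op i x * op j x) (if i = j then 1 else 0)"
  using M by (simp add: orthonormal_upto_def)

lemma op_integral:
  "j \<le> n \<Longrightarrow> has_bochner_integral M (op j) (if j = 0 then 1 else 0)"
  using op_op_integral[of j 0] by simp

lemma one_integral: "has_bochner_integral M (\<lambda>_. 1 :: real) 1"
  using op_op_integral[of 0 0] by simp

lemma bounded_times_op_integrable:
  fixes u :: "real \<Rightarrow> 'b::{real_normed_field, banach, second_countable_topology}"
  assumes "u \<in> borel_measurable M" "\<And>t. norm (u t) \<le> B" "j \<le> n"
  shows "integrable M (\<lambda>t. u t * of_real (op j t))"
proof (rule Bochner_Integration.integrable_bound)
  show "integrable M (\<lambda>t. B * op j t)"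
    using op_integral[OF assms(3)] by (auto simp: has_bochner_integral_iff)
  show "(\<lambda>t. u t * of_real (op j t)) \<in> borel_measurable M"
    using assms(1) op_measurable[OF sets_M, of j] by measurable
  show "AE t in M. norm (u t * of_real (op j t)) \<le> norm (B * op j t)"
  proof (rule AE_I2)
    fix t
    have "norm (u t * of_real (op j t)) \<le> B * \<bar>op j t\<bar>"
      unfolding norm_mult norm_of_real by (intro mult_right_mono assms) auto
    also have "\<dots> \<le> norm (B * op j t)" by (simp add: abs_mult mult_right_mono)
    finally show "norm (u t * of_real (op j t)) \<le> norm (B * op j t)" .
  qed
qed

lemma bessel_inequality:
  fixes u :: "real \<Rightarrow> real"
  assumes u: "u \<in> borel_measurable M" "\<And>t. norm (u t) \<le> B"
  shows "integrable M (\<lambda>t. (u t)\<^sup>2)" and "(\<Sum>j\<le>n. (\<integral>t. u t * op j t \<partial>M)\<^sup>2) \<le> (\<integral>t. (u t)\<^sup>2 \<partial>M)"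
proof -
  show i: "integrable M (\<lambda>t. (u t)\<^sup>2)"
  proof (rule Bochner_Integration.integrable_bound)
    show "integrable M (\<lambda>t. B\<^sup>2 * (1 :: real))"
      using one_integral by (intro integrable_mult_right) (auto simp: has_bochner_integral_iff)
    show "AE t in M. norm ((u t)\<^sup>2) \<le> norm (B\<^sup>2 * (1 :: real))"
    proof (rule AE_I2)
      fix t
      have "\<bar>u t\<bar>\<^sup>2 \<le> B\<^sup>2" using u(2)[of t] by (intro power_mono) auto
      then show "norm ((u t)\<^sup>2) \<le> norm (B\<^sup>2 * (1 :: real))" by simp
    qed
    show "(\<lambda>t. (u t)\<^sup>2) \<in> borel_measurable M"
      by (rule borel_measurable_power[OF u(1)])
  qed
  define c where "c j = (\<integral>t. u t * op j t \<partial>M)" for j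
  have c: "has_bochner_integral M (\<lambda>t. u t * op j t) (c j)" if "j \<le> n" for j
    using bounded_times_op_integrable[OF u that] by (simp add: has_bochner_integral_iff c_def)
  have "has_bochner_integral M
      (\<lambda>t. (u t)\<^sup>2 - (\<Sum>j\<le>n. 2 * c j * (u t * op j t)) + (\<Sum>i\<le>n. \<Sum>j\<le>n. (c i * c j) * (op i t * op j t)))
      ((\<integral>t. (u t)\<^sup>2 \<partial>M) - (\<Sum>j\<le>n. 2 * c j * c j) + (\<Sum>i\<le>n. \<Sum>j\<le>n. (c i * c j) * (if i = j then 1 else 0)))"
    by (intro has_bochner_integral_add has_bochner_integral_diff has_bochner_integral_sum
        has_bochner_integral_mult_right c op_op_integral has_bochner_integral_integrable[OF i]) simp_all
  moreover have "(u t)\<^sup>2 - (\<Sum>j\<le>n. 2 * c j * (u t * op j t)) + (\<Sum>i\<le>n. \<Sum>j\<le>n. (c i * c j) * (op i t * op j t))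
      = (u t - (\<Sum>j\<le>n. c j * op j t))\<^sup>2" for t
  proof -
    have "(\<Sum>j\<le>n. 2 * c j * (u t * op j t)) = 2 * u t * (\<Sum>j\<le>n. c j * op j t)"
      by (simp add: sum_distrib_left mult_ac)
    moreover have "(\<Sum>i\<le>n. \<Sum>j\<le>n. (c i * c j) * (op i t * op j t)) = (\<Sum>j\<le>n. c j * op j t)\<^sup>2"
      by (simp add: power2_eq_square sum_product mult_ac)
    ultimately show ?thesis by (simp add: power2_diff)
  qed
  moreover have "(\<Sum>i\<le>n. \<Sum>j\<le>n. (c i * c j) * (if i = j then 1 else 0)) = (\<Sum>j\<le>n. (c j)\<^sup>2)"
  proof (rule sum.cong[OF refl])
    fix i assume i: "i \<in> {..n}"
    have "(\<Sum>j\<le>n. (c i * c j) * (if i = j then 1 else 0)) = (\<Sum>j\<le>n. if i = j then c i * c j else 0)"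
      by (rule sum.cong) auto
    also have "\<dots> = (c i)\<^sup>2" using i by (simp add: power2_eq_square)
    finally show "(\<Sum>j\<le>n. (c i * c j) * (if i = j then 1 else 0)) = (c i)\<^sup>2" .
  qed
  ultimately have "has_bochner_integral M (\<lambda>t. (u t - (\<Sum>j\<le>n. c j * op j t))\<^sup>2)
      ((\<integral>t. (u t)\<^sup>2 \<partial>M) - (\<Sum>j\<le>n. 2 * c j * c j) + (\<Sum>j\<le>n. (c j)\<^sup>2))"
    by (simp only:)
  moreover have "(\<Sum>j\<le>n. 2 * c j * c j) = 2 * (\<Sum>j\<le>n. (c j)\<^sup>2)"
    by (simp add: sum_distrib_left power2_eq_square mult.assoc)
  ultimately have "(\<integral>t. (u t - (\<Sum>j\<le>n. c j * op j t))\<^sup>2 \<partial>M) = (\<integral>t. (u t)\<^sup>2 \<partial>M) - (\<Sum>j\<le>n. (c j)\<^sup>2)"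
    by (simp add: has_bochner_integral_iff)
  moreover have "0 \<le> (\<integral>t. (u t - (\<Sum>j\<le>n. c j * op j t))\<^sup>2 \<partial>M)"
    by (rule integral_nonneg_AE) simp
  ultimately show "(\<Sum>j\<le>n. (\<integral>t. u t * op j t \<partial>M)\<^sup>2) \<le> (\<integral>t. (u t)\<^sup>2 \<partial>M)" by (simp add: c_def)
qed

context
  fixes z :: complex
  assumes z: "Im z > 0"
begin

lemma second_kind_integral:
  assumes "j \<le> n"
  shows "has_bochner_integral M (\<lambda>t. of_real (op j t) / (of_real t - z)) (\<psi> M z j)"
  using bounded_times_op_integrable[OF cauchy_kernel_measurable[OF sets_M z] cauchy_kernel_bound[OF z] assms]
  by (simp add: has_bochner_integral_iff \<psi>_def)

text \<open>Bessel's inequality is applied to the real and the imaginary part of the kernel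
  separately; the two squares add up to at most 1 / (Im z)^2, and the total mass is 1.\<close>

lemma second_kind_bessel: "(\<Sum>j\<le>n. (cmod (\<psi> M z j))\<^sup>2) \<le> 1 / (Im z)\<^sup>2"
proof -
  define u where "u t = Re (1 / (of_real t - z))" for t
  define v where "v t = Im (1 / (of_real t - z))" for t
  have u: "u \<in> borel_measurable M" "\<And>t. norm (u t) \<le> 1 / Im z"
    and v: "v \<in> borel_measurable M" "\<And>t. norm (v t) \<le> 1 / Im z"
    unfolding u_def [abs_def] v_def [abs_def]
    using cauchy_kernel_measurable[OF sets_M z] order_trans[OF abs_Re_le_cmod cauchy_kernel_bound[OF z]]
      order_trans[OF abs_Im_le_cmod cauchy_kernel_bound[OF z]]
    by (simp_all del: Re_divide Im_divide)
  have re: "Re (\<psi> M z j) = (\<integral>t. u t * op j t \<partial>M)"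
    and im: "Im (\<psi> M z j) = (\<integral>t. v t * op j t \<partial>M)" if "j \<le> n" for j
  proof -
    have 1: "of_real (op j t) / (of_real t - z) = of_real (op j t) * (1 / (of_real t - z))" for t by simp
    have "Re (of_real (op j t) / (of_real t - z)) = u t * op j t"
      "Im (of_real (op j t) / (of_real t - z)) = v t * op j t" for t
      unfolding 1 u_def v_def times_complex.sel by simp_all
    then show "Re (\<psi> M z j) = (\<integral>t. u t * op j t \<partial>M)" "Im (\<psi> M z j) = (\<integral>t. v t * op j t \<partial>M)"
      using has_bochner_integral_bounded_linear[OF bounded_linear_Re second_kind_integral[OF that]]
        has_bochner_integral_bounded_linear[OF bounded_linear_Im second_kind_integral[OF that]]
      by (simp_all add: has_bochner_integral_iff)
  qed
  have "(\<Sum>j\<le>n. (cmod (\<psi> M z j))\<^sup>2)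
      = (\<Sum>j\<le>n. (\<integral>t. u t * op j t \<partial>M)\<^sup>2) + (\<Sum>j\<le>n. (\<integral>t. v t * op j t \<partial>M)\<^sup>2)"
    unfolding sum.distrib[symmetric] by (intro sum.cong refl) (simp add: cmod_power2 re im)
  also have "\<dots> \<le> (\<integral>t. (u t)\<^sup>2 \<partial>M) + (\<integral>t. (v t)\<^sup>2 \<partial>M)"
    by (intro add_mono bessel_inequality(2)[OF u] bessel_inequality(2)[OF v])
  also have "\<dots> = (\<integral>t. (u t)\<^sup>2 + (v t)\<^sup>2 \<partial>M)"
    by (rule Bochner_Integration.integral_add[symmetric] bessel_inequality(1)[OF u] bessel_inequality(1)[OF v])+
  also have "\<dots> \<le> (\<integral>t. (1 / Im z)\<^sup>2 * (1 :: real) \<partial>M)"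
  proof (rule integral_mono)
    show "integrable M (\<lambda>t. (u t)\<^sup>2 + (v t)\<^sup>2)"
      by (intro Bochner_Integration.integrable_add bessel_inequality(1)[OF u] bessel_inequality(1)[OF v])
    show "integrable M (\<lambda>t. (1 / Im z)\<^sup>2 * (1 :: real))"
      using one_integral by (intro integrable_mult_right) (auto simp: has_bochner_integral_iff)
    fix t
    have "(u t)\<^sup>2 + (v t)\<^sup>2 = (cmod (1 / (of_real t - z)))\<^sup>2"
      unfolding u_def v_def cmod_power2 ..
    also have "\<dots> \<le> (1 / Im z)\<^sup>2"
      by (intro power_mono cauchy_kernel_bound[OF z]) simp
    finally show "(u t)\<^sup>2 + (v t)\<^sup>2 \<le> (1 / Im z)\<^sup>2 * 1" by simp
  qed
  also have "\<dots> = (1 / Im z)\<^sup>2"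
    using has_bochner_integral_mult_right[OF one_integral, of "(1 / Im z)\<^sup>2"]
    by (simp only: has_bochner_integral_iff mult_1_right)
  finally show ?thesis by (simp add: power_divide)
qed

text \<open>Because t / (t - z) = 1 + z / (t - z), integrating the recurrence for t p_j against the
  kernel leaves the integral of p_j as an extra term, which is 1 for j = 0 and 0 otherwise.\<close>

lemma second_kind_recurrence:
  assumes "Suc j \<le> n"
  shows "of_real (a j) * \<psi> M z (Suc j) = (z - of_real (b j)) * \<psi> M z j
    - (if j = 0 then 0 else of_real (a (j - 1)) * \<psi> M z (j - 1)) + (if j = 0 then 1 else 0)"
proof -
  define c where "c = (if j = 0 then 0 else complex_of_real (a (j - 1)))"
  have "has_bochner_integral M (\<lambda>t. complex_of_real (op j t)) (of_real (if j = 0 then 1 else 0))"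
    using assms by (intro has_bochner_integral_of_real op_integral) auto
  then have "has_bochner_integral M (\<lambda>t. (z - of_real (b j)) * (of_real (op j t) / (of_real t - z))
      - c * (of_real (op (j - 1) t) / (of_real t - z)) + of_real (op j t))
      ((z - of_real (b j)) * \<psi> M z j - c * \<psi> M z (j - 1) + of_real (if j = 0 then 1 else 0))"
    by (intro has_bochner_integral_add has_bochner_integral_diff has_bochner_integral_mult_right
        second_kind_integral) (use assms in auto)
  moreover have "(z - of_real (b j)) * (of_real (op j t) / (of_real t - z))
      - c * (of_real (op (j - 1) t) / (of_real t - z)) + of_real (op j t)
      = of_real (a j) * (of_real (op (Suc j) t) / (of_real t - z))" for t
  proof -
    have nz: "complex_of_real t - z \<noteq> 0" using z by (auto simp: complex_eq_iff)
    have "complex_of_real (t * op j t) = of_real (a j * op (Suc j) t + b j * op j t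
        + (if j = 0 then 0 else a (j - 1) * op (j - 1) t))"
      by (simp only: op_times_x)
    then have "of_real t * of_real (op j t) = of_real (a j) * of_real (op (Suc j) t) + of_real (b j) * of_real (op j t)
        + c * complex_of_real (op (j - 1) t)"
      by (auto simp: c_def)
    then have num: "(z - of_real (b j)) * of_real (op j t) - c * of_real (op (j - 1) t)
        + (of_real t - z) * of_real (op j t) = of_real (a j) * complex_of_real (op (Suc j) t)"
      by (simp add: algebra_simps)
    have "(z - of_real (b j)) * (of_real (op j t) / (of_real t - z))
      - c * (of_real (op (j - 1) t) / (of_real t - z)) + of_real (op j t)
      = ((z - of_real (b j)) * of_real (op j t) - c * of_real (op (j - 1) t)
        + (of_real t - z) * of_real (op j t)) / (of_real t - z)"
      using nz by (simp add: add_divide_distrib diff_divide_distrib)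
    then show ?thesis unfolding num by simp
  qed
  ultimately have "has_bochner_integral M (\<lambda>t. of_real (a j) * (of_real (op (Suc j) t) / (of_real t - z)))
      ((z - of_real (b j)) * \<psi> M z j - c * \<psi> M z (j - 1) + of_real (if j = 0 then 1 else 0))"
    by (simp only:)
  moreover have "has_bochner_integral M (\<lambda>t. of_real (a j) * (of_real (op (Suc j) t) / (of_real t - z)))
      (of_real (a j) * \<psi> M z (Suc j))"
    by (intro has_bochner_integral_mult_right second_kind_integral assms)
  ultimately have "of_real (a j) * \<psi> M z (Suc j)
      = (z - of_real (b j)) * \<psi> M z j - c * \<psi> M z (j - 1) + of_real (if j = 0 then 1 else 0)"
    using has_bochner_integral_eq by blast
  then show ?thesis by (auto simp: c_def)
qed

text \<open>Beyond j = 0 both sequences obey the same recurrence, so a_j times their Casoratian is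
  constant; the inhomogeneity at j = 0 fixes the constant as 1.\<close>

lemma second_kind_wronskian:
  assumes "Suc j \<le> n"
  shows "of_real (a j) * (opc j z * \<psi> M z (Suc j) - opc (Suc j) z * \<psi> M z j) = 1"
  using assms
proof (induction j)
  case 0
  have "of_real (a 0) * (opc 0 z * \<psi> M z (Suc 0) - opc (Suc 0) z * \<psi> M z 0)
      = of_real (a 0) * \<psi> M z (Suc 0) - (of_real (a 0) * opc (Suc 0) z) * \<psi> M z 0"
    by (simp add: algebra_simps del: opc.simps(2))
  also have "of_real (a 0) * opc (Suc 0) z = z - of_real (b 0)" using a_nz by simp
  finally show ?case using second_kind_recurrence[OF 0] by simp
next
  case (Suc j)
  have r: "of_real (a (Suc j)) * opc (Suc (Suc j)) z
      = (z - of_real (b (Suc j))) * opc (Suc j) z - of_real (a j) * opc j z"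
    using a_nz by simp
  have s: "of_real (a (Suc j)) * \<psi> M z (Suc (Suc j))
      = (z - of_real (b (Suc j))) * \<psi> M z (Suc j) - of_real (a j) * \<psi> M z j"
    using second_kind_recurrence[OF Suc.prems] by simp
  have "of_real (a (Suc j)) * (opc (Suc j) z * \<psi> M z (Suc (Suc j)) - opc (Suc (Suc j)) z * \<psi> M z (Suc j))
      = opc (Suc j) z * (of_real (a (Suc j)) * \<psi> M z (Suc (Suc j)))
        - (of_real (a (Suc j)) * opc (Suc (Suc j)) z) * \<psi> M z (Suc j)"
    by (simp add: algebra_simps del: opc.simps)
  also have "\<dots> = of_real (a j) * (opc j z * \<psi> M z (Suc j) - opc (Suc j) z * \<psi> M z j)"
    unfolding r s by (simp add: algebra_simps del: opc.simps)
  finally show ?case using Suc by simp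
qed

end
end

text \<open>The difference solves the recurrence with the initial conditions of the polynomials.\<close>

lemma second_kind_diff:
  assumes M: "orthonormal_upto n M" and M': "orthonormal_upto n M'" and z: "Im z > 0" and "j \<le> n"
  shows "\<psi> M z j - \<psi> M' z j = (\<psi> M z 0 - \<psi> M' z 0) * opc j z"
proof -
  let ?d = "\<lambda>j. \<psi> M z j - \<psi> M' z j"
  show ?thesis
    using \<open>j \<le> n\<close>
  proof (induction j rule: induct_nat_012)
    case 1
    have "of_real (a 0) * (?d (Suc 0))
        = (z - of_real (b 0)) * (?d 0)"
      unfolding right_diff_distrib second_kind_recurrence[OF M z 1] second_kind_recurrence[OF M' z 1] by simp
    then have "?d (Suc 0)
        = (z - of_real (b 0)) * (?d 0) / of_real (a 0)"
      using a_nz[of 0] by (subst nonzero_eq_divide_eq) (simp_all only: of_real_eq_0_iff simp_thms mult.commute)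
    then show ?case by simp
  next
    case (ge2 j)
    have "of_real (a (Suc j)) * (?d (Suc (Suc j)))
        = (z - of_real (b (Suc j))) * (?d (Suc j))
          - of_real (a j) * (?d j)"
      unfolding right_diff_distrib second_kind_recurrence[OF M z ge2(3)] second_kind_recurrence[OF M' z ge2(3)]
      by simp
    also have "\<dots> = (?d 0)
        * ((z - of_real (b (Suc j))) * opc (Suc j) z - of_real (a j) * opc j z)"
    proof -
      have alg: "(z - \<beta>) * Y - \<alpha> * X = D * ((z - \<beta>) * y - \<alpha> * x)"
        if "X = D * x" "Y = D * y" for X Y D x y \<alpha> \<beta> :: complex
        unfolding that by (simp add: algebra_simps)
      show ?thesis by (rule alg) (use ge2 in simp_all)
    qed
    also have "(z - of_real (b (Suc j))) * opc (Suc j) z - of_real (a j) * opc j z = of_real (a (Suc j)) * opc (Suc (Suc j)) z"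
      using a_nz by simp
    finally have "of_real (a (Suc j)) * (?d (Suc (Suc j)))
        = of_real (a (Suc j)) * ((?d 0) * opc (Suc (Suc j)) z)"
      by (simp only: mult.left_commute)
    then show ?case using a_nz[of "Suc j"] by (simp only: mult_cancel_left of_real_eq_0_iff) blast
  qed simp
qed

text \<open>The difference of the two second-kind sequences is a multiple of p_j(z), yet each has
  square sum at most 1 / (Im z)^2. The constant 4 arises from |x - y|^2 \<le> 2 |x|^2 + 2
  |y|^2.\<close>

lemma stieltjes_close:
  assumes M: "orthonormal_upto n M" and M': "orthonormal_upto n M'" and z: "Im z > 0"
  shows "(cmod (\<psi> M z 0 - \<psi> M' z 0))\<^sup>2 * (\<Sum>j\<le>n. (cmod (opc j z))\<^sup>2) \<le> 4 / (Im z)\<^sup>2"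
proof -
  let ?d = "\<psi> M z 0 - \<psi> M' z 0"
  let ?s = "\<lambda>M j. (cmod (\<psi> M z j))\<^sup>2"
  have "(cmod ?d)\<^sup>2 * (\<Sum>j\<le>n. (cmod (opc j z))\<^sup>2)
      = (\<Sum>j\<le>n. (cmod (\<psi> M z j - \<psi> M' z j))\<^sup>2)"
    unfolding sum_distrib_left
  proof (intro sum.cong refl)
    fix j assume "j \<in> {..n}"
    then have "\<psi> M z j - \<psi> M' z j = ?d * opc j z"
      by (intro second_kind_diff[OF M M' z]) simp
    then show "(cmod ?d)\<^sup>2 * (cmod (opc j z))\<^sup>2
        = (cmod (\<psi> M z j - \<psi> M' z j))\<^sup>2"
      by (simp only: norm_mult power_mult_distrib)
  qed
  also have "\<dots> \<le> (\<Sum>j\<le>n. 2 * ?s M j + 2 * ?s M' j)"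
  proof (rule sum_mono)
    fix j
    define x y where "x = cmod (\<psi> M z j)" and "y = cmod (\<psi> M' z j)"
    have "(cmod (\<psi> M z j - \<psi> M' z j))\<^sup>2 \<le> (x + y)\<^sup>2"
      unfolding x_def y_def by (intro power_mono norm_triangle_ineq4) simp
    also have "\<dots> \<le> 2 * x\<^sup>2 + 2 * y\<^sup>2"
      using sum_squares_bound[of x y] by (simp add: power2_sum)
    finally show "(cmod (\<psi> M z j - \<psi> M' z j))\<^sup>2
        \<le> 2 * ?s M j + 2 * ?s M' j"
      by (simp add: x_def y_def)
  qed
  also have "\<dots> = 2 * (\<Sum>j\<le>n. ?s M j) + 2 * (\<Sum>j\<le>n. ?s M' j)"
    by (simp add: sum.distrib sum_distrib_left)
  also have "\<dots> \<le> 2 * (1 / (Im z)\<^sup>2) + 2 * (1 / (Im z)\<^sup>2)"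
    by (intro add_mono mult_left_mono second_kind_bessel M M' z) auto
  finally show ?thesis by simp
qed

text \<open>The limit-point property. By the Casoratian identity, 1 / a_j is at most half the sum of
  the squared moduli of p_j, p_{j+1} and of the two second-kind functions at these indices. The
  latter are square summable, so the Carleman condition forces the former to diverge.\<close>

lemma opc_square_sum_diverges:
  assumes M: "\<And>n. orthonormal_upto n M" and z: "Im z > 0"
    and carleman: "filterlim (\<lambda>n. \<Sum>j\<le>n. 1 / a j) at_top sequentially"
  shows "filterlim (\<lambda>n. \<Sum>j\<le>n. (cmod (opc j z))\<^sup>2) at_top sequentially"
proof -
  let ?p = "\<lambda>j. (cmod (opc j z))\<^sup>2" and ?s = "\<lambda>j. (cmod (\<psi> M z j))\<^sup>2"
  define A where "A n = (\<Sum>j\<le>n. ?p j)" for n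
  define P where "P n = (\<Sum>j\<le>n. ?s j)" for n
  have P: "P n \<le> 1 / (Im z)\<^sup>2" for n unfolding P_def by (rule second_kind_bessel[OF M z])
  have shift: "(\<Sum>j\<le>n. f (Suc j)) \<le> (\<Sum>j\<le>Suc n. f j)" "(\<Sum>j\<le>n. f j) \<le> (\<Sum>j\<le>Suc n. f j)"
    if "\<And>j. 0 \<le> f j" for f :: "nat \<Rightarrow> real" and n
  proof -
    show "(\<Sum>j\<le>n. f (Suc j)) \<le> (\<Sum>j\<le>Suc n. f j)"
      unfolding sum.atMost_Suc_shift using that[of 0] by simp
    show "(\<Sum>j\<le>n. f j) \<le> (\<Sum>j\<le>Suc n. f j)"
      using that[of "Suc n"] by simp
  qed
  have "(\<Sum>j\<le>n. 1 / a j) \<le> A (Suc n) + 1 / (Im z)\<^sup>2" for n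
  proof -
    have "1 / a j \<le> (?p j + ?p (Suc j)
        + ?s j + ?s (Suc j)) / 2" for j
    proof -
      define p0 p1 s0 s1 where "p0 = cmod (opc j z)" and "p1 = cmod (opc (Suc j) z)"
        and "s0 = cmod (\<psi> M z j)" and "s1 = cmod (\<psi> M z (Suc j))"
      let ?W = "opc j z * \<psi> M z (Suc j) - opc (Suc j) z * \<psi> M z j"
      have "of_real (a j) * ?W = 1"
        by (rule second_kind_wronskian[OF M z order_refl])
      then have "cmod (of_real (a j) * ?W) = 1"
        by (simp only: norm_one)
      then have "1 / a j = cmod ?W"
      proof -
        assume *: "cmod (of_real (a j) * ?W) = 1"
        have "a j * cmod ?W = 1"
          using * a_pos[of j] by (simp only: norm_mult norm_of_real abs_of_pos)
        then show ?thesis using a_nz[of j] by (simp add: field_simps del: opc.simps)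
      qed
      also have "\<dots> \<le> p0 * s1 + p1 * s0"
        unfolding p0_def p1_def s0_def s1_def norm_mult[symmetric] by (rule norm_triangle_ineq4)
      also have "\<dots> \<le> (p0\<^sup>2 + p1\<^sup>2 + s0\<^sup>2 + s1\<^sup>2) / 2"
        using sum_squares_bound[of p0 s1] sum_squares_bound[of p1 s0] by simp
      finally show ?thesis unfolding p0_def p1_def s0_def s1_def .
    qed
    then have "(\<Sum>j\<le>n. 1 / a j) \<le> (\<Sum>j\<le>n. (?p j + ?p (Suc j)
        + ?s j + ?s (Suc j)) / 2)"
      by (rule sum_mono)
    also have "\<dots> = ((\<Sum>j\<le>n. ?p j) + (\<Sum>j\<le>n. ?p (Suc j))
        + (\<Sum>j\<le>n. ?s j) + (\<Sum>j\<le>n. ?s (Suc j))) / 2"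
      by (simp only: sum_divide_distrib[symmetric] sum.distrib)
    also have "\<dots> \<le> (A (Suc n) + A (Suc n) + P (Suc n) + P (Suc n)) / 2"
      unfolding A_def P_def by (intro divide_right_mono add_mono shift) auto
    also have "\<dots> \<le> A (Suc n) + 1 / (Im z)\<^sup>2" using P[of "Suc n"] by simp
    finally show ?thesis .
  qed
  then have "- (1 / (Im z)\<^sup>2) + (\<Sum>j\<le>n. 1 / a j) \<le> A (Suc n)" for n
    by (simp add: algebra_simps)
  moreover have "filterlim (\<lambda>n. - (1 / (Im z)\<^sup>2) + (\<Sum>j\<le>n. 1 / a j)) at_top sequentially"
    by (rule filterlim_tendsto_add_at_top[OF tendsto_const carleman])
  ultimately have "filterlim (\<lambda>n. A (Suc n)) at_top sequentially"
    by (intro filterlim_at_top_mono[of _ sequentially "\<lambda>n. A (Suc n)"] always_eventually) auto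
  then have "filterlim A at_top sequentially"
    by (rule filterlim_sequentially_Suc[THEN iffD1])
  then show ?thesis by (simp only: A_def [abs_def])
qed

text \<open>Only positive indices are assumed for \<nu>, because orthonormality of the weights is
  established from n = 1 on.\<close>

lemma stieltjes_convergence:
  assumes M: "\<And>n. orthonormal_upto n M" and \<nu>: "\<And>n. orthonormal_upto (Suc n) (\<nu> (Suc n))" and z: "Im z > 0"
    and carleman: "filterlim (\<lambda>n. \<Sum>j\<le>n. 1 / a j) at_top sequentially"
  shows "(\<lambda>n. \<psi> (\<nu> n) z 0) \<longlonglongrightarrow> \<psi> M z 0"
proof -
  define A where "A n = (\<Sum>j\<le>n. (cmod (opc j z))\<^sup>2)" for n
  have A: "A n > 0" for n
  proof -
    have "1 \<le> A n" unfolding A_def using member_le_sum[of 0 "{..n}" "\<lambda>j. (cmod (opc j z))\<^sup>2"] by simp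
    then show ?thesis by simp
  qed
  have "(\<lambda>n. 4 / (Im z)\<^sup>2 / A n) \<longlonglongrightarrow> 0"
    using opc_square_sum_diverges[OF M z carleman] unfolding A_def [symmetric]
    by (rule real_tendsto_divide_at_top[OF tendsto_const])
  then have "(\<lambda>n. 4 / (Im z)\<^sup>2 / A (Suc n)) \<longlonglongrightarrow> 0" by (rule LIMSEQ_Suc)
  then have "(\<lambda>n. sqrt (4 / (Im z)\<^sup>2 / A (Suc n))) \<longlonglongrightarrow> sqrt 0" by (rule tendsto_real_sqrt)
  then have lim0: "(\<lambda>n. sqrt (4 / (Im z)\<^sup>2 / A (Suc n))) \<longlonglongrightarrow> 0" by simp
  have "(\<lambda>n. \<psi> (\<nu> (Suc n)) z 0 - \<psi> M z 0) \<longlonglongrightarrow> 0"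
  proof (rule Lim_null_comparison[OF always_eventually lim0], rule allI)
    fix n
    have "(cmod (\<psi> (\<nu> (Suc n)) z 0 - \<psi> M z 0))\<^sup>2 \<le> 4 / (Im z)\<^sup>2 / A (Suc n)"
      using stieltjes_close[OF \<nu> M z] A unfolding A_def by (simp only: pos_le_divide_eq)
    then show "norm (\<psi> (\<nu> (Suc n)) z 0 - \<psi> M z 0) \<le> sqrt (4 / (Im z)\<^sup>2 / A (Suc n))"
      by (rule real_le_rsqrt)
  qed
  then have "(\<lambda>n. \<psi> (\<nu> (Suc n)) z 0) \<longlonglongrightarrow> \<psi> M z 0"
    by (rule LIM_zero_cancel)
  then show ?thesis by (rule LIMSEQ_imp_Suc)
qed

end

section \<open>Poisson smoothing\<close>

definition poisson :: "real \<Rightarrow> real \<Rightarrow> real"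
  where "poisson e s = e / (pi * (s\<^sup>2 + e\<^sup>2))"

lemma poisson_pos: "e > 0 \<Longrightarrow> poisson e s > 0"
  by (simp add: poisson_def add_nonneg_pos)

lemma poisson_le:
  assumes e: "e > 0" shows "poisson e s \<le> 1 / (pi * e)"
proof -
  have "s\<^sup>2 + e\<^sup>2 > 0" using e by (simp add: add_nonneg_pos)
  moreover have "e * e \<le> s\<^sup>2 + e\<^sup>2" by (simp add: power2_eq_square)
  ultimately have "e / (s\<^sup>2 + e\<^sup>2) \<le> 1 / e"
    using e by (simp add: pos_divide_le_eq pos_le_divide_eq)
  from mult_left_mono[OF this, of "1 / pi"] show ?thesis by (simp add: poisson_def)
qed

lemma continuous_on_poisson: "e > 0 \<Longrightarrow> continuous_on S (poisson e)"
  unfolding poisson_def [abs_def]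
  by (intro continuous_intros) (simp add: add_nonneg_pos less_imp_neq[THEN not_sym])

lemma poisson_measurable: "e > 0 \<Longrightarrow> poisson e \<in> borel_measurable borel"
  by (rule borel_measurable_continuous_onI[OF continuous_on_poisson])

text \<open>After the substitution x = t + e u the error is at most the integral of
  \<open>G (e * u)\<close> against the Cauchy density, a bound independent of t that tends to 0 with
  e by dominated convergence.\<close>

lemma poisson_average_close:
  fixes f :: "real \<Rightarrow> real"
  assumes lip: "\<And>s t. \<bar>f s - f t\<bar> \<le> L * \<bar>s - t\<bar>" and bd: "\<And>t. \<bar>f t\<bar> \<le> 1" and d: "d > 0"
  shows "\<exists>e>0. \<forall>t. \<bar>(\<integral>x. f x * poisson e (x - t) \<partial>lborel) - f t\<bar> \<le> d"
proof -
  have L: "L \<ge> 0" using lip[of 1 0] by simp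
  have contf: "continuous_on UNIV f"
  proof (rule lipschitz_on_continuous_on)
    show "L-lipschitz_on UNIV f" by (rule lipschitz_onI) (use lip L in \<open>auto simp: dist_real_def\<close>)
  qed
  have [measurable]: "f \<in> borel_measurable borel" by (rule borel_measurable_continuous_onI[OF contf])
  \<comment> \<open>The cut-off at 2, available because |f| \<le> 1, supplies an integrable
    majorant; |u| itself is not integrable against the Cauchy density.\<close>
  define G where "G s = min (L * \<bar>s\<bar>) 2" for s :: real
  have G: "\<bar>f (t + s) - f t\<bar> \<le> G s" for s t
    using lip[of "t + s" t] bd[of t] bd[of "t + s"] by (auto simp: G_def)
  have Gn: "0 \<le> G s" "G s \<le> 2" for s using L by (auto simp: G_def)
  have [measurable]: "G \<in> borel_measurable borel" unfolding G_def [abs_def] by measurable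
  define c where "c u = inverse (1 + u\<^sup>2) / pi" for u :: real
  have c_pos: "c u > 0" for u by (simp add: c_def add_pos_nonneg)
  have ci: "has_bochner_integral lborel c 1"
    using integrable_inverse_1_plus_square_lborel integral_inverse_1_plus_square_lborel
    unfolding has_bochner_integral_iff c_def [abs_def] by simp
  have [measurable]: "c \<in> borel_measurable borel"
    using ci by (auto simp: has_bochner_integral_iff dest: borel_measurable_integrable)
  have c_int: "integrable lborel c" using ci by (simp add: has_bochner_integral_iff)
  have Gc_int: "integrable lborel (\<lambda>u. G (e * u) * c u)" for e
  proof (rule Bochner_Integration.integrable_bound[OF integrable_mult_right[OF c_int, of 2]])
    show "AE u in lborel. norm (G (e * u) * c u) \<le> norm (2 * c u)"
      using Gn c_pos by (intro AE_I2) (auto simp: abs_mult intro!: mult_right_mono)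
  qed simp
  have "(\<lambda>k. \<integral>u. G (1 / real (Suc k) * u) * c u \<partial>lborel) \<longlonglongrightarrow> (\<integral>u. 0 \<partial>(lborel :: real measure))"
  proof (rule integral_dominated_convergence)
    show "integrable lborel (\<lambda>u. 2 * c u)" by (rule integrable_mult_right[OF c_int])
    show "AE u in lborel. norm (G (1 / real (Suc k) * u) * c u) \<le> 2 * c u" for k
      using Gn c_pos by (intro AE_I2) (auto simp: abs_mult less_imp_le intro!: mult_mono)
    show "AE u in lborel. (\<lambda>k. G (1 / real (Suc k) * u) * c u) \<longlonglongrightarrow> 0"
    proof (rule AE_I2)
      fix u
      have l: "(\<lambda>k. 1 / real (Suc k)) \<longlonglongrightarrow> 0"
        using LIMSEQ_inverse_real_of_nat by (simp add: inverse_eq_divide)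
      have "(\<lambda>k. min (L * \<bar>1 / real (Suc k) * u\<bar>) 2 * c u) \<longlonglongrightarrow> min (L * \<bar>0 * u\<bar>) 2 * c u"
        by (intro tendsto_mult_right tendsto_min tendsto_mult_left tendsto_rabs tendsto_const l)
      then show "(\<lambda>k. G (1 / real (Suc k) * u) * c u) \<longlonglongrightarrow> 0" by (simp add: G_def)
    qed
  qed simp_all
  then have "\<forall>\<^sub>F k in sequentially. (\<integral>u. G (1 / real (Suc k) * u) * c u \<partial>lborel) < d"
    using order_tendstoD(2)[of _ 0 sequentially d] d by simp
  then obtain k where k: "(\<integral>u. G (1 / real (Suc k) * u) * c u \<partial>lborel) < d"
    unfolding eventually_sequentially by blast
  define e where "e = 1 / real (Suc k)"
  have e: "e > 0" by (simp add: e_def)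
  let ?P = "\<lambda>t. \<integral>x. f x * poisson e (x - t) \<partial>lborel"
  have "\<bar>?P t - f t\<bar> \<le> d" for t
  proof -
    have "?P t = \<bar>e\<bar> *\<^sub>R (\<integral>u. f (t + e * u) * poisson e (t + e * u - t) \<partial>lborel)"
      using e by (intro lborel_integral_real_affine) simp
    also have "\<dots> = (\<integral>u. f (t + e * u) * c u \<partial>lborel)"
    proof -
      have c_eq: "c u = e * poisson e (t + e * u - t)" for u
        using e by (simp add: poisson_def c_def power2_eq_square divide_simps add_nonneg_eq_0_iff)
          (simp add: algebra_simps)
      have "f (t + e * u) * c u = e * (f (t + e * u) * poisson e (t + e * u - t))" for u
        unfolding c_eq by (rule mult.left_commute)
      then have "(\<integral>u. f (t + e * u) * c u \<partial>lborel) = (\<integral>u. e * (f (t + e * u) * poisson e (t + e * u - t)) \<partial>lborel)"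
        by (simp only:)
      then show ?thesis using e by (simp only: integral_mult_right_zero abs_of_pos real_scaleR_def)
    qed
    finally have 1: "?P t = (\<integral>u. f (t + e * u) * c u \<partial>lborel)" .
    have fi: "integrable lborel (\<lambda>u. f (t + e * u) * c u)"
    proof (rule Bochner_Integration.integrable_bound[OF c_int])
      show "AE u in lborel. norm (f (t + e * u) * c u) \<le> norm (c u)"
        using bd by (intro AE_I2) (simp add: abs_mult mult_left_le_one_le)
    qed measurable
    have 2: "f t = (\<integral>u. f t * c u \<partial>lborel)" using ci by (simp add: has_bochner_integral_iff)
    have "?P t - f t = (\<integral>u. f (t + e * u) * c u - f t * c u \<partial>lborel)"
      unfolding 1 using fi c_int by (subst 2) (simp add: Bochner_Integration.integral_diff)
    also have "\<bar>\<dots>\<bar> \<le> (\<integral>u. G (e * u) * c u \<partial>lborel)"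
    proof (rule integral_abs_bound_integral)
      show "integrable lborel (\<lambda>u. f (t + e * u) * c u - f t * c u)"
        using fi c_int by simp
      show "\<bar>f (t + e * u) * c u - f t * c u\<bar> \<le> G (e * u) * c u" for u
        using G[of t "e * u"] c_pos[of u] by (simp add: left_diff_distrib[symmetric] abs_mult)
    qed (rule Gc_int)
    also have "\<dots> \<le> d" using k by (simp add: e_def)
    finally show ?thesis .
  qed
  then show ?thesis using e by blast
qed

text \<open>Fubini moves the measure onto the kernel; the double integral converges absolutely
  because f is integrable and the kernel is bounded by 1 / (pi e).\<close>

lemma poisson_average_integral:
  fixes f :: "real \<Rightarrow> real"
  assumes M: "prob_space M" "sets M = sets borel" and e: "e > 0"
    and f: "integrable lborel f"
  shows "integrable M (\<lambda>t. \<integral>x. f x * poisson e (x - t) \<partial>lborel)"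
    and "(\<integral>t. (\<integral>x. f x * poisson e (x - t) \<partial>lborel) \<partial>M) = (\<integral>x. f x * (\<integral>t. poisson e (x - t) \<partial>M) \<partial>lborel)"
proof -
  interpret M: prob_space M by (rule M)
  interpret pair_sigma_finite lborel M by standard
  note [measurable_cong] = M(2)
  note [measurable] = poisson_measurable[OF e]
  have [measurable]: "f \<in> borel_measurable borel" using borel_measurable_integrable[OF f] by simp
  have b: "\<bar>poisson e s\<bar> \<le> 1 / (pi * e)" for s
    using poisson_le[OF e, of s] poisson_pos[OF e, of s] by simp
  have inner: "integrable M (\<lambda>t. poisson e (x - t))" for x
    by (rule M.integrable_const_bound[where B = "1 / (pi * e)"]) (use b in auto)
  have int: "integrable (lborel \<Otimes>\<^sub>M M) (\<lambda>(x, t). f x * poisson e (x - t))"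
  proof (rule Fubini_integrable)
    show "integrable lborel (\<lambda>x. \<integral>t. norm (case (x, t) of (x, t) \<Rightarrow> f x * poisson e (x - t)) \<partial>M)"
    proof (rule Bochner_Integration.integrable_bound[OF integrable_mult_left[OF f, of "1 / (pi * e)"]])
      show "AE x in lborel. norm (\<integral>t. norm (case (x, t) of (x, t) \<Rightarrow> f x * poisson e (x - t)) \<partial>M)
          \<le> norm (f x * (1 / (pi * e)))"
      proof (rule AE_I2)
        fix x
        have "(\<integral>t. norm (f x * poisson e (x - t)) \<partial>M) \<le> (\<integral>t. norm (f x * (1 / (pi * e))) \<partial>M)"
        proof (rule integral_mono)
          show "norm (f x * poisson e (x - t)) \<le> norm (f x * (1 / (pi * e)))" for t
            unfolding norm_mult by (rule mult_left_mono) (use b e in auto)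
          show "integrable M (\<lambda>t. norm (f x * poisson e (x - t)))"
            by (intro integrable_norm integrable_mult_right inner)
        qed simp
        then show "norm (\<integral>t. norm (case (x, t) of (x, t) \<Rightarrow> f x * poisson e (x - t)) \<partial>M)
          \<le> norm (f x * (1 / (pi * e)))"
          by (simp add: M.prob_space)
      qed
    qed measurable
    show "AE x in lborel. integrable M (\<lambda>t. case (x, t) of (x, t) \<Rightarrow> f x * poisson e (x - t))"
      using inner by (intro AE_I2) simp
  qed measurable
  show "integrable M (\<lambda>t. \<integral>x. f x * poisson e (x - t) \<partial>lborel)"
    using integrable_snd[OF int] by simp
  have "(\<integral>t. (\<integral>x. f x * poisson e (x - t) \<partial>lborel) \<partial>M) = (\<integral>x. (\<integral>t. f x * poisson e (x - t) \<partial>M) \<partial>lborel)"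
    using Fubini_integral[OF int] .
  then show "(\<integral>t. (\<integral>x. f x * poisson e (x - t) \<partial>lborel) \<partial>M) = (\<integral>x. f x * (\<integral>t. poisson e (x - t) \<partial>M) \<partial>lborel)"
    by simp
qed

lemma poisson_Im: "e > 0 \<Longrightarrow> poisson e (x - t) = Im (1 / (of_real t - Complex x e)) / pi"
  by (simp add: poisson_def Im_divide power2_commute divide_simps)

text \<open>Replacing f by its Poisson average costs at most d / 4 for every probability measure at
  once. The averaged integrals converge by dominated convergence, with a multiple of |f| as
  majorant, and the three errors of d / 4 stay below d.\<close>

lemma weak_convergence_from_poisson:
  fixes f :: "real \<Rightarrow> real"
  assumes M: "prob_space M" "sets M = sets borel"
    and \<nu>: "\<And>n. prob_space (\<nu> n)" "\<And>n. sets (\<nu> n) = sets borel"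
    and lip: "\<And>s t. \<bar>f s - f t\<bar> \<le> L * \<bar>s - t\<bar>" and bd: "\<And>t. \<bar>f t\<bar> \<le> 1"
    and f: "integrable lborel f"
    and conv: "\<And>e x. e > 0 \<Longrightarrow> (\<lambda>n. \<integral>t. poisson e (x - t) \<partial>\<nu> n) \<longlonglongrightarrow> (\<integral>t. poisson e (x - t) \<partial>M)"
  shows "(\<lambda>n. \<integral>t. f t \<partial>\<nu> n) \<longlonglongrightarrow> (\<integral>t. f t \<partial>M)"
proof (rule LIMSEQ_I)
  fix d :: real assume d: "d > 0"
  have [measurable]: "f \<in> borel_measurable borel" using borel_measurable_integrable[OF f] by simp
  obtain e where e: "e > 0" "\<And>t. \<bar>(\<integral>x. f x * poisson e (x - t) \<partial>lborel) - f t\<bar> \<le> d / 4"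
    using poisson_average_close[OF lip bd, of "d / 4"] d by auto
  let ?I = "\<lambda>m. \<integral>x. f x * (\<integral>t. poisson e (x - t) \<partial>m) \<partial>lborel"
  have close: "\<bar>?I m - (\<integral>t. f t \<partial>m)\<bar> \<le> d / 4"
    if m: "prob_space m" "sets m = sets borel" for m
  proof -
    interpret m: prob_space m by (rule m)
    note [measurable_cong] = m(2)
    have fi: "integrable m f"
      by (rule m.integrable_const_bound[where B = 1]) (use bd in auto)
    note P = poisson_average_integral[OF m e(1) f]
    have "?I m - (\<integral>t. f t \<partial>m)
        = (\<integral>t. (\<integral>x. f x * poisson e (x - t) \<partial>lborel) - f t \<partial>m)"
      unfolding P(2)[symmetric] by (rule Bochner_Integration.integral_diff[OF P(1) fi, symmetric])
    also have "\<bar>\<dots>\<bar> \<le> (\<integral>t. d / 4 \<partial>m)"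
      by (rule integral_abs_bound_integral) (use P(1) fi e(2) in auto)
    finally show ?thesis by (simp add: m.prob_space)
  qed
  have "(\<lambda>n. ?I (\<nu> n)) \<longlonglongrightarrow> ?I M"
  proof (rule integral_dominated_convergence)
    have meas: "(\<lambda>x. f x * (\<integral>t. poisson e (x - t) \<partial>m)) \<in> borel_measurable lborel"
      if m: "prob_space m" "sets m = sets borel" for m
    proof -
      interpret m: prob_space m by (rule m)
      note [measurable_cong] = m(2)
      note [measurable] = poisson_measurable[OF e(1)]
      show ?thesis by measurable
    qed
    show "(\<lambda>x. f x * (\<integral>t. poisson e (x - t) \<partial>M)) \<in> borel_measurable lborel" by (rule meas[OF M])
    show "(\<lambda>x. f x * (\<integral>t. poisson e (x - t) \<partial>\<nu> n)) \<in> borel_measurable lborel" for n by (rule meas[OF \<nu>])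
    show "integrable lborel (\<lambda>x. norm (f x) * (1 / (pi * e)))"
      by (intro integrable_mult_left integrable_norm f)
    show "AE x in lborel. norm (f x * (\<integral>t. poisson e (x - t) \<partial>\<nu> n)) \<le> norm (f x) * (1 / (pi * e))" for n
    proof (rule AE_I2)
      fix x
      interpret m: prob_space "\<nu> n" by (rule \<nu>)
      note [measurable_cong] = \<nu>(2)
      note [measurable] = poisson_measurable[OF e(1)]
      have b: "\<bar>poisson e s\<bar> \<le> 1 / (pi * e)" for s
        using poisson_le[OF e(1), of s] poisson_pos[OF e(1), of s] by simp
      have "\<bar>\<integral>t. poisson e (x - t) \<partial>\<nu> n\<bar> \<le> (\<integral>t. 1 / (pi * e) \<partial>\<nu> n)"
        by (rule integral_abs_bound_integral[OF m.integrable_const_bound[where B = "1 / (pi * e)"]]) (use b in auto)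
      then have "\<bar>\<integral>t. poisson e (x - t) \<partial>\<nu> n\<bar> \<le> 1 / (pi * e)" by (simp add: m.prob_space)
      then show "norm (f x * (\<integral>t. poisson e (x - t) \<partial>\<nu> n)) \<le> norm (f x) * (1 / (pi * e))"
        unfolding norm_mult by (intro mult_left_mono) auto
    qed
    show "AE x in lborel. (\<lambda>n. f x * (\<integral>t. poisson e (x - t) \<partial>\<nu> n)) \<longlonglongrightarrow> f x * (\<integral>t. poisson e (x - t) \<partial>M)"
      by (intro AE_I2 tendsto_mult tendsto_const conv e)
  qed
  from LIMSEQ_D[OF this, of "d / 4"] d obtain n0 where n0: "\<And>n. n \<ge> n0 \<Longrightarrow>
    \<bar>?I (\<nu> n) - ?I M\<bar> < d / 4"
    by auto
  have "norm ((\<integral>t. f t \<partial>\<nu> n) - (\<integral>t. f t \<partial>M)) < d" if "n \<ge> n0" for n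
    using n0[OF that] close[OF \<nu>, of n] close[OF M] d unfolding real_norm_def by linarith
  then show "\<exists>no. \<forall>n\<ge>no. norm ((\<integral>t. f t \<partial>\<nu> n) - (\<integral>t. f t \<partial>M)) < d" by blast
qed

section \<open>Averages\<close>

text \<open>The terms before \<open>J\<close> contribute at most the fixed amount \<open>S\<close>,
  which the divergent total weight absorbs; all later terms are within e / 2 of the limit.\<close>

lemma weighted_cesaro_uniform:
  fixes c :: "nat \<Rightarrow> real \<Rightarrow> real" and w :: "nat \<Rightarrow> real"
  assumes w: "\<And>j. w j > 0" and div: "filterlim (\<lambda>n. \<Sum>j\<le>n. w j) at_top sequentially"
    and lim: "uniform_limit K c g sequentially"
    and bd: "\<And>j. \<exists>B. \<forall>x\<in>K. \<bar>c j x - g x\<bar> \<le> B"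
  shows "uniform_limit K (\<lambda>n x. inverse (\<Sum>j\<le>n. w j) * (\<Sum>j\<le>n. w j * c j x)) g sequentially"
  unfolding uniform_limit_iff
proof (intro allI impI)
  fix e :: real assume e: "e > 0"
  define A where "A n = (\<Sum>j\<le>n. w j)" for n
  have A: "A n > 0" for n unfolding A_def by (intro sum_pos w) auto
  have "\<forall>\<^sub>F n in sequentially. \<forall>x\<in>K. dist (c n x) (g x) < e / 2"
    using lim e unfolding uniform_limit_iff by (meson half_gt_zero)
  then obtain J where J: "\<And>j x. j \<ge> J \<Longrightarrow> x \<in> K \<Longrightarrow> \<bar>c j x - g x\<bar> \<le> e / 2"
    unfolding eventually_sequentially by (force simp: dist_real_def less_imp_le)
  obtain B where B: "\<And>j x. x \<in> K \<Longrightarrow> \<bar>c j x - g x\<bar> \<le> B j"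
    using bd by metis
  define S where "S = (\<Sum>j<J. w j * \<bar>B j\<bar>)"
  have "\<forall>\<^sub>F n in sequentially. 2 * S / e < A n"
    using div unfolding A_def filterlim_at_top_dense by blast
  then show "\<forall>\<^sub>F n in sequentially. \<forall>x\<in>K. dist (inverse (\<Sum>j\<le>n. w j) * (\<Sum>j\<le>n. w j * c j x)) (g x) < e"
    using eventually_ge_at_top[of J]
  proof eventually_elim
    case (elim n)
    show ?case
    proof
      fix x assume x: "x \<in> K"
      have "(\<Sum>j\<le>n. w j * c j x) - A n * g x = (\<Sum>j\<le>n. w j * (c j x - g x))"
        unfolding A_def by (simp add: sum_distrib_right sum_subtractf right_diff_distrib)
      then have "\<bar>(\<Sum>j\<le>n. w j * c j x) - A n * g x\<bar> \<le> (\<Sum>j\<le>n. w j * \<bar>c j x - g x\<bar>)"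
        using sum_abs[of "\<lambda>j. w j * (c j x - g x)" "{..n}"] w by (simp add: abs_mult less_imp_le)
      also have "\<dots> \<le> (\<Sum>j\<le>n. w j * (e / 2) + (if j < J then w j * \<bar>B j\<bar> else 0))"
      proof (rule sum_mono)
        fix j
        show "w j * \<bar>c j x - g x\<bar> \<le> w j * (e / 2) + (if j < J then w j * \<bar>B j\<bar> else 0)"
        proof (cases "j < J")
          case True
          have "w j * \<bar>c j x - g x\<bar> \<le> w j * \<bar>B j\<bar>"
            using B[OF x, of j] w[of j] by (intro mult_left_mono) auto
          also have "\<dots> \<le> w j * (e / 2) + w j * \<bar>B j\<bar>" using w[of j] e by simp
          finally show ?thesis using True by simp
        next
          case False
          then show ?thesis using J[of j x] x w[of j] by (simp add: mult_left_mono less_imp_le)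
        qed
      qed
      also have "\<dots> = A n * (e / 2) + (\<Sum>j\<le>n. if j < J then w j * \<bar>B j\<bar> else 0)"
        by (simp add: sum.distrib A_def sum_distrib_right)
      also have "(\<Sum>j\<le>n. if j < J then w j * \<bar>B j\<bar> else 0) \<le> S"
      proof -
        have "{..n} \<inter> {j. j < J} = {..<J}" using elim by auto
        then show ?thesis unfolding S_def by (simp add: sum.If_cases)
      qed
      also have "S < A n * (e / 2)" using elim(1) e by (simp add: field_simps)
      finally have "\<bar>(\<Sum>j\<le>n. w j * c j x) - A n * g x\<bar> < A n * e" by (simp add: mult.commute)
      then have "\<bar>(\<Sum>j\<le>n. w j * c j x) - A n * g x\<bar> / A n < e"
        using A[of n] by (simp add: field_simps)
      moreover have "inverse (A n) * (\<Sum>j\<le>n. w j * c j x) - g x = ((\<Sum>j\<le>n. w j * c j x) - A n * g x) / A n"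
        using A[of n] by (simp add: field_simps)
      ultimately show "dist (inverse (\<Sum>j\<le>n. w j) * (\<Sum>j\<le>n. w j * c j x)) (g x) < e"
        using A[of n] unfolding A_def[symmetric] dist_real_def by (simp add: abs_divide)
    qed
  qed
qed

lemma uniform_limit_mult_bounded:
  fixes f u :: "nat \<Rightarrow> real \<Rightarrow> real"
  assumes f: "uniform_limit K f (\<lambda>_. 0) sequentially"
    and u: "\<forall>\<^sub>F n in sequentially. \<forall>x\<in>K. \<bar>u n x\<bar> \<le> B"
  shows "uniform_limit K (\<lambda>n x. f n x * u n x) (\<lambda>_. 0) sequentially"
  unfolding uniform_limit_iff
proof (intro allI impI)
  fix e :: real assume "e > 0"
  then have "e / (\<bar>B\<bar> + 1) > 0" by simp
  then have "\<forall>\<^sub>F n in sequentially. \<forall>x\<in>K. dist (f n x) 0 < e / (\<bar>B\<bar> + 1)"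
    using f unfolding uniform_limit_iff by blast
  then show "\<forall>\<^sub>F n in sequentially. \<forall>x\<in>K. dist (f n x * u n x) 0 < e"
    using u
  proof eventually_elim
    case (elim n)
    show ?case
    proof
      fix x assume x: "x \<in> K"
      have "\<bar>f n x * u n x\<bar> \<le> \<bar>f n x\<bar> * (\<bar>B\<bar> + 1)"
        using elim(2) x unfolding abs_mult by (intro mult_left_mono) auto
      also have "\<dots> < e / (\<bar>B\<bar> + 1) * (\<bar>B\<bar> + 1)"
        using elim(1) x by (intro mult_strict_right_mono) auto
      finally show "dist (f n x * u n x) 0 < e" by simp
    qed
  qed
qed

lemma uniform_limit_of_const:
  fixes f :: "nat \<Rightarrow> real"
  assumes "f \<longlonglongrightarrow> l" shows "uniform_limit K (\<lambda>n x. f n) (\<lambda>_. l) sequentially"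
  using assms unfolding uniform_limit_iff tendsto_iff by (auto elim!: eventually_mono)

section \<open>From the energies to the sums of squares\<close>

context jacobi
begin

lemma U_ge: "(1 - \<bar>q\<bar> / 2) * (a n * (op n x)\<^sup>2 + a n * (op (Suc n) x)\<^sup>2) \<le> U n x"
proof -
  define u v where "u = op n x" and "v = op (Suc n) x"
  have "2 * \<bar>u * v\<bar> \<le> u\<^sup>2 + v\<^sup>2"
    using sum_squares_bound[of "\<bar>u\<bar>" "\<bar>v\<bar>"] by (simp add: abs_mult)
  then have "\<bar>q\<bar> * (2 * \<bar>u * v\<bar>) \<le> \<bar>q\<bar> * (u\<^sup>2 + v\<^sup>2)" by (intro mult_left_mono) auto
  moreover have "- (q * u * v) \<le> \<bar>q\<bar> * \<bar>u * v\<bar>" using abs_ge_minus_self[of "q * u * v"] by (simp add: abs_mult mult.assoc)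
  ultimately have "(1 - \<bar>q\<bar> / 2) * (u\<^sup>2 + v\<^sup>2) \<le> u\<^sup>2 + q * u * v + v\<^sup>2" by (simp add: algebra_simps)
  from mult_left_mono[OF this, of "a n"] show ?thesis
    using a_pos[of n] by (simp add: U_def u_def v_def algebra_simps)
qed

lemma christoffel_average:
  assumes g: "continuous_on UNIV g" and lim: "\<And>R. uniform_limit {-R..R} U g sequentially"
    and carleman: "filterlim (\<lambda>n. \<Sum>j\<le>n. 1 / a j) at_top sequentially"
  shows "uniform_limit {-R..R} (\<lambda>n x. inverse (\<Sum>j\<le>n. 1 / a j) * (\<Sum>j\<le>n. (op j x)\<^sup>2))
    (\<lambda>x. 2 * g x / (4 - q\<^sup>2)) sequentially"
proof -
  let ?K = "{-R..R}"
  let ?ev = "\<lambda>P. \<forall>\<^sub>F n::nat in sequentially. \<forall>x\<in>?K. P n x"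
  let ?ul = "\<lambda>f l. uniform_limit ?K f l sequentially"
  let ?sq = "\<lambda>n x. a n * (op n x)\<^sup>2" and ?sq' = "\<lambda>n x. a n * (op (Suc n) x)\<^sup>2"
  let ?pr = "\<lambda>n x. a n * (op n x * op (Suc n) x)"
  let ?A = "\<lambda>n. inverse (\<Sum>j\<le>n. 1 / a j)"
  let ?X = "\<lambda>n x. (1 - a n / a (Suc n)) * ?pr n x"
  note limR = lim[of R]
  have bounded_cont: "\<exists>B. \<forall>x\<in>?K. \<bar>f x\<bar> \<le> B" if "continuous_on ?K f" for f :: "real \<Rightarrow> real"
  proof -
    have "bounded (f ` ?K)" by (intro compact_imp_bounded compact_continuous_image that) simp
    then show ?thesis unfolding bounded_iff by auto
  qed
  have gK: "continuous_on ?K g" using continuous_on_subset[OF g] by blast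
  obtain B where B: "\<And>x. x \<in> ?K \<Longrightarrow> \<bar>g x\<bar> \<le> B" using bounded_cont[OF gK] by blast
  have evU: "\<forall>\<^sub>F n in sequentially. \<forall>x\<in>?K. U n x \<le> B + 1"
  proof -
    have "\<forall>\<^sub>F n in sequentially. \<forall>x\<in>?K. dist (U n x) (g x) < 1"
      using limR unfolding uniform_limit_iff by (meson zero_less_one)
    then show ?thesis
      by eventually_elim (use B in \<open>fastforce simp: dist_real_def\<close>)
  qed
  define \<delta> where "\<delta> = 1 - \<bar>q\<bar> / 2"
  have \<delta>: "\<delta> > 0" using q_less by (simp add: \<delta>_def)
  define C where "C = (B + 1) / \<delta>"
  have evS: "\<forall>\<^sub>F n in sequentially. \<forall>x\<in>?K. ?sq n x + ?sq' n x \<le> C"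
    using evU
  proof eventually_elim
    case (elim n)
    show ?case
    proof
      fix x assume "x \<in> ?K"
      then have "\<delta> * (?sq n x + ?sq' n x) \<le> B + 1"
        using elim U_ge[of n x] unfolding \<delta>_def by fastforce
      then show "?sq n x + ?sq' n x \<le> C"
        using \<delta> by (simp add: C_def field_simps)
    qed
  qed
  have evsq: "\<forall>\<^sub>F n in sequentially. \<forall>x\<in>?K. \<bar>?sq n x\<bar> \<le> C"
    using evS
  proof eventually_elim
    case (elim n)
    show ?case
    proof
      fix x assume "x \<in> ?K"
      then have "?sq n x + ?sq' n x \<le> C" using elim by blast
      moreover have "0 \<le> ?sq n x" "0 \<le> ?sq' n x" using a_pos[of n] by simp_all
      ultimately show "\<bar>?sq n x\<bar> \<le> C" by linarith
    qed
  qed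
  have evpr: "\<forall>\<^sub>F n in sequentially. \<forall>x\<in>?K. \<bar>?pr n x\<bar> \<le> C"
    using evS
  proof eventually_elim
    case (elim n)
    have "\<bar>?pr n x\<bar> \<le> ?sq n x + ?sq' n x" for x
    proof -
      have "2 * (\<bar>op n x\<bar> * \<bar>op (Suc n) x\<bar>) \<le> (op n x)\<^sup>2 + (op (Suc n) x)\<^sup>2"
        using sum_squares_bound[of "\<bar>op n x\<bar>" "\<bar>op (Suc n) x\<bar>"] by (simp add: mult.assoc)
      moreover have "0 \<le> \<bar>op n x\<bar> * \<bar>op (Suc n) x\<bar>" by simp
      ultimately have "\<bar>op n x\<bar> * \<bar>op (Suc n) x\<bar> \<le> (op n x)\<^sup>2 + (op (Suc n) x)\<^sup>2" by linarith
      from mult_left_mono[OF this, of "a n"] show ?thesis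
        using a_pos[of n] by (simp add: abs_mult distrib_left)
    qed
    then show ?case using elim by (meson order_trans)
  qed
  \<comment> \<open>This equals (x - b_{n+1}) / a_{n+1} + q, the deviation of the recurrence
    coefficient from its limit - q.\<close>
  define \<beta> where "\<beta> n x = x * (1 / a (Suc n)) - (b (Suc n) / a (Suc n) - q)" for n x
  have limb: "(\<lambda>n. b (Suc n) / a (Suc n) - q) \<longlonglongrightarrow> 0"
    using tendsto_diff[OF LIMSEQ_Suc[OF ba_lim] tendsto_const[of q]] by simp
  have lima: "(\<lambda>n. 1 / a (Suc n)) \<longlonglongrightarrow> 0"
    using LIMSEQ_Suc[OF real_tendsto_divide_at_top[OF tendsto_const a_top]] .
  have x_bd: "\<forall>\<^sub>F n::nat in sequentially. \<forall>x\<in>?K. \<bar>x\<bar> \<le> \<bar>R\<bar>"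
    by (intro always_eventually) auto
  have "?ul (\<lambda>n x. 1 / a (Suc n) * x - (b (Suc n) / a (Suc n) - q)) (\<lambda>x. 0 - 0)"
    by (intro uniform_limit_minus uniform_limit_mult_bounded[OF uniform_limit_of_const[OF lima] x_bd]
        uniform_limit_of_const[OF limb])
  then have lim\<beta>: "?ul \<beta> (\<lambda>_. 0)"
    by (simp add: \<beta>_def [abs_def] mult.commute)
  have limr: "(\<lambda>n. 1 - a n / a (Suc n)) \<longlonglongrightarrow> 0"
    using tendsto_diff[OF tendsto_const[of 1] a_ratio] by simp
  have limr': "(\<lambda>n. a (Suc n) / a n - 1) \<longlonglongrightarrow> 0"
    using tendsto_diff[OF tendsto_inverse[OF a_ratio] tendsto_const[of 1]] by simp
  \<comment> \<open>The correction \<kappa>' is chosen so that a_{n+1} y_{n+1} = U_{n+1} - (q / 2)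
    a_{n+1} t with t = p_{n+1} (p_{n+2} + q p_{n+1} + p_n). The bracket is the defect in the
    limiting recurrence and hence small, while the increments of \<kappa>' telescope in sums;
    \<open>k\<close> is what remains as coefficient of p_{n+1}^2.\<close>
  define k where "k = 2 - q\<^sup>2 / 2"
  define \<kappa>' where "\<kappa>' n x = (op (Suc n) x)\<^sup>2 + q / 2 * (op n x * op (Suc n) x)" for n x
  define y where "y j x = (case j of 0 \<Rightarrow> k * (op 0 x)\<^sup>2
    | Suc n \<Rightarrow> k * (op (Suc n) x)\<^sup>2 + \<kappa>' (Suc n) x - \<kappa>' n x)" for j x
  have cont_y: "continuous_on S (y j)" for j S
    unfolding y_def [abs_def] \<kappa>'_def [abs_def] by (cases j) (auto intro!: continuous_intros)
  have y_Suc: "a (Suc n) * y (Suc n) x = U (Suc n) x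
      - q / 2 * (\<beta> n x * (?sq (Suc n) x)
        + ?X n x
        + (a (Suc n) / a n - 1) * (?X n x))" for n x
  proof -
    define t where "t = op (Suc n) x * op (Suc (Suc n)) x + q * (op (Suc n) x)\<^sup>2 + op n x * op (Suc n) x"
    have t: "a (Suc n) * t = \<beta> n x * (?sq (Suc n) x)
        + (1 - a n / a (Suc n)) * (a (Suc n) * (op n x * op (Suc n) x))"
      using a_nz[of "Suc n"] unfolding t_def \<beta>_def op_Suc_Suc
      by (simp add: field_simps power2_eq_square)
    \<comment> \<open>The product p_n p_{n+1} is controlled with the weight a_n, so a_{n+1} is
      rewritten by means of a_{n+1} / a_n.\<close>
    have "a (Suc n) * (op n x * op (Suc n) x)
        = (1 + (a (Suc n) / a n - 1)) * (?pr n x)"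
      using a_nz[of n] by simp
    then have t': "a (Suc n) * t = \<beta> n x * (?sq (Suc n) x)
        + ?X n x
        + (a (Suc n) / a n - 1) * (?X n x)"
      unfolding t by (simp only: distrib_right distrib_left mult_1 mult.left_commute add.assoc)
    have y_eq: "y (Suc n) x = (op (Suc n) x)\<^sup>2 + q * op (Suc n) x * op (Suc (Suc n)) x + (op (Suc (Suc n)) x)\<^sup>2 - q / 2 * t"
      unfolding y_def \<kappa>'_def t_def k_def by (simp add: field_simps power2_eq_square)
    have "a (Suc n) * y (Suc n) x = U (Suc n) x - q / 2 * (a (Suc n) * t)"
      unfolding U_def y_eq by (simp only: right_diff_distrib mult.left_commute)
    then show ?thesis unfolding t' .
  qed
  have evsq': "\<forall>\<^sub>F n in sequentially. \<forall>x\<in>?K. \<bar>?sq (Suc n) x\<bar> \<le> C"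
    using evsq eventually_sequentially_Suc[of "\<lambda>n. \<forall>x\<in>?K. \<bar>?sq n x\<bar> \<le> C"] by blast
  have l1: "?ul (\<lambda>n x. ?X n x) (\<lambda>_. 0)"
    by (rule uniform_limit_mult_bounded[OF uniform_limit_of_const[OF limr] evpr])
  have "\<forall>\<^sub>F n in sequentially. \<forall>x\<in>?K. \<bar>?X n x\<bar> \<le> 1"
  proof -
    have "\<forall>\<^sub>F n in sequentially. \<forall>x\<in>?K. dist (?X n x) 0 < 1"
      using l1 unfolding uniform_limit_iff by (meson zero_less_one)
    then show ?thesis by eventually_elim (auto simp: less_imp_le)
  qed
  note l2 = uniform_limit_mult_bounded[OF uniform_limit_of_const[OF limr'] this]
  note l3 = uniform_limit_mult_bounded[OF lim\<beta> evsq']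
  have limU': "?ul (\<lambda>n. U (Suc n)) g"
    using limR filterlim_sequentially_Suc[of U] by blast
  have evq: "\<forall>\<^sub>F n::nat in sequentially. \<forall>x\<in>?K. \<bar>q / 2\<bar> \<le> \<bar>q / 2\<bar>" by simp
  have "?ul (\<lambda>n x. U (Suc n) x
      - (\<beta> n x * (?sq (Suc n) x)
        + ?X n x
        + (a (Suc n) / a n - 1) * (?X n x)) * (q / 2))
      (\<lambda>x. g x - 0)"
    by (intro uniform_limit_minus limU' uniform_limit_mult_bounded[OF _ evq])
      (use uniform_limit_add[OF uniform_limit_add[OF l3 l1] l2] in simp)
  then have "?ul (\<lambda>n x. a (Suc n) * y (Suc n) x) g"
    by (simp add: y_Suc mult.commute)
  then have lim_y: "?ul (\<lambda>n x. a n * y n x) g"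
    using filterlim_sequentially_Suc[of "\<lambda>n x. a n * y n x"] by blast
  have "?ul (\<lambda>n x. ?A n * (\<Sum>j\<le>n. 1 / a j * (a j * y j x))) g"
  proof (rule weighted_cesaro_uniform[OF _ carleman lim_y])
    show "\<exists>B. \<forall>x\<in>?K. \<bar>a j * y j x - g x\<bar> \<le> B" for j
      by (intro bounded_cont continuous_intros cont_y gK)
  qed (use a_pos in simp)
  then have lim1: "?ul (\<lambda>n x. ?A n * (\<Sum>j\<le>n. y j x)) g"
    using a_nz by simp
  have sum_y: "(\<Sum>j\<le>n. y j x) = k * (\<Sum>j\<le>n. (op j x)\<^sup>2) + \<kappa>' n x - \<kappa>' 0 x" for n x
    by (induction n) (simp_all add: y_def algebra_simps)
  have eventually_ge_1: "\<forall>\<^sub>F n in sequentially. 1 \<le> a n"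
    using a_top unfolding filterlim_at_top by blast
  have inv0: "(\<lambda>n. ?A n) \<longlonglongrightarrow> 0"
    by (rule tendsto_inverse_0_at_top[OF carleman])
  have "continuous_on ?K (\<kappa>' 0)" unfolding \<kappa>'_def [abs_def] by (intro continuous_intros)
  then obtain C0 where C0: "\<And>x. x \<in> ?K \<Longrightarrow> \<bar>\<kappa>' 0 x\<bar> \<le> C0"
    using bounded_cont by blast
  \<comment> \<open>The telescoped remainder stays bounded, because the squares and products are
    bounded even with the factor a_n, and a_n \<ge> 1 eventually. Division by the divergent sum of 1
    / a_j removes it.\<close>
  have ev\<kappa>: "\<forall>\<^sub>F n in sequentially. \<forall>x\<in>?K. \<bar>\<kappa>' n x - \<kappa>' 0 x\<bar> \<le> 2 * C + C0"
    using evS evpr eventually_ge_1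
  proof eventually_elim
    case (elim n)
    show ?case
    proof
      fix x assume x: "x \<in> ?K"
      have "(op (Suc n) x)\<^sup>2 \<le> ?sq' n x"
        using elim(3) by (intro mult_right_mono[of 1 "a n", simplified]) auto
      moreover have "0 \<le> ?sq n x" using a_pos[of n] by simp
      ultimately have 1: "(op (Suc n) x)\<^sup>2 \<le> C" using bspec[OF elim(1) x] by linarith
      have "\<bar>op n x * op (Suc n) x\<bar> \<le> a n * \<bar>op n x * op (Suc n) x\<bar>"
        using elim(3) by (intro mult_right_mono[of 1 "a n", simplified]) auto
      also have "\<dots> = \<bar>?pr n x\<bar>" using a_pos[of n] by (simp add: abs_mult)
      also have "\<dots> \<le> C" using elim(2) x by blast
      finally have "\<bar>q / 2\<bar> * \<bar>op n x * op (Suc n) x\<bar> \<le> 1 * C"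
        using q_less by (intro mult_mono) auto
      then have 2: "\<bar>q / 2 * (op n x * op (Suc n) x)\<bar> \<le> C"
        by (simp only: abs_mult mult_1)
      have "0 \<le> (op (Suc n) x)\<^sup>2" by simp
      with 1 2 C0[OF x] show "\<bar>\<kappa>' n x - \<kappa>' 0 x\<bar> \<le> 2 * C + C0"
        unfolding \<kappa>'_def[of n] by linarith
    qed
  qed
  note l4 = uniform_limit_mult_bounded[OF uniform_limit_of_const[OF inv0] ev\<kappa>]
  have "?ul (\<lambda>n x. ?A n * (\<Sum>j\<le>n. y j x)
      - ?A n * (\<kappa>' n x - \<kappa>' 0 x)) (\<lambda>x. g x - 0)"
    by (rule uniform_limit_minus[OF lim1 l4])
  moreover have "inverse A * (\<Sum>j\<le>n. y j x) - inverse A * (\<kappa>' n x - \<kappa>' 0 x)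
      = k * (inverse A * (\<Sum>j\<le>n. (op j x)\<^sup>2))" for A n x
    unfolding sum_y by (simp add: algebra_simps)
  ultimately have "?ul (\<lambda>n x. k * (?A n * (\<Sum>j\<le>n. (op j x)\<^sup>2))) g"
    by simp
  from bounded_linear.uniform_limit[OF bounded_linear_mult_right[of "1 / k"] this]
  have "?ul (\<lambda>n x. 1 / k * (k * (?A n * (\<Sum>j\<le>n. (op j x)\<^sup>2))))
      (\<lambda>x. 1 / k * g x)" .
  moreover have "k = (4 - q\<^sup>2) / 2" "k \<noteq> 0" using q2 by (simp_all add: k_def field_simps)
  ultimately show ?thesis by simp
qed


section \<open>The weights as probability measures\<close>

lemma orthonormal_upto_prob_space:
  assumes "orthonormal_upto n M" shows "prob_space M"
proof
  have "has_bochner_integral M (\<lambda>_. 1 :: real) 1" by (rule one_integral[OF assms])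
  then have "(\<integral>\<^sup>+x. ennreal 1 \<partial>M) = ennreal 1"
    by (subst nn_integral_eq_integral) (auto simp: has_bochner_integral_iff)
  then show "emeasure M (space M) = 1" by simp
qed

lemma continuous_on_szego: "continuous_on S (szego n)"
  unfolding szego_def [abs_def]
  by (intro continuous_intros continuous_on_U) (use U_pos in \<open>simp add: less_imp_neq[THEN not_sym]\<close>)

lemma szego_pos: "szego n x > 0"
  unfolding szego_def using U_pos Im_\<sigma>_pos by simp

lemma szego_measurable [measurable]: "szego n \<in> borel_measurable borel"
  by (rule borel_measurable_continuous_onI[OF continuous_on_szego])

lemma szego_orthonormal_upto:
  assumes "n = Suc m" shows "orthonormal_upto n (density lborel (\<lambda>x. ennreal (szego n x)))"
  unfolding orthonormal_upto_def
proof (intro conjI allI impI)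
  fix i j assume ij: "i \<le> n" "j \<le> n"
  have [measurable]: "op k \<in> borel_measurable borel" for k by (rule op_measurable) simp
  have h: "has_bochner_integral lborel (\<lambda>x. szego n x *\<^sub>R (op i x * op j x)) (if i = j then 1 else 0)"
    using szego_orthonormal[OF assms ij] by (simp add: mult.commute)
  show "has_bochner_integral (density lborel (\<lambda>x. ennreal (szego n x))) (\<lambda>x. op i x * op j x) (if i = j then 1 else 0)"
    by (rule has_bochner_integral_density[OF _ _ _ h])
      (use szego_pos in \<open>auto simp: less_imp_le\<close>)
qed simp

text \<open>The Poisson kernel is the imaginary part of the Cauchy kernel divided by pi, so
  convergence of Stieltjes transforms becomes the pointwise convergence on which the weak limit
  rests.\<close>

lemma poisson_integral_second_kind:
  assumes M: "orthonormal_upto n M" and e: "e > 0"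
  shows "(\<integral>t. poisson e (x - t) \<partial>M) = Im (\<psi> M (Complex x e) 0) / pi"
proof -
  have "has_bochner_integral M (\<lambda>t. of_real (op 0 t) / (of_real t - Complex x e)) (\<psi> M (Complex x e) 0)"
    by (rule second_kind_integral[OF M]) (use e in auto)
  from has_bochner_integral_bounded_linear[OF bounded_linear_Im this]
  have "has_bochner_integral M (\<lambda>t. Im (1 / (of_real t - Complex x e))) (Im (\<psi> M (Complex x e) 0))"
    by simp
  from has_bochner_integral_divide_zero[OF this, of pi]
  show ?thesis by (simp only: poisson_Im[OF e] has_bochner_integral_integral_eq)
qed

end

section \<open>Identification of the density\<close>

text \<open>For l \<le> u and k \<ge> 1 the function is 1 on [l, u] and falls with slope k to 0 at
  distance 1 / k. It is Lipschitz with compact support, as the Poisson argument demands, and tends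
  to the indicator of the interval.\<close>

definition trapezoid :: "real \<Rightarrow> real \<Rightarrow> nat \<Rightarrow> real \<Rightarrow> real"
  where "trapezoid l u k x = max 0 (1 - real k * max 0 (max (l - x) (x - u)))"

lemma trapezoid_lipschitz: "\<bar>trapezoid l u k s - trapezoid l u k t\<bar> \<le> real k * \<bar>s - t\<bar>"
proof -
  define d where "d x = max 0 (max (l - x) (x - u))" for x
  have "\<bar>d s - d t\<bar> \<le> \<bar>s - t\<bar>" unfolding d_def by linarith
  then have "real k * \<bar>d s - d t\<bar> \<le> real k * \<bar>s - t\<bar>" by (intro mult_left_mono) auto
  then have "\<bar>real k * d s - real k * d t\<bar> \<le> real k * \<bar>s - t\<bar>"
    by (simp add: abs_mult flip: right_diff_distrib)
  then show ?thesis unfolding trapezoid_def d_def[symmetric] by linarith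
qed

lemma trapezoid_bounds: "0 \<le> trapezoid l u k x" "trapezoid l u k x \<le> 1"
proof -
  have "0 \<le> real k * max 0 (max (l - x) (x - u))" by simp
  then show "0 \<le> trapezoid l u k x" "trapezoid l u k x \<le> 1" unfolding trapezoid_def by linarith+
qed

lemma continuous_on_trapezoid: "continuous_on S (trapezoid l u k)"
  unfolding trapezoid_def [abs_def] by (intro continuous_intros)

lemma trapezoid_support:
  assumes "x \<notin> {l - 1..u + 1}" shows "trapezoid l u (Suc k) x = 0"
proof -
  have "1 \<le> max 0 (max (l - x) (x - u))" using assms by auto
  then have "1 * 1 \<le> real (Suc k) * max 0 (max (l - x) (x - u))" by (intro mult_mono) auto
  then show ?thesis unfolding trapezoid_def by simp
qed

lemma trapezoid_tendsto: "(\<lambda>k. trapezoid l u (Suc k) x) \<longlonglongrightarrow> indicator {l..u} x"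
proof (cases "x \<in> {l..u}")
  case True
  then show ?thesis by (simp add: trapezoid_def)
next
  case False
  define d where "d = max 0 (max (l - x) (x - u))"
  have d: "d > 0" using False by (auto simp: d_def)
  obtain m :: nat where m: "1 / d < real m" using reals_Archimedean2 by blast
  have "trapezoid l u (Suc k) x = 0" if "k \<ge> m" for k
  proof -
    have "1 / d \<le> real (Suc k)" using m that by linarith
    then have "1 \<le> real (Suc k) * d" using d by (simp add: pos_divide_le_eq)
    then show ?thesis unfolding trapezoid_def d_def[symmetric] by simp
  qed
  then have "\<forall>\<^sub>F k in sequentially. trapezoid l u (Suc k) x = indicator {l..u} x"
    unfolding eventually_sequentially using False by auto
  then show ?thesis by (rule tendsto_eventually)
qed

text \<open>Closed intervals are stable under intersection and generate the Borel sets, and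
  \<open>M\<close> is finite on each [-n, n]. As integrability of \<open>w\<close> is at hand on
  bounded intervals only, the passage to indicators relies on the common support
  [l - 1, u + 1].\<close>

lemma measure_eqI_trapezoid:
  assumes M: "prob_space M" "sets M = sets borel"
    and w: "continuous_on UNIV w" "\<And>x. 0 < w x"
    and eq: "\<And>l u k. (\<integral>t. trapezoid l u (Suc k) t \<partial>M) = (\<integral>t. trapezoid l u (Suc k) t * w t \<partial>lborel)"
  shows "M = density lborel (\<lambda>x. ennreal (w x))"
proof -
  interpret M: prob_space M by (rule M)
  note [measurable_cong] = M(2)
  have [measurable]: "w \<in> borel_measurable borel" by (rule borel_measurable_continuous_onI[OF w(1)])
  have [measurable]: "trapezoid l u k \<in> borel_measurable borel" for l u k
    by (rule borel_measurable_continuous_onI[OF continuous_on_trapezoid])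
  have int_w: "integrable lborel (\<lambda>t. indicator {l..u} t * w t)" for l u :: real
    using borel_integrable_compact[of "{l..u}" w] continuous_on_subset[OF w(1)] by simp
  have Icc: "emeasure M {l..u} = emeasure (density lborel (\<lambda>x. ennreal (w x))) {l..u}" for l u :: real
  proof -
    have "(\<lambda>k. \<integral>t. trapezoid l u (Suc k) t \<partial>M) \<longlonglongrightarrow> (\<integral>t. indicator {l..u} t \<partial>M)"
      by (rule integral_dominated_convergence[where w = "\<lambda>_. 1"])
        (use trapezoid_bounds trapezoid_tendsto in auto)
    moreover have "(\<lambda>k. \<integral>t. trapezoid l u (Suc k) t * w t \<partial>lborel) \<longlonglongrightarrow> (\<integral>t. indicator {l..u} t * w t \<partial>lborel)"
    proof (rule integral_dominated_convergence)
      show "integrable lborel (\<lambda>t. indicator {l - 1..u + 1} t * w t)" by (rule int_w)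
      show "AE t in lborel. (\<lambda>k. trapezoid l u (Suc k) t * w t) \<longlonglongrightarrow> indicator {l..u} t * w t"
        by (intro AE_I2 tendsto_mult tendsto_const trapezoid_tendsto)
      show "AE t in lborel. norm (trapezoid l u (Suc k) t * w t) \<le> indicator {l - 1..u + 1} t * w t" for k
      proof (rule AE_I2)
        fix t
        show "norm (trapezoid l u (Suc k) t * w t) \<le> indicator {l - 1..u + 1} t * w t"
          using trapezoid_bounds[of l u "Suc k" t] w(2)[of t] trapezoid_support[of t l u k]
          by (cases "t \<in> {l - 1..u + 1}") (auto simp: abs_mult mult_le_cancel_right1)
      qed
    qed measurable
    ultimately have "(\<integral>t. indicator {l..u} t \<partial>M) = (\<integral>t. indicator {l..u} t * w t \<partial>lborel)"
      unfolding eq using LIMSEQ_unique by blast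
    then have 1: "measure M {l..u} = (\<integral>t. indicator {l..u} t * w t \<partial>lborel)" by simp
    have "emeasure (density lborel (\<lambda>x. ennreal (w x))) {l..u} = (\<integral>\<^sup>+t. ennreal (w t) * indicator {l..u} t \<partial>lborel)"
      by (subst emeasure_density) auto
    also have "\<dots> = (\<integral>\<^sup>+t. ennreal (indicator {l..u} t * w t) \<partial>lborel)"
      by (intro nn_integral_cong) (auto simp: indicator_def)
    also have "\<dots> = ennreal (\<integral>t. indicator {l..u} t * w t \<partial>lborel)"
      by (rule nn_integral_eq_integral[OF int_w]) (use w(2) in \<open>auto simp: less_imp_le\<close>)
    finally show ?thesis using 1 by (simp add: M.emeasure_eq_measure)
  qed
  show ?thesis
  proof (rule measure_eqI_generator_eq[where \<Omega> = UNIV and E = "range (\<lambda>(a, b). {a..b})"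
      and A = "\<lambda>n. {- real n..real n}"])
    show "Int_stable (range (\<lambda>(a, b). {a..b :: real}))"
      by (auto simp: Int_stable_def)
    show "sets M = sigma_sets UNIV (range (\<lambda>(a, b). {a..b}))"
      "sets (density lborel (\<lambda>x. ennreal (w x))) = sigma_sets UNIV (range (\<lambda>(a, b). {a..b}))"
      unfolding M(2) sets_density sets_lborel by (subst borel_eq_atLeastAtMost, simp)+
    show "(\<Union>n. {- real n..real n}) = UNIV"
    proof -
      have "x \<in> (\<Union>n. {- real n..real n})" for x
      proof -
        obtain n where "\<bar>x\<bar> < real n" using reals_Archimedean2 by blast
        then have "x \<in> {- real n..real n}" by auto
        then show ?thesis by blast
      qed
      then show ?thesis by blast
    qed
    show "emeasure M X = emeasure (density lborel (\<lambda>x. ennreal (w x))) X" if "X \<in> range (\<lambda>(a, b). {a..b})" for X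
      using that Icc by auto
  qed (auto simp: M.emeasure_eq_measure)
qed

context jacobi
begin

text \<open>Integrals of a trapezoid against the n-th weight have two limits: the integral under
  \<open>M\<close>, by the Stieltjes transforms, and the one with density \<open>w\<close>, by
  uniform convergence of the weights on the compact support.\<close>

lemma density_formula:
  assumes M: "\<And>n. orthonormal_upto n M"
    and g: "continuous_on UNIV g" "\<And>x. g x > 0" and lim: "\<And>R. uniform_limit {-R..R} U g sequentially"
    and carleman: "filterlim (\<lambda>n. \<Sum>j\<le>n. 1 / a j) at_top sequentially"
  shows "is_continuous_density M (\<lambda>x. Im \<sigma> / (pi * g x))"
proof -
  define w where "w x = Im \<sigma> / (pi * g x)" for x
  have w: "continuous_on UNIV w" "w x > 0" for x
    unfolding w_def [abs_def] using g Im_\<sigma>_pos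
    by (auto intro!: continuous_intros simp: less_imp_neq[THEN not_sym])
  have limw: "uniform_limit {-R..R} szego w sequentially" for R
  proof (cases "R \<ge> 0")
    case True
    have gR: "continuous_on {-R..R} g" using continuous_on_subset[OF g(1)] by blast
    \<comment> \<open>Inversion preserves uniform convergence because g has a positive minimum on
      the interval, which is nonempty for R \<ge> 0.\<close>
    obtain y where y: "\<And>x. x \<in> {-R..R} \<Longrightarrow> g y \<le> g x"
      using continuous_attains_inf[OF compact_Icc _ gR] True by fastforce
    have "uniform_limit {-R..R} (\<lambda>n x. inverse (U n x)) (inverse \<circ> g) sequentially"
      by (rule uniform_lim_inverse[OF lim, of _ "g y"]) (use y g(2) in \<open>auto simp: abs_of_pos\<close>)
    from bounded_linear.uniform_limit[OF bounded_linear_mult_right[of "Im \<sigma> / pi"] this]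
    show ?thesis by (simp add: szego_def [abs_def] w_def [abs_def] divide_simps)
  qed simp
  define \<nu> where "\<nu> n = density lborel (\<lambda>x. ennreal (szego n x))" for n
  have \<nu>: "orthonormal_upto (Suc n) (\<nu> (Suc n))" for n
    unfolding \<nu>_def by (rule szego_orthonormal_upto) simp
  have sets_\<nu>: "sets (\<nu> n) = sets borel" for n by (simp add: \<nu>_def)
  have sets_M: "sets M = sets borel" using M by (simp add: orthonormal_upto_def)
  have "(\<integral>t. trapezoid l u (Suc k) t \<partial>M) = (\<integral>t. trapezoid l u (Suc k) t * w t \<partial>lborel)" for l u k
  proof -
    define f where "f = trapezoid l u (Suc k)"
    define R where "R = max \<bar>l - 1\<bar> \<bar>u + 1\<bar>"
    have f0: "f x = 0" if "x \<notin> {-R..R}" for x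
      unfolding f_def by (rule trapezoid_support) (use that in \<open>auto simp: R_def\<close>)
    have contf: "continuous_on S f" for S unfolding f_def by (rule continuous_on_trapezoid)
    have supp: "integrable lborel (\<lambda>x. f x * v x)" if "continuous_on UNIV v" for v
    proof -
      have "integrable lborel (\<lambda>x. indicator {-R..R} x *\<^sub>R (f x * v x))"
        by (intro borel_integrable_compact continuous_intros contf continuous_on_subset[OF that]) auto
      moreover have "indicator {-R..R} x *\<^sub>R (f x * v x) = f x * v x" for x
        using f0[of x] by (cases "x \<in> {-R..R}") simp_all
      ultimately show ?thesis by (simp only:)
    qed
    have fint: "integrable lborel f" using supp[of "\<lambda>_. 1"] by simp
    have "(\<lambda>n. \<integral>t. f t \<partial>\<nu> (Suc n)) \<longlonglongrightarrow> (\<integral>t. f t \<partial>M)"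
    proof (rule weak_convergence_from_poisson)
      show "prob_space M" using orthonormal_upto_prob_space[OF M] .
      show "prob_space (\<nu> (Suc n))" for n using orthonormal_upto_prob_space[OF \<nu>] .
      show "\<bar>f s - f t\<bar> \<le> real (Suc k) * \<bar>s - t\<bar>" for s t unfolding f_def by (rule trapezoid_lipschitz)
      show "\<bar>f t\<bar> \<le> 1" for t using trapezoid_bounds[of l u "Suc k" t] by (simp add: f_def)
      show "(\<lambda>n. \<integral>t. poisson e (x - t) \<partial>\<nu> (Suc n)) \<longlonglongrightarrow> (\<integral>t. poisson e (x - t) \<partial>M)" if e: "e > 0" for e x
        unfolding poisson_integral_second_kind[OF \<nu> e] poisson_integral_second_kind[OF M e]
        by (intro tendsto_divide tendsto_Im tendsto_const LIMSEQ_Suc[OF stieltjes_convergence[OF M \<nu> _ carleman]])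
          (use e in auto)
    qed (use sets_\<nu> sets_M fint in auto)
    moreover have "(\<lambda>n. \<integral>t. f t \<partial>\<nu> (Suc n)) \<longlonglongrightarrow> (\<integral>t. f t * w t \<partial>lborel)"
    proof (rule LIMSEQ_Suc, rule LIMSEQ_I)
      fix e :: real assume e: "e > 0"
      \<comment> \<open>The interval has length 2 R; the added 1 covers R = 0 and makes the final
        inequality strict.\<close>
      define d where "d = e / (2 * R + 1)"
      have R: "R \<ge> 0" by (simp add: R_def)
      have d: "d > 0" using e R by (simp add: d_def)
      have [measurable]: "f \<in> borel_measurable borel" by (rule borel_measurable_continuous_onI[OF contf])
      have "\<forall>\<^sub>F n in sequentially. \<forall>x\<in>{-R..R}. dist (szego n x) (w x) < d"
        using limw d unfolding uniform_limit_iff by blast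
      then obtain n0 where n0: "\<And>n x. n \<ge> n0 \<Longrightarrow> x \<in> {-R..R} \<Longrightarrow> \<bar>szego n x - w x\<bar> \<le> d"
        unfolding eventually_sequentially by (force simp: dist_real_def less_imp_le)
      have "norm ((\<integral>t. f t \<partial>\<nu> n) - (\<integral>t. f t * w t \<partial>lborel)) < e" if n: "n \<ge> n0" for n
      proof -
        have "(\<integral>t. f t \<partial>\<nu> n) = (\<integral>t. szego n t *\<^sub>R f t \<partial>lborel)"
          unfolding \<nu>_def using szego_pos by (intro integral_density) (auto simp: less_imp_le)
        then have "(\<integral>t. f t \<partial>\<nu> n) - (\<integral>t. f t * w t \<partial>lborel) = (\<integral>t. f t * szego n t - f t * w t \<partial>lborel)"
          by (simp add: Bochner_Integration.integral_diff[OF supp[OF continuous_on_szego] supp[OF w(1)]] mult.commute)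
        also have "\<bar>\<dots>\<bar> \<le> (\<integral>t. indicator {-R..R} t * d \<partial>lborel)"
        proof (rule integral_abs_bound_integral)
          show "integrable lborel (\<lambda>t. f t * szego n t - f t * w t)"
            by (intro Bochner_Integration.integrable_diff supp continuous_on_szego w)
          show "integrable lborel (\<lambda>t. indicator {-R..R} t * d)"
            using borel_integrable_compact[of "{-R..R}" "\<lambda>_. d"] by simp
          show "\<bar>f t * szego n t - f t * w t\<bar> \<le> indicator {-R..R} t * d" for t
          proof (cases "t \<in> {-R..R}")
            case True
            have "\<bar>f t * szego n t - f t * w t\<bar> = f t * \<bar>szego n t - w t\<bar>"
              using trapezoid_bounds[of l u "Suc k" t] by (simp add: f_def abs_mult flip: right_diff_distrib)
            also have "\<dots> \<le> 1 * d"
              using trapezoid_bounds[of l u "Suc k" t] n0[OF n True] by (intro mult_mono) (auto simp: f_def)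
            finally show ?thesis using True by simp
          qed (simp add: f0)
        qed
        also have "\<dots> = 2 * R * d" using R by simp
        also have "\<dots> < e" using e R by (simp add: d_def field_simps)
        finally show ?thesis by simp
      qed
      then show "\<exists>n0. \<forall>n\<ge>n0. norm ((\<integral>t. f t \<partial>\<nu> n) - (\<integral>t. f t * w t \<partial>lborel)) < e" by blast
    qed
    ultimately show ?thesis unfolding f_def by (rule LIMSEQ_unique)
  qed
  then have "M = density lborel (\<lambda>x. ennreal (w x))"
    by (intro measure_eqI_trapezoid orthonormal_upto_prob_space[OF M] sets_M w)
  then show ?thesis
    using w unfolding is_continuous_density_def w_def by blast
qed

end

theorem corollary4p16:
  fixes N r :: nat and a b :: "nat \<Rightarrow> real" and q :: real and \<mu> :: "real measure"
  assumes "N \<ge> 1" and "r \<ge> 1"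
    and "\<And>n. a n > 0"
    and "\<And>i. i < N \<Longrightarrow> (\<lambda>j. a ((j + 1) * N + i - 1) / a ((j + 1) * N + i)) \<in> stolz_class r"
    and "\<And>i. i < N \<Longrightarrow> (\<lambda>j. b (j * N + i) / a (j * N + i)) \<in> stolz_class r"
    and "\<And>i. i < N \<Longrightarrow> (\<lambda>j. 1 / a (j * N + i)) \<in> stolz_class r"
    and "(\<lambda>n. a n / a (Suc n)) \<longlonglongrightarrow> 1"
    and "(\<lambda>n. b n / a n) \<longlonglongrightarrow> q"
    and "filterlim a at_top sequentially"
    and "\<bar>q\<bar> < 2"
    and "q \<notin> {2 * cos (real j * (pi / real N)) | j. 1 \<le> j \<and> j < N}"
    and "filterlim (\<lambda>n. \<Sum>j\<le>n. 1 / a j) at_top sequentially"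
    and "orthonormality_measure a b \<mu>"
  shows "\<forall>K. compact K \<longrightarrow>
    uniform_limit K
      (\<lambda>n x. inverse (\<Sum>j\<le>n. 1 / a j) * (\<Sum>j\<le>n. (poly (orth_poly a b j) x)\<^sup>2))
      (\<lambda>x. 1 / (pi * sqrt (4 - q\<^sup>2) * continuous_density \<mu> x))
      sequentially"
proof (intro allI impI)
  fix K :: "real set" assume K: "compact K"
  interpret jacobi a b q
    by standard (use assms in auto)
  obtain g where g: "continuous_on UNIV g" "\<And>x. g x > 0" "\<And>R. uniform_limit {-R..R} U g sequentially"
    using U_uniform_limit[OF ln_U_uniform_limit_stolz[OF assms(1,2,4,5,6,11)]] by blast
  have "orthonormal_upto n \<mu>" for n
    using assms(13) by (simp add: orthonormal_upto_def orthonormality_measure_def op_def)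
  then have "is_continuous_density \<mu> (\<lambda>x. Im \<sigma> / (pi * g x))"
    by (rule density_formula[OF _ g assms(12)])
  then have dens: "continuous_density \<mu> = (\<lambda>x. Im \<sigma> / (pi * g x))"
    by (rule continuous_density_eqI)
  \<comment> \<open>Since Im \<sigma> = sqrt (4 - q^2) / 2, the root occurs twice, in the claim and
    in the density; the product 4 - q^2 is the denominator in the limit of the averages.\<close>
  have eq: "1 / (pi * sqrt (4 - q\<^sup>2) * continuous_density \<mu> x) = 2 * g x / (4 - q\<^sup>2)" for x
  proof -
    have s: "sqrt (4 - q\<^sup>2) * sqrt (4 - q\<^sup>2) = 4 - q\<^sup>2" using q2 by simp
    have "pi * sqrt (4 - q\<^sup>2) * continuous_density \<mu> x = sqrt (4 - q\<^sup>2) * sqrt (4 - q\<^sup>2) / (2 * g x)"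
      unfolding dens Im_\<sigma> using g(2)[of x] by (simp add: field_simps)
    then show ?thesis unfolding s by simp
  qed
  obtain R where R: "\<And>x. x \<in> K \<Longrightarrow> \<bar>x\<bar> \<le> R"
    using compact_imp_bounded[OF K] unfolding bounded_iff by auto
  have "K \<subseteq> {-R..R}" using R by (force simp: abs_le_iff)
  from uniform_limit_on_subset[OF christoffel_average[OF g(1,3) assms(12)] this]
  show "uniform_limit K
      (\<lambda>n x. inverse (\<Sum>j\<le>n. 1 / a j) * (\<Sum>j\<le>n. (poly (orth_poly a b j) x)\<^sup>2))
      (\<lambda>x. 1 / (pi * sqrt (4 - q\<^sup>2) * continuous_density \<mu> x)) sequentially"
    unfolding eq by (simp add: op_def)
qed

end
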